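(* Let $c\ge1$. The image of the morphism $\varphi:S^c\mathbb A^4\to\mathcal M_0(\mathbb P^3;0,c)$ is an irreducible component of $\mathcal M_0(\mathbb P^3;0,c)$ of dimension $4c$.
   Context: $k$ is an algebraically closed field and $V$ is a $k$-vector space of dimension $c$. Let $x_0,x_1$ be a basis of $H^0(\mathbb P^1,\mathcal O(1))$. The scheme of ADHM $(0,c)$-data for $\mathbb P^1$ is the scheme $\tilde\mu^{-1}(0)$ of pairs $(\tilde B_1,\tilde B_2)$ with $\tilde B_1,\tilde B_2\in\mathrm{End}(V)\otimes H^0(\mathbb P^1,\mathcal O(1))$ and $[\tilde B_1,\tilde B_2]=0$ in $\mathrm{End}(V)\otimes H^0(\mathbb P^1,\mathcal O(2))$; $\mathrm{GL}(V)$ acts on it by simultaneous conjugation. Writing $\tilde B_k=B_{1k}\otimes x_0+B_{2k}\otimes x_1$, the equations are $[B_{11},B_{12}]=0$, $[B_{21},B_{22}]=0$, $[B_{11},B_{22}]+[B_{21},B_{12}]=0$. $\mathcal M_0(\mathbb P^3;0,c)=\tilde\mu^{-1}(0)/\mathrm{GL}(V)=\mathrm{Spec}\,k[\tilde\mu^{-1}(0)]^{\mathrm{GL}(V)}$ is the affine GIT quotient (the moduli space of perverse instantons of rank $0$). The subscheme of $\tilde\mu^{-1}(0)$ where all four matrices $B_{11},B_{12},B_{21},B_{22}$ commute with each other is the scheme of $c$-dimensional module structures over $k[y_1,y_2,z_1,z_2]$, the coordinate ring of $\mathbb A^4$. The morphism $\varphi:S^c\mathbb A^4\to\mathcal M_0(\mathbb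 P^3;0,c)$ from the $c$-th symmetric power of $\mathbb A^4$ is the morphism induced by taking direct sums of $c$ one-dimensional modules: the class of $(p_1,\dots,p_c)$, $p_l\in\mathbb A^4$, is sent to the class of the quadruple of diagonal $c\times c$ matrices whose $l$-th diagonal entries are the coordinates of $p_l$. *)

theory Defs
  imports
    "HOL-Analysis.Analysis"
    "HOL-Algebra.Algebra"
    "HOL-Algebra.Algebraic_Closure_Type"
    "HOL-Library.Poly_Mapping"
begin

no_notation fps_nth (infixl "$" 75)

section \<open>Irreducible components and dimension of a topological space\<close>

definition irreducible_in :: "'a topology \<Rightarrow> 'a set \<Rightarrow> bool" where
  "irreducible_in T S \<longleftrightarrow> S \<subseteq> topspace T \<and> S \<noteq> {} \<and>
     (\<forall>C D. closedin (subtopology T S) C \<and> closedin (subtopology T S) D \<and> S = C \<union> D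
        \<longrightarrow> C = S \<or> D = S)"

definition irreducible_component :: "'a topology \<Rightarrow> 'a set \<Rightarrow> bool" where
  "irreducible_component T S \<longleftrightarrow>
     irreducible_in T S \<and> (\<forall>S'. irreducible_in T S' \<and> S \<subseteq> S' \<longrightarrow> S' = S)"

text \<open>The value on the empty space is \<open>0\<close> rather than the customary \<open>-\<infinity>\<close>.\<close>

definition krull_dim :: "'a topology \<Rightarrow> enat" where
  "krull_dim T = Sup {enat n | n. \<exists>Z :: nat \<Rightarrow> 'a set.
     (\<forall>i\<le>n. closedin T (Z i) \<and> irreducible_in T (Z i)) \<and> (\<forall>i<n. Z i \<subset> Z (Suc i))}"


section \<open>Prime spectra with the Zariski topology\<close>

definition spectrum :: "('a, 'b) ring_scheme \<Rightarrow> 'a set set" where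
  "spectrum R = {P. primeideal P R}"

definition Spec :: "('a, 'b) ring_scheme \<Rightarrow> 'a set topology" where
  "Spec R = topology (\<lambda>U. \<exists>S \<subseteq> carrier R. U = {P \<in> spectrum R. \<not> S \<subseteq> P})"

lemma istopology_Spec:
  "istopology (\<lambda>U. \<exists>S \<subseteq> carrier R. U = {P \<in> spectrum R. \<not> S \<subseteq> P})"
  (is "istopology ?open")
proof -
  have "?open (U \<inter> V)" if U: "?open U" and V: "?open V" for U V
  proof -
    obtain A B where A: "A \<subseteq> carrier R" "U = {P \<in> spectrum R. \<not> A \<subseteq> P}"
      and B: "B \<subseteq> carrier R" "V = {P \<in> spectrum R. \<not> B \<subseteq> P}"
      using U V by blast
    define AB where "AB = {a \<otimes>\<^bsub>R\<^esub> b | a b. a \<in> A \<and> b \<in> B} \<inter> carrier R"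
    have "\<not> AB \<subseteq> P \<longleftrightarrow> \<not> A \<subseteq> P \<and> \<not> B \<subseteq> P" if P: "P \<in> spectrum R" for P
    proof -
      interpret primeideal P R using P by (simp add: spectrum_def)
      show ?thesis
      proof
        assume "\<not> AB \<subseteq> P"
        then show "\<not> A \<subseteq> P \<and> \<not> B \<subseteq> P"
          using A(1) B(1) I_l_closed I_r_closed unfolding AB_def by blast
      next
        assume "\<not> A \<subseteq> P \<and> \<not> B \<subseteq> P"
        then obtain a b where ab: "a \<in> A" "a \<notin> P" "b \<in> B" "b \<notin> P" by blast
        then have c: "a \<in> carrier R" "b \<in> carrier R" using A(1) B(1) by auto
        then have "a \<otimes>\<^bsub>R\<^esub> b \<in> AB" using ab unfolding AB_def by blast
        moreover have "a \<otimes>\<^bsub>R\<^esub> b \<notin> P" using ab c I_prime by blast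
        ultimately show "\<not> AB \<subseteq> P" by blast
      qed
    qed
    then have "U \<inter> V = {P \<in> spectrum R. \<not> AB \<subseteq> P}" using A B by blast
    moreover have "AB \<subseteq> carrier R" by (simp add: AB_def)
    ultimately show ?thesis by blast
  qed
  moreover have "?open (\<Union>\<U>)" if \<U>: "\<forall>U\<in>\<U>. ?open U" for \<U>
  proof -
    define S where "S = \<Union>{A. A \<subseteq> carrier R \<and> {P \<in> spectrum R. \<not> A \<subseteq> P} \<in> \<U>}"
    have "\<Union>\<U> = {P \<in> spectrum R. \<not> S \<subseteq> P}"
    proof (intro Set.set_eqI iffI)
      fix P assume "P \<in> \<Union>\<U>"
      then obtain U where U: "U \<in> \<U>" "P \<in> U" by blast
      then obtain A where "A \<subseteq> carrier R" "U = {P \<in> spectrum R. \<not> A \<subseteq> P}" using \<U> by blast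
      then show "P \<in> {P \<in> spectrum R. \<not> S \<subseteq> P}" using U unfolding S_def by blast
    next
      fix P assume P: "P \<in> {P \<in> spectrum R. \<not> S \<subseteq> P}"
      then obtain A where "A \<subseteq> carrier R" "{P \<in> spectrum R. \<not> A \<subseteq> P} \<in> \<U>" "\<not> A \<subseteq> P"
        unfolding S_def by blast
      then show "P \<in> \<Union>\<U>" using P by blast
    qed
    moreover have "S \<subseteq> carrier R" by (auto simp: S_def)
    ultimately show ?thesis by blast
  qed
  ultimately show ?thesis unfolding istopology_def by blast
qed

lemma openin_Spec:
  "openin (Spec R) U \<longleftrightarrow> (\<exists>S \<subseteq> carrier R. U = {P \<in> spectrum R. \<not> S \<subseteq> P})"
  unfolding Spec_def using istopology_Spec[of R] by (simp add: topology_inverse')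

lemma topspace_Spec: "topspace (Spec R) = spectrum R"
proof
  show "topspace (Spec R) \<subseteq> spectrum R"
    unfolding topspace_def openin_Spec by blast
  have "\<not> carrier R \<subseteq> P" if "P \<in> spectrum R" for P
  proof -
    interpret primeideal P R using that by (simp add: spectrum_def)
    show ?thesis using I_notcarr a_subset by blast
  qed
  then have "spectrum R = {P \<in> spectrum R. \<not> carrier R \<subseteq> P}" by blast
  then have "openin (Spec R) (spectrum R)" unfolding openin_Spec by blast
  then show "spectrum R \<subseteq> topspace (Spec R)" by (rule openin_subset)
qed


section \<open>Multivariate polynomials\<close>

type_synonym ('v, 'k) mpoly = "('v \<Rightarrow>\<^sub>0 nat) \<Rightarrow>\<^sub>0 'k"

definition mconst :: "'k \<Rightarrow> ('v, 'k::comm_ring_1) mpoly" where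
  "mconst a = Poly_Mapping.single 0 a"

definition mvar :: "'v \<Rightarrow> ('v, 'k::comm_ring_1) mpoly" where
  "mvar v = Poly_Mapping.single (Poly_Mapping.single v 1) 1"

definition msubst :: "('v \<Rightarrow> ('w, 'k) mpoly) \<Rightarrow> ('v, 'k::comm_ring_1) mpoly \<Rightarrow> ('w, 'k) mpoly" where
  "msubst \<sigma> f = (\<Sum>m\<in>Poly_Mapping.keys f. mconst (Poly_Mapping.lookup f m) *
     (\<Prod>v\<in>Poly_Mapping.keys m. \<sigma> v ^ Poly_Mapping.lookup m v))"

abbreviation mpoly_ring :: "('v, 'k::comm_ring_1) mpoly ring" where
  "mpoly_ring \<equiv> ring_of_type_algebra"

definition fixed_subring :: "('a, 'b) ring_scheme \<Rightarrow> ('a \<Rightarrow> 'a) set \<Rightarrow> ('a, 'b) ring_scheme" where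
  "fixed_subring R G = R\<lparr>carrier := {x \<in> carrier R. \<forall>\<sigma>\<in>G. \<sigma> x = x}\<rparr>"


section \<open>ADHM data and their moduli space\<close>

text \<open>
  We identify \<open>V\<close> with \<open>k\<^sup>c\<close>, \<open>c = CARD('n)\<close>.  The index \<open>I\<^sub>i\<^sub>k\<close> stands for the matrix
  \<open>B\<^sub>i\<^sub>k\<close>, and the variable \<open>(I\<^sub>i\<^sub>k, r, s)\<close> for its entry in row \<open>r\<close> and column \<open>s\<close>.  The four
  indices also label the coordinates of the affine space \<open>\<bbbA>\<^sup>4\<close>.
\<close>

datatype adhm_index = I11 | I12 | I21 | I22

type_synonym ('n, 'k) adhm_poly = "(adhm_index \<times> 'n \<times> 'n, 'k) mpoly"

definition generic_matrix :: "adhm_index \<Rightarrow> ('n, 'k::comm_ring_1) adhm_poly ^ 'n ^ 'n" where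
  "generic_matrix a = (\<chi> r s. mvar (a, r, s))"

definition commutator :: "'a::ring_1 ^ 'n ^ 'n \<Rightarrow> 'a ^ 'n ^ 'n \<Rightarrow> 'a ^ 'n ^ 'n" where
  "commutator A B = A ** B - B ** A"

text \<open>The coefficients of \<open>x\<^sub>0\<^sup>2\<close>, \<open>x\<^sub>1\<^sup>2\<close> and \<open>x\<^sub>0 x\<^sub>1\<close> in the commutator of
  \<open>B\<^sub>1\<^sub>1 x\<^sub>0 + B\<^sub>2\<^sub>1 x\<^sub>1\<close> and \<open>B\<^sub>1\<^sub>2 x\<^sub>0 + B\<^sub>2\<^sub>2 x\<^sub>1\<close>.\<close>

definition adhm_equations :: "(('n::finite, 'k::comm_ring_1) adhm_poly ^ 'n ^ 'n) set" where
  "adhm_equations =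
     {commutator (generic_matrix I11) (generic_matrix I12),
      commutator (generic_matrix I21) (generic_matrix I22),
      commutator (generic_matrix I11) (generic_matrix I22)
        + commutator (generic_matrix I21) (generic_matrix I12)}"

definition adhm_ideal :: "('n::finite, 'k::comm_ring_1) adhm_poly set" where
  "adhm_ideal = Idl\<^bsub>mpoly_ring\<^esub> {E $ r $ s | E r s. E \<in> adhm_equations}"

definition adhm_ring :: "('n::finite, 'k::comm_ring_1) adhm_poly set ring" where
  "adhm_ring = mpoly_ring Quot adhm_ideal"

definition const_matrix :: "'k::comm_ring_1 ^ 'n ^ 'n \<Rightarrow> ('v, 'k) mpoly ^ 'n ^ 'n" where
  "const_matrix g = (\<chi> r s. mconst (g $ r $ s))"

text \<open>Pullback of functions along \<open>B \<mapsto> g B g\<^sup>-\<^sup>1\<close>.\<close>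

definition gl_act ::
  "'k::field ^ 'n ^ 'n \<Rightarrow> ('n::finite, 'k) adhm_poly \<Rightarrow> ('n, 'k) adhm_poly" where
  "gl_act g = msubst (\<lambda>(a, r, s).
     (const_matrix g ** generic_matrix a ** const_matrix (matrix_inv g)) $ r $ s)"

text \<open>
  The coordinate ring of the GIT quotient.  An automorphism of the polynomial ring that preserves
  the ideal acts on the cosets by taking images.  As the field will be algebraically closed, hence
  infinite, invariance under the abstract group \<open>GL(V)\<close> is invariance under the group scheme.
\<close>

definition M0_ring :: "('n::finite, 'k::field) adhm_poly set ring" where
  "M0_ring = fixed_subring adhm_ring {(`) (gl_act g) | g. invertible g}"

definition M0 :: "('n::finite, 'k::field) adhm_poly set set topology" where
  "M0 = Spec M0_ring"


section \<open>The symmetric power of the affine space and the morphism\<close>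

text \<open>The variable \<open>(l, a)\<close> is the coordinate \<open>a\<close> of the point \<open>p\<^sub>l\<close> in \<open>(\<bbbA>\<^sup>4)\<^sup>c\<close>.\<close>

type_synonym ('n, 'k) points_poly = "('n \<times> adhm_index, 'k) mpoly"

definition perm_act ::
  "('n \<Rightarrow> 'n) \<Rightarrow> ('n, 'k::comm_ring_1) points_poly \<Rightarrow> ('n, 'k) points_poly" where
  "perm_act \<pi> = msubst (\<lambda>(l, a). mvar (\<pi> l, a))"

definition SymA4_ring :: "('n::finite, 'k::comm_ring_1) points_poly ring" where
  "SymA4_ring = fixed_subring mpoly_ring {perm_act \<pi> | \<pi>. bij \<pi>}"

definition SymA4 :: "('n::finite, 'k::comm_ring_1) points_poly set topology" where
  "SymA4 = Spec SymA4_ring"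

text \<open>
  Pullback along the map sending \<open>(p\<^sub>l)\<^sub>l\<close> to the quadruple of diagonal matrices whose \<open>l\<close>-th
  diagonal entries are the coordinates of \<open>p\<^sub>l\<close>.
\<close>

definition diag_pullback ::
  "('n, 'k::comm_ring_1) adhm_poly \<Rightarrow> ('n, 'k) points_poly" where
  "diag_pullback = msubst (\<lambda>(a, r, s). if r = s then mvar (r, a) else 0)"

definition phi_ring_hom ::
  "('n, 'k::comm_ring_1) adhm_poly set \<Rightarrow> ('n, 'k) points_poly" where
  "phi_ring_hom F = the_elem (diag_pullback ` F)"

definition phi ::
  "('n::finite, 'k::field) points_poly set \<Rightarrow> ('n, 'k) adhm_poly set set" where
  "phi Q = {F \<in> carrier M0_ring. phi_ring_hom F \<in> Q}"


section \<open>Well-definedness\<close>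

definition monom_subst :: "('v \<Rightarrow> ('w, 'k::comm_ring_1) mpoly) \<Rightarrow> ('v \<Rightarrow>\<^sub>0 nat) \<Rightarrow> ('w, 'k) mpoly" where
  "monom_subst \<sigma> m = (\<Prod>v\<in>Poly_Mapping.keys m. \<sigma> v ^ Poly_Mapping.lookup m v)"

lemma monom_subst_superset:
  "finite A \<Longrightarrow> Poly_Mapping.keys m \<subseteq> A \<Longrightarrow>
     monom_subst \<sigma> m = (\<Prod>v\<in>A. \<sigma> v ^ Poly_Mapping.lookup m v)"
  unfolding monom_subst_def by (rule prod.mono_neutral_left) (auto simp: in_keys_iff)

lemma monom_subst_add: "monom_subst \<sigma> (m + m') = monom_subst \<sigma> m * monom_subst \<sigma> m'"
proof -
  let ?A = "Poly_Mapping.keys m \<union> Poly_Mapping.keys m'"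
  have "monom_subst \<sigma> (m + m') = (\<Prod>v\<in>?A. \<sigma> v ^ Poly_Mapping.lookup (m + m') v)"
    by (rule monom_subst_superset) (auto simp: Poly_Mapping.keys_add)
  also have "\<dots> = (\<Prod>v\<in>?A. \<sigma> v ^ Poly_Mapping.lookup m v) * (\<Prod>v\<in>?A. \<sigma> v ^ Poly_Mapping.lookup m' v)"
    by (simp add: lookup_add power_add prod.distrib)
  also have "\<dots> = monom_subst \<sigma> m * monom_subst \<sigma> m'"
    by (simp add: monom_subst_superset[of ?A])
  finally show ?thesis .
qed

lemma mconst_simps [simp]:
  "mconst 0 = 0" "mconst 1 = 1" "mconst (a + b) = mconst a + mconst b"
  "mconst (a * b) = mconst a * mconst b"
  by (simp_all add: mconst_def single_add mult_single)

lemma mconst_sum: "mconst (sum f A) = (\<Sum>x\<in>A. mconst (f x))"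
  by (induction A rule: infinite_finite_induct) auto

lemma msubst_superset:
  "finite A \<Longrightarrow> Poly_Mapping.keys f \<subseteq> A \<Longrightarrow>
     msubst \<sigma> f = (\<Sum>m\<in>A. mconst (Poly_Mapping.lookup f m) * monom_subst \<sigma> m)"
  unfolding msubst_def monom_subst_def[symmetric]
  by (rule sum.mono_neutral_left) (auto simp: in_keys_iff)

lemma msubst_0 [simp]: "msubst \<sigma> 0 = 0"
  by (simp add: msubst_def)

lemma msubst_add [simp]: "msubst \<sigma> (f + g) = msubst \<sigma> f + msubst \<sigma> g"
proof -
  let ?A = "Poly_Mapping.keys f \<union> Poly_Mapping.keys g"
  have "msubst \<sigma> (f + g) = (\<Sum>m\<in>?A. mconst (Poly_Mapping.lookup (f + g) m) * monom_subst \<sigma> m)"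
    by (rule msubst_superset) (auto simp: Poly_Mapping.keys_add)
  then show ?thesis
    by (simp add: msubst_superset[of ?A] lookup_add distrib_right sum.distrib)
qed

lemma msubst_single:
  "msubst \<sigma> (Poly_Mapping.single m a) = mconst a * monom_subst \<sigma> m"
  by (simp add: msubst_superset[of "{m}"])

lemma mpoly_induct [case_names zero single add]:
  assumes "P 0" "\<And>m a. P (Poly_Mapping.single m a)" "\<And>f g. P f \<Longrightarrow> P g \<Longrightarrow> P (f + g)"
  shows "P (f :: 'a \<Rightarrow>\<^sub>0 'b::comm_monoid_add)"
proof (induction f rule: Poly_Mapping.update_induct)
  case const
  show ?case by (rule assms)
next
  case (update f a b)
  have "Poly_Mapping.update a b f = f + Poly_Mapping.single a b"
    using update(1)
    by (intro poly_mapping_eqI)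
      (auto simp: Poly_Mapping.lookup_update lookup_add lookup_single in_keys_iff when_def)
  then show ?case using update assms by simp
qed

lemma msubst_mult [simp]: "msubst \<sigma> (f * g) = msubst \<sigma> f * msubst \<sigma> g"
proof (induction f rule: mpoly_induct)
  case (single m a)
  show ?case
  proof (induction g rule: mpoly_induct)
    case (single m' b)
    show ?case by (simp add: mult_single msubst_single monom_subst_add)
  qed (simp_all add: algebra_simps)
qed (simp_all add: algebra_simps)

lemma msubst_mconst [simp]: "msubst \<sigma> (mconst a) = mconst a"
  unfolding mconst_def[of a] msubst_single by (simp add: monom_subst_def mconst_def)

lemma msubst_1 [simp]: "msubst \<sigma> 1 = 1"
  using msubst_mconst[of \<sigma> 1] by simp

lemma msubst_mvar [simp]: "msubst \<sigma> (mvar v) = \<sigma> v"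
  unfolding mvar_def msubst_single by (simp add: monom_subst_def)

lemma msubst_uminus [simp]: "msubst \<sigma> (- f) = - msubst \<sigma> f"
  using msubst_add[of \<sigma> f "- f"] by (simp add: eq_neg_iff_add_eq_0 add.commute del: msubst_add)

lemma msubst_diff [simp]: "msubst \<sigma> (f - g) = msubst \<sigma> f - msubst \<sigma> g"
  using msubst_add[of \<sigma> f "- g"] by simp

lemma msubst_sum [simp]: "msubst \<sigma> (sum F A) = (\<Sum>x\<in>A. msubst \<sigma> (F x))"
  by (induction A rule: infinite_finite_induct) auto

lemma hom_eqI_mpoly:
  fixes F G :: "('v, 'k::comm_ring_1) mpoly \<Rightarrow> 'b::comm_ring_1"
  assumes add: "\<And>f g. F (f + g) = F f + F g" "\<And>f g. G (f + g) = G f + G g"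
    and mult: "\<And>f g. F (f * g) = F f * F g" "\<And>f g. G (f * g) = G f * G g"
    and const: "\<And>a. F (mconst a) = G (mconst a)" and var: "\<And>v. F (mvar v) = G (mvar v)"
  shows "F f = G f"
proof (induction f rule: mpoly_induct)
  case zero
  show ?case using const[of 0] by simp
next
  case (single m a)
  show ?case
  proof (induction m arbitrary: a rule: mpoly_induct)
    case zero
    show ?case using const[of a] by (simp add: mconst_def)
  next
    case (single v n)
    show ?case
    proof (induction n)
      case 0
      show ?case using const[of a] by (simp add: mconst_def)
    next
      case (Suc n)
      have "Poly_Mapping.single (Poly_Mapping.single v (Suc n)) a =
          (Poly_Mapping.single (Poly_Mapping.single v n) a :: ('v, 'k) mpoly) * mvar v"
        by (simp add: mvar_def mult_single flip: single_add)
      then show ?case using Suc by (simp add: mult var)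
    qed
  next
    case (add m m')
    have "Poly_Mapping.single (m + m') a = Poly_Mapping.single m a * Poly_Mapping.single m' 1"
      by (simp add: mult_single)
    then show ?case by (simp add: mult add)
  qed
next
  case (add f g)
  then show ?case by (simp add: assms)
qed

lemma msubst_msubst: "msubst \<sigma> (msubst \<tau> f) = msubst (\<lambda>v. msubst \<sigma> (\<tau> v)) f"
  by (rule hom_eqI_mpoly) auto

lemma msubst_id: "msubst mvar f = f"
  by (rule hom_eqI_mpoly) auto

lemma mpoly_ring_simps [simp]:
  "carrier mpoly_ring = UNIV" "f \<otimes>\<^bsub>mpoly_ring\<^esub> g = f * g" "f \<oplus>\<^bsub>mpoly_ring\<^esub> g = f + g"
  "\<one>\<^bsub>mpoly_ring\<^esub> = 1" "\<zero>\<^bsub>mpoly_ring\<^esub> = 0"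
  by (simp_all add: ring_of_type_algebra_def)

lemma cring_mpoly_ring: "cring mpoly_ring"
  by (rule cring_from_type_algebra)

lemma msubst_ring_hom: "msubst \<sigma> \<in> ring_hom mpoly_ring mpoly_ring"
  by (rule ring_hom_memI) auto

lemma ideal_adhm_ideal:
  "ideal (adhm_ideal :: ('n::finite, 'k::comm_ring_1) adhm_poly set) mpoly_ring"
proof -
  interpret cring "mpoly_ring :: ('n, 'k) adhm_poly ring" by (rule cring_mpoly_ring)
  show ?thesis unfolding adhm_ideal_def by (rule genideal_ideal) simp
qed

lemma cring_adhm_ring: "cring adhm_ring"
  unfolding adhm_ring_def by (rule ideal.quotient_is_cring[OF ideal_adhm_ideal cring_mpoly_ring])

lemma cring_fixed_subring:
  assumes "cring R" and G: "\<And>\<sigma>. \<sigma> \<in> G \<Longrightarrow> \<sigma> \<in> ring_hom R R"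
  shows "cring (fixed_subring R G)"
proof -
  interpret cring R by fact
  let ?S = "{x \<in> carrier R. \<forall>\<sigma>\<in>G. \<sigma> x = x}"
  have hom: "ring_hom_cring R R \<sigma>" if "\<sigma> \<in> G" for \<sigma>
    using G[OF that] by (simp add: ring_hom_cringI cring_axioms)
  have "subcring ?S R"
  proof (rule subcringI', rule subringI)
    show "\<one>\<^bsub>R\<^esub> \<in> ?S" using G ring_hom_one by fastforce
    show "\<ominus>\<^bsub>R\<^esub> h \<in> ?S" if "h \<in> ?S" for h
    proof -
      have "\<sigma> (\<ominus>\<^bsub>R\<^esub> h) = \<ominus>\<^bsub>R\<^esub> h" if "\<sigma> \<in> G" for \<sigma>
        using ring_hom_cring.hom_a_inv[OF hom[OF that], of h] that \<open>h \<in> ?S\<close> by (metis (mono_tags, lifting) mem_Collect_eq)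
      then show ?thesis using that by simp
    qed
    show "h1 \<otimes>\<^bsub>R\<^esub> h2 \<in> ?S" "h1 \<oplus>\<^bsub>R\<^esub> h2 \<in> ?S" if "h1 \<in> ?S" "h2 \<in> ?S" for h1 h2
    proof -
      have "\<sigma> (h1 \<otimes>\<^bsub>R\<^esub> h2) = h1 \<otimes>\<^bsub>R\<^esub> h2 \<and> \<sigma> (h1 \<oplus>\<^bsub>R\<^esub> h2) = h1 \<oplus>\<^bsub>R\<^esub> h2" if "\<sigma> \<in> G" for \<sigma>
      proof -
        have "\<sigma> h1 = h1" "\<sigma> h2 = h2" "h1 \<in> carrier R" "h2 \<in> carrier R"
          using that \<open>h1 \<in> ?S\<close> \<open>h2 \<in> ?S\<close> by blast+
        then show ?thesis using G[OF that] by (simp add: ring_hom_mult ring_hom_add)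
      qed
      then show "h1 \<otimes>\<^bsub>R\<^esub> h2 \<in> ?S" "h1 \<oplus>\<^bsub>R\<^esub> h2 \<in> ?S" using that by simp_all
    qed
  qed auto
  then show ?thesis using subcring_iff[of ?S] by (simp add: fixed_subring_def)
qed

lemma gl_act_mvar:
  "gl_act g (mvar (a, r, s)) =
     (const_matrix g ** generic_matrix a ** const_matrix (matrix_inv g)) $ r $ s"
  by (simp add: gl_act_def)

definition map_mat :: "('a \<Rightarrow> 'b) \<Rightarrow> 'a ^ 'n ^ 'm \<Rightarrow> 'b ^ 'n ^ 'm" where
  "map_mat h A = (\<chi> r s. h (A $ r $ s))"

lemma map_mat_msubst:
  fixes A B :: "('v, 'k::comm_ring_1) mpoly ^ 'n ^ 'n"
  shows "map_mat (msubst \<sigma>) (A ** B) = map_mat (msubst \<sigma>) A ** map_mat (msubst \<sigma>) B"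
    "map_mat (msubst \<sigma>) (A + B) = map_mat (msubst \<sigma>) A + map_mat (msubst \<sigma>) B"
    "map_mat (msubst \<sigma>) (A - B) = map_mat (msubst \<sigma>) A - map_mat (msubst \<sigma>) B"
    "map_mat (msubst \<sigma>) (const_matrix g) = const_matrix g"
  by (simp_all add: map_mat_def matrix_matrix_mult_def const_matrix_def vec_eq_iff)

lemma const_matrix_mult: "const_matrix (g ** h) = const_matrix g ** const_matrix h"
  by (simp add: const_matrix_def matrix_matrix_mult_def vec_eq_iff mconst_sum)

lemma const_matrix_1: "const_matrix (mat 1) = mat 1"
  by (simp add: const_matrix_def mat_def vec_eq_iff)

lemma matrix_inv_mult:
  fixes g :: "'k::field ^ 'n ^ 'n"
  assumes "invertible g"
  shows "matrix_inv g ** g = mat 1" "g ** matrix_inv g = mat 1"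
  using someI_ex[OF assms[unfolded invertible_def]] unfolding matrix_inv_def by auto

lemma matrix_inv_inv:
  fixes g :: "'k::field ^ 'n ^ 'n"
  assumes "invertible g"
  shows "invertible (matrix_inv g)" "matrix_inv (matrix_inv g) = g"
proof -
  show i: "invertible (matrix_inv g)"
    using matrix_inv_mult[OF assms] unfolding invertible_def by blast
  have "matrix_inv (matrix_inv g) = (g ** matrix_inv g) ** matrix_inv (matrix_inv g)"
    by (simp add: matrix_inv_mult assms)
  also have "\<dots> = g" unfolding matrix_mul_assoc[symmetric] by (simp add: matrix_inv_mult i)
  finally show "matrix_inv (matrix_inv g) = g" .
qed

lemma map_mat_gl_act:
  fixes A :: "('n::finite, 'k::field) adhm_poly ^ 'n ^ 'n"
  shows "map_mat (gl_act g) (generic_matrix a) =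
     const_matrix g ** generic_matrix a ** const_matrix (matrix_inv g)"
  by (simp add: map_mat_def generic_matrix_def[of a] gl_act_mvar vec_eq_iff)

lemma conj_mult:
  fixes g :: "'k::field ^ 'n ^ 'n" and A B :: "('v, 'k) mpoly ^ 'n ^ 'n"
  assumes "invertible g"
  defines "P \<equiv> const_matrix g" and "Q \<equiv> const_matrix (matrix_inv g)"
  shows "(P ** A ** Q) ** (P ** B ** Q) = P ** (A ** B) ** Q"
proof -
  have QP: "Q ** P = mat 1"
    by (simp add: P_def Q_def matrix_inv_mult assms const_matrix_1 flip: const_matrix_mult)
  have "(P ** A ** Q) ** (P ** B ** Q) = P ** A ** (Q ** P) ** B ** Q"
    by (simp only: matrix_mul_assoc)
  then show ?thesis by (simp add: QP matrix_mul_assoc)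
qed

lemma gl_act_gl_act_inv:
  fixes f :: "('n::finite, 'k::field) adhm_poly"
  assumes "invertible g"
  shows "gl_act g (gl_act (matrix_inv g) f) = f"
proof -
  have "gl_act g ((const_matrix (matrix_inv g) ** generic_matrix a ** const_matrix g) $ r $ s) = mvar (a, r, s)"
    for a r s
  proof -
    let ?P = "const_matrix g :: ('n, 'k) adhm_poly ^ 'n ^ 'n" and ?Q = "const_matrix (matrix_inv g)"
    have PQ: "?Q ** ?P = mat 1"
      by (simp add: matrix_inv_mult assms const_matrix_1 flip: const_matrix_mult)
    have "map_mat (gl_act g) (?Q ** generic_matrix a ** ?P) =
        ?Q ** (?P ** generic_matrix a ** ?Q) ** ?P"
      unfolding map_mat_gl_act[symmetric] unfolding gl_act_def map_mat_msubst ..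
    also have "\<dots> = (?Q ** ?P) ** generic_matrix a ** (?Q ** ?P)"
      by (simp only: matrix_mul_assoc)
    also have "\<dots> = generic_matrix a" by (simp add: PQ)
    finally show ?thesis
      by (simp add: map_mat_def generic_matrix_def vec_eq_iff)
  qed
  then have "gl_act g (gl_act (matrix_inv g) f) = msubst mvar f"
    unfolding gl_act_def[of "matrix_inv g"] unfolding gl_act_def msubst_msubst
    by (intro arg_cong2[where f = msubst] refl ext)
      (auto simp: matrix_inv_inv assms simp flip: gl_act_def)
  then show ?thesis by (simp add: msubst_id)
qed

lemma matrix_sub_distrib:
  fixes A B :: "'a::comm_ring_1 ^ 'n::finite ^ 'n"
  shows "P ** (A - B) = P ** A - P ** B" "(A - B) ** P = A ** P - B ** P"
  by (simp_all add: matrix_matrix_mult_def vec_eq_iff right_diff_distrib left_diff_distrib sum_subtractf)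

lemma matrix_add_rdistrib':
  fixes A B :: "'a::comm_ring_1 ^ 'n::finite ^ 'n"
  shows "(A + B) ** P = A ** P + B ** P"
  by (simp add: matrix_matrix_mult_def vec_eq_iff distrib_right sum.distrib)

lemma gl_act_equations:
  fixes E :: "('n::finite, 'k::field) adhm_poly ^ 'n ^ 'n"
  assumes "E \<in> adhm_equations" and g: "invertible g"
  shows "map_mat (gl_act g) E = const_matrix g ** E ** const_matrix (matrix_inv g)"
proof -
  let ?P = "const_matrix g :: ('n, 'k) adhm_poly ^ 'n ^ 'n" and ?Q = "const_matrix (matrix_inv g)"
  have c: "map_mat (gl_act g) (commutator (generic_matrix a) (generic_matrix b)) =
      ?P ** commutator (generic_matrix a) (generic_matrix b) ** ?Q" for a b
    unfolding commutator_def
    by (simp add: map_mat_gl_act map_mat_msubst(1,3)[of "\<lambda>(a, r, s). (const_matrix g ** generic_matrix a ** const_matrix (matrix_inv g)) $ r $ s", folded gl_act_def] conj_mult[OF g]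
        matrix_sub_distrib)
  show ?thesis
    using assms(1) unfolding adhm_equations_def
    by (auto simp: c map_mat_msubst(2)[of "\<lambda>(a, r, s). (const_matrix g ** generic_matrix a ** const_matrix (matrix_inv g)) $ r $ s", folded gl_act_def]
        matrix_add_ldistrib matrix_add_rdistrib')
qed

lemma adhm_ideal_closed:
  fixes f g :: "('n::finite, 'k::comm_ring_1) adhm_poly"
  shows "f \<in> adhm_ideal \<Longrightarrow> g \<in> adhm_ideal \<Longrightarrow> f + g \<in> adhm_ideal"
    "(0 :: ('n, 'k) adhm_poly) \<in> adhm_ideal"
    "f \<in> adhm_ideal \<Longrightarrow> g * f \<in> adhm_ideal" "f \<in> adhm_ideal \<Longrightarrow> f * g \<in> adhm_ideal"
proof -
  interpret ideal "adhm_ideal :: ('n, 'k) adhm_poly set" mpoly_ring by (rule ideal_adhm_ideal)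
  show "f \<in> adhm_ideal \<Longrightarrow> g \<in> adhm_ideal \<Longrightarrow> f + g \<in> adhm_ideal"
    using additive_subgroup.a_closed[OF additive_subgroup_axioms, of f g] by simp
  show "(0 :: ('n, 'k) adhm_poly) \<in> adhm_ideal" using additive_subgroup.zero_closed[OF additive_subgroup_axioms] by simp
  show "f \<in> adhm_ideal \<Longrightarrow> g * f \<in> adhm_ideal" using I_l_closed[of f g] by simp
  show "f \<in> adhm_ideal \<Longrightarrow> f * g \<in> adhm_ideal" using I_r_closed[of f g] by simp
qed

lemma adhm_ideal_sum:
  "(\<And>x. x \<in> A \<Longrightarrow> F x \<in> adhm_ideal) \<Longrightarrow> sum F A \<in> adhm_ideal"
  by (induction A rule: infinite_finite_induct) (auto intro: adhm_ideal_closed)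

lemma adhm_equations_in_ideal:
  fixes E :: "('n::finite, 'k::comm_ring_1) adhm_poly ^ 'n ^ 'n"
  shows "E \<in> adhm_equations \<Longrightarrow> E $ r $ s \<in> adhm_ideal"
proof -
  interpret cring "mpoly_ring :: ('n, 'k) adhm_poly ring" by (rule cring_mpoly_ring)
  assume "E \<in> adhm_equations"
  then show ?thesis unfolding adhm_ideal_def by (intro genideal_self[THEN subsetD]) auto
qed

lemma msubst_adhm_ideal:
  fixes \<sigma> :: "adhm_index \<times> 'n::finite \<times> 'n \<Rightarrow> ('w, 'k::comm_ring_1) mpoly"
  assumes "f \<in> (adhm_ideal :: ('n::finite, 'k) adhm_poly set)" and "ideal J mpoly_ring"
    and "\<And>E r s. E \<in> adhm_equations \<Longrightarrow> msubst \<sigma> (E $ r $ s) \<in> J"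
  shows "msubst \<sigma> f \<in> J"
proof -
  interpret cring "mpoly_ring :: ('n, 'k) adhm_poly ring" by (rule cring_mpoly_ring)
  interpret h: ring_hom_ring mpoly_ring mpoly_ring "msubst \<sigma>"
    by (rule ring_hom_ringI2) (auto intro: msubst_ring_hom cring.axioms cring_mpoly_ring)
  have "adhm_ideal \<subseteq> {f \<in> carrier mpoly_ring. msubst \<sigma> f \<in> J}"
    unfolding adhm_ideal_def using assms(3)
    by (intro genideal_minimal h.ideal_vimage assms(2)) auto
  then show ?thesis using assms(1) by blast
qed

lemma gl_act_adhm_ideal_subset:
  fixes f :: "('n::finite, 'k::field) adhm_poly"
  assumes "invertible g" "f \<in> adhm_ideal"
  shows "gl_act g f \<in> adhm_ideal"
  unfolding gl_act_def
proof (rule msubst_adhm_ideal[OF assms(2) ideal_adhm_ideal], fold gl_act_def)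
  fix E :: "('n, 'k) adhm_poly ^ 'n ^ 'n" and r s assume E: "E \<in> adhm_equations"
  have "gl_act g (E $ r $ s) = (const_matrix g ** E ** const_matrix (matrix_inv g)) $ r $ s"
    using gl_act_equations[OF E assms(1)] by (simp add: map_mat_def vec_eq_iff)
  also have "\<dots> \<in> adhm_ideal"
    by (simp add: matrix_matrix_mult_def)
      (intro adhm_ideal_sum adhm_ideal_closed(4) adhm_ideal_closed(3) adhm_equations_in_ideal E)
  finally show "gl_act g (E $ r $ s) \<in> adhm_ideal" .
qed

lemma gl_act_adhm_ideal:
  assumes "invertible g"
  shows "gl_act g ` adhm_ideal = adhm_ideal"
proof
  show "gl_act g ` adhm_ideal \<subseteq> adhm_ideal" using gl_act_adhm_ideal_subset[OF assms] by blast
  show "adhm_ideal \<subseteq> gl_act g ` adhm_ideal"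
    using gl_act_adhm_ideal_subset[OF matrix_inv_inv(1)[OF assms]] gl_act_gl_act_inv[OF assms]
    by (metis image_eqI subsetI)
qed

lemma adhm_ring_simps:
  fixes f g :: "('n::finite, 'k::comm_ring_1) adhm_poly"
  shows "carrier adhm_ring = range (\<lambda>f. (+) f ` (adhm_ideal :: ('n, 'k) adhm_poly set))"
    "(+) f ` adhm_ideal \<otimes>\<^bsub>adhm_ring\<^esub> (+) g ` adhm_ideal = (+) (f * g) ` adhm_ideal"
    "(+) f ` adhm_ideal \<oplus>\<^bsub>adhm_ring\<^esub> (+) g ` adhm_ideal = (+) (f + g) ` adhm_ideal"
    "\<one>\<^bsub>adhm_ring\<^esub> = (+) (1 :: ('n, 'k) adhm_poly) ` adhm_ideal"
proof -
  interpret ideal "adhm_ideal :: ('n, 'k) adhm_poly set" mpoly_ring by (rule ideal_adhm_ideal)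
  have coset: "adhm_ideal +>\<^bsub>mpoly_ring\<^esub> f = (+) f ` adhm_ideal" for f :: "('n, 'k) adhm_poly"
    by (auto simp: a_r_coset_def' add.commute)
  show "carrier adhm_ring = range (\<lambda>f. (+) f ` (adhm_ideal :: ('n, 'k) adhm_poly set))"
    by (auto simp: adhm_ring_def FactRing_def A_RCOSETS_def' coset)
  show "(+) f ` adhm_ideal \<otimes>\<^bsub>adhm_ring\<^esub> (+) g ` adhm_ideal = (+) (f * g) ` adhm_ideal"
    using rcoset_mult_add[of f g] by (simp add: adhm_ring_def FactRing_def coset)
  show "(+) f ` adhm_ideal \<oplus>\<^bsub>adhm_ring\<^esub> (+) g ` adhm_ideal = (+) (f + g) ` adhm_ideal"
    using a_rcos_sum[of f g] by (simp add: adhm_ring_def FactRing_def coset)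
  show "\<one>\<^bsub>adhm_ring\<^esub> = (+) (1 :: ('n, 'k) adhm_poly) ` adhm_ideal"
    by (simp add: adhm_ring_def FactRing_def coset)
qed

lemma gl_act_hom [simp]:
  "gl_act g (f + f') = gl_act g f + gl_act g f'" "gl_act g (f * f') = gl_act g f * gl_act g f'"
  "gl_act g 1 = 1"
  by (simp_all add: gl_act_def)

lemma gl_act_coset:
  assumes "invertible g"
  shows "gl_act g ` (+) f ` adhm_ideal = (+) (gl_act g f) ` adhm_ideal"
proof -
  have "gl_act g ` (+) f ` adhm_ideal = (+) (gl_act g f) ` gl_act g ` adhm_ideal"
    by (simp add: image_image)
  then show ?thesis by (simp add: gl_act_adhm_ideal assms)
qed

lemma cring_M0_ring: "cring (M0_ring :: ('n::finite, 'k::field) adhm_poly set ring)"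
  unfolding M0_ring_def
proof (rule cring_fixed_subring[OF cring_adhm_ring])
  fix \<sigma> :: "('n, 'k) adhm_poly set \<Rightarrow> ('n, 'k) adhm_poly set"
  assume "\<sigma> \<in> {(`) (gl_act g) | g. invertible g}"
  then obtain g where \<sigma>: "\<sigma> = (`) (gl_act g)" and g: "invertible g" by blast
  have carr: "F \<in> carrier adhm_ring \<longleftrightarrow> (\<exists>f. F = (+) f ` adhm_ideal)" for F :: "('n, 'k) adhm_poly set"
    by (auto simp: adhm_ring_simps)
  show "\<sigma> \<in> ring_hom adhm_ring adhm_ring"
  proof (rule ring_hom_memI)
    fix F F' :: "('n, 'k) adhm_poly set"
    assume "F \<in> carrier adhm_ring"
    then obtain f where f: "F = (+) f ` adhm_ideal" unfolding carr by blast
    show "\<sigma> F \<in> carrier adhm_ring" unfolding carr f \<sigma> gl_act_coset[OF g] by blast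
    assume "F' \<in> carrier adhm_ring"
    then obtain f' where f': "F' = (+) f' ` adhm_ideal" unfolding carr by blast
    show "\<sigma> (F \<otimes>\<^bsub>adhm_ring\<^esub> F') = \<sigma> F \<otimes>\<^bsub>adhm_ring\<^esub> \<sigma> F'"
      unfolding f f' \<sigma> by (simp only: adhm_ring_simps gl_act_coset[OF g] gl_act_hom)
    show "\<sigma> (F \<oplus>\<^bsub>adhm_ring\<^esub> F') = \<sigma> F \<oplus>\<^bsub>adhm_ring\<^esub> \<sigma> F'"
      unfolding f f' \<sigma> by (simp only: adhm_ring_simps gl_act_coset[OF g] gl_act_hom)
  next
    show "\<sigma> \<one>\<^bsub>adhm_ring\<^esub> = \<one>\<^bsub>adhm_ring\<^esub>"
      unfolding \<sigma> by (simp only: adhm_ring_simps gl_act_coset[OF g] gl_act_hom)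
  qed
qed

lemma cring_SymA4_ring: "cring (SymA4_ring :: ('n::finite, 'k::comm_ring_1) points_poly ring)"
  unfolding SymA4_ring_def
  by (rule cring_fixed_subring[OF cring_mpoly_ring]) (auto simp: perm_act_def msubst_ring_hom)

lemma diag_pullback_hom [simp]:
  "diag_pullback (f + f') = diag_pullback f + diag_pullback f'"
  "diag_pullback (f * f') = diag_pullback f * diag_pullback f'"
  "diag_pullback 1 = 1"
  by (simp_all add: diag_pullback_def)

lemma diag_pullback_generic_mult:
  "map_mat diag_pullback (generic_matrix a ** generic_matrix b :: ('n::finite, 'k::comm_ring_1) adhm_poly ^ 'n ^ 'n) =
   (\<chi> r s. if r = s then mvar (r, a) * mvar (r, b) else 0)"
  by (simp add: map_mat_def generic_matrix_def matrix_matrix_mult_def diag_pullback_def vec_eq_iff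
      if_distrib[of "\<lambda>x. x * _"] cong: if_cong)

lemma diag_pullback_adhm_ideal:
  fixes f :: "('n::finite, 'k::comm_ring_1) adhm_poly"
  assumes "f \<in> adhm_ideal"
  shows "diag_pullback f = 0"
proof -
  interpret cring "mpoly_ring :: ('n, 'k) points_poly ring" by (rule cring_mpoly_ring)
  have "msubst (\<lambda>(a, r, s). if r = s then mvar (r, a) else 0) f \<in> {0 :: ('n, 'k) points_poly}"
  proof (rule msubst_adhm_ideal[OF assms], fold diag_pullback_def)
    show "ideal {0 :: ('n, 'k) points_poly} mpoly_ring" using zeroideal by simp
    fix E :: "('n, 'k) adhm_poly ^ 'n ^ 'n" and r s
    assume E: "E \<in> adhm_equations"
    have "diag_pullback ((generic_matrix a ** generic_matrix b :: ('n, 'k) adhm_poly ^ 'n ^ 'n) $ r $ s) =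
        diag_pullback ((generic_matrix b ** generic_matrix a :: ('n, 'k) adhm_poly ^ 'n ^ 'n) $ r $ s)" for a b r s
      using diag_pullback_generic_mult[of a b, where 'n = 'n and 'k = 'k]
        diag_pullback_generic_mult[of b a, where 'n = 'n and 'k = 'k]
      by (simp add: map_mat_def vec_eq_iff mult.commute)
    moreover have "diag_pullback (f - g) = diag_pullback f - diag_pullback g" for f g :: "('n, 'k) adhm_poly"
      by (simp add: diag_pullback_def)
    ultimately show "diag_pullback (E $ r $ s) \<in> {0}"
      using E by (auto simp: adhm_equations_def commutator_def)
  qed
  then show ?thesis by (simp add: diag_pullback_def)
qed

lemma phi_ring_hom_coset:
  "phi_ring_hom ((+) f ` adhm_ideal) = diag_pullback (f :: ('n::finite, 'k::comm_ring_1) adhm_poly)"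
proof -
  have "diag_pullback ` (+) f ` adhm_ideal = {diag_pullback f}"
    using adhm_ideal_closed(2)[where 'n = 'n and 'k = 'k]
    by (auto simp: image_image diag_pullback_adhm_ideal)
  then show ?thesis by (simp add: phi_ring_hom_def)
qed

definition perm_mat :: "('n \<Rightarrow> 'n) \<Rightarrow> 'k::field ^ 'n ^ 'n" where
  "perm_mat \<pi> = (\<chi> r s. if s = \<pi> r then 1 else 0)"

lemma perm_mat:
  fixes \<pi> :: "'n::finite \<Rightarrow> 'n"
  assumes "bij \<pi>"
  shows "invertible (perm_mat \<pi> :: 'k::field ^ 'n ^ 'n)"
    "matrix_inv (perm_mat \<pi> :: 'k ^ 'n ^ 'n) = transpose (perm_mat \<pi>)"
proof -
  let ?g = "perm_mat \<pi> :: 'k ^ 'n ^ 'n"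
  have 1: "?g ** transpose ?g = mat 1"
    using bij_is_inj[OF assms]
    by (simp add: perm_mat_def transpose_def matrix_matrix_mult_def mat_def vec_eq_iff inj_eq
        if_distrib[of "\<lambda>x. x * _"] cong: if_cong)
  then show i: "invertible ?g" by (meson invertible_def matrix_left_right_inverse)
  have "matrix_inv ?g = matrix_inv ?g ** (?g ** transpose ?g)" by (simp add: 1)
  then show "matrix_inv ?g = transpose ?g"
    by (simp add: matrix_mul_assoc matrix_inv_mult[OF i])
qed

lemma perm_mat_gl_act:
  fixes f :: "('n::finite, 'k::field) adhm_poly"
  assumes "bij \<pi>"
  shows "diag_pullback (gl_act (perm_mat \<pi>) f) = perm_act \<pi> (diag_pullback f)"
proof (rule hom_eqI_mpoly[of "\<lambda>f. diag_pullback (gl_act (perm_mat \<pi>) f)" "\<lambda>f. perm_act \<pi> (diag_pullback f)"])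
  fix v :: "adhm_index \<times> 'n \<times> 'n"
  obtain a r s where v: "v = (a, r, s)" by (cases v)
  have "gl_act (perm_mat \<pi> :: 'k ^ 'n ^ 'n) (mvar v) = mvar (a, \<pi> r, \<pi> s)"
    unfolding v gl_act_mvar perm_mat(2)[OF assms]
    by (simp add: perm_mat_def const_matrix_def generic_matrix_def transpose_def matrix_matrix_mult_def
        if_distrib[of mconst] if_distrib[of "\<lambda>x. x * _"] if_distrib[of "\<lambda>x. _ * x"] cong: if_cong)
  then show "diag_pullback (gl_act (perm_mat \<pi> :: 'k ^ 'n ^ 'n) (mvar v)) = perm_act \<pi> (diag_pullback (mvar v))"
    using bij_is_inj[OF assms] by (simp add: v diag_pullback_def perm_act_def inj_eq)
qed (simp_all add: diag_pullback_def gl_act_def perm_act_def)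

lemma phi_ring_hom:
  "phi_ring_hom \<in> ring_hom (M0_ring :: ('n::finite, 'k::field) adhm_poly set ring) SymA4_ring"
proof -
  have "phi_ring_hom F \<in> carrier SymA4_ring"
    if F: "F \<in> carrier M0_ring" for F :: "('n, 'k) adhm_poly set"
  proof -
    obtain f where f: "F = (+) f ` adhm_ideal"
      using F by (auto simp: M0_ring_def fixed_subring_def adhm_ring_simps)
    have "perm_act \<pi> (diag_pullback f) = diag_pullback f" if \<pi>: "bij \<pi>" for \<pi>
    proof -
      have "gl_act (perm_mat \<pi>) ` F = F"
        using F perm_mat(1)[OF \<pi>] by (auto simp: M0_ring_def fixed_subring_def)
      then have "(+) (gl_act (perm_mat \<pi>) f) ` adhm_ideal = (+) f ` adhm_ideal"
        by (simp add: f gl_act_coset perm_mat(1) \<pi>)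
      then have "diag_pullback (gl_act (perm_mat \<pi>) f) = diag_pullback f"
        by (metis phi_ring_hom_coset)
      then show ?thesis by (simp add: perm_mat_gl_act \<pi>)
    qed
    then show ?thesis
      by (auto simp: f phi_ring_hom_coset SymA4_ring_def fixed_subring_def)
  qed
  then show ?thesis
    by (intro ring_hom_memI)
      (auto simp: M0_ring_def SymA4_ring_def fixed_subring_def adhm_ring_simps phi_ring_hom_coset)
qed

lemma phi_in_M0:
  fixes Q :: "('n::finite, 'k::field) points_poly set"
  assumes "Q \<in> topspace SymA4"
  shows "phi Q \<in> topspace M0"
proof -
  interpret h: ring_hom_ring "M0_ring :: ('n, 'k) adhm_poly set ring" SymA4_ring phi_ring_hom
    by (rule ring_hom_ringI2)
      (auto intro: phi_ring_hom cring.axioms cring_M0_ring cring_SymA4_ring)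
  show ?thesis
    using h.primeideal_vimage[OF cring_M0_ring] assms
    by (simp add: phi_def M0_def SymA4_def topspace_Spec spectrum_def)
qed

end

theory Submission
  imports Defs
begin

text \<open>
  Let \<open>\<pp>\<close> be the kernel of the pullback from the ring of invariants to the polynomial ring in
  the \<open>4 c\<close> coordinates of \<open>c\<close> points.  The pulled back characteristic polynomials of the four
  generic matrices have the coordinates of the points as their roots and invariant functions as
  their coefficients, so the polynomial ring is integral over the image of the invariants
  (\<open>points_integral\<close>).  Lying over then shows that the image of the morphism is the whole zero
  locus of \<open>\<pp>\<close> (\<open>lying_over\<close>, \<open>image_phi\<close>), and going up and incomparability show that the
  dimension of this locus is that of the polynomial ring (\<open>krull_dim_kernel\<close>).  A chain of
  \<open>n\<close> strict inclusions of primes gives \<open>n\<close> algebraically independent elements, so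
  this dimension is \<open>4 c\<close> (\<open>mpoly_chain_bound\<close>).

  The zero locus of \<open>\<pp>\<close> is an irreducible component because \<open>\<pp>\<close> is a minimal prime
  (\<open>kernel_minimal_prime\<close>).  This rests on an invariant polynomial \<open>s\<close> that is not in \<open>\<pp>\<close> and
  whose nonvanishing forces the four matrices of an ADHM datum to be simultaneously diagonalizable
  (\<open>commuting_pencils_diagonalizable\<close>).  The ADHM equations say that the two pencils
  \<open>M(t) = B\<^sub>1\<^sub>1 + t B\<^sub>2\<^sub>1\<close> and \<open>N(t) = B\<^sub>1\<^sub>2 + t B\<^sub>2\<^sub>2\<close> commute for every \<open>t\<close>.  Let \<open>s\<close> be the resultant
  of the discriminants of their characteristic polynomials, which are polynomials in \<open>t\<close>.  Where
  \<open>M(t)\<close> has distinct eigenvalues, the entries of the projection of a fixed matrix to the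
  centralizer of \<open>M(t)\<close> are rational functions of \<open>t\<close> with the discriminant as denominator, and
  likewise for \<open>N(t)\<close>.  Where both have distinct eigenvalues, the two centralizers are equal, as
  \<open>M(t)\<close> and \<open>N(t)\<close> commute.  If \<open>s\<close> does not vanish, the two denominators are coprime, so these
  rational functions have no poles, not even at infinity, and are constant.  Hence
  the centralizer does not depend on \<open>t\<close>, and all four matrices are diagonal in one basis.

  An invariant function in \<open>\<pp>\<close> vanishes on quadruples of diagonal matrices, so its product with \<open>s\<close>
  vanishes at every ADHM datum, and by the Nullstellensatz (\<open>nullstellensatz_prime\<close>) a power of the
  product is zero (\<open>power_in_adhm_ideal\<close>).  A prime contained in \<open>\<pp>\<close> does not contain \<open>s\<close> and
  therefore contains every element of \<open>\<pp>\<close>.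
\<close>

hide_const (open) up_ring.coeff up_ring.monom Polynomials.degree Polynomials.lead_coeff ring.coeff ring.monom

section \<open>Prime ideals of subrings and integral extensions\<close>

definition subring_set :: "'a::comm_ring_1 set \<Rightarrow> bool" where
  "subring_set S \<longleftrightarrow> 1 \<in> S \<and> (\<forall>a\<in>S. \<forall>b\<in>S. a - b \<in> S \<and> a * b \<in> S)"

definition ideal_in :: "'a::comm_ring_1 set \<Rightarrow> 'a set \<Rightarrow> bool" where
  "ideal_in S I \<longleftrightarrow> I \<subseteq> S \<and> 0 \<in> I \<and> (\<forall>a\<in>I. \<forall>b\<in>I. a + b \<in> I) \<and> (\<forall>a\<in>S. \<forall>b\<in>I. a * b \<in> I)"

definition prime_in :: "'a::comm_ring_1 set \<Rightarrow> 'a set \<Rightarrow> bool" where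
  "prime_in S P \<longleftrightarrow> ideal_in S P \<and> 1 \<notin> P \<and> (\<forall>a\<in>S. \<forall>b\<in>S. a * b \<in> P \<longrightarrow> a \<in> P \<or> b \<in> P)"

lemma subring_set_closed:
  assumes "subring_set S"
  shows "1 \<in> S" "0 \<in> S" "a \<in> S \<Longrightarrow> b \<in> S \<Longrightarrow> a - b \<in> S" "a \<in> S \<Longrightarrow> - a \<in> S"
    "a \<in> S \<Longrightarrow> b \<in> S \<Longrightarrow> a + b \<in> S" "a \<in> S \<Longrightarrow> b \<in> S \<Longrightarrow> a * b \<in> S"
proof -
  have d: "a - b \<in> S" if "a \<in> S" "b \<in> S" for a b using assms that by (simp add: subring_set_def)
  show 1: "1 \<in> S" using assms by (simp add: subring_set_def)
  show 0: "0 \<in> S" using d[OF 1 1] by simp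
  show m: "- a \<in> S" if "a \<in> S" for a using d[OF 0 that] by simp
  show "a + b \<in> S" if "a \<in> S" "b \<in> S" using d[OF that(1) m[OF that(2)]] by simp
  show "a \<in> S \<Longrightarrow> b \<in> S \<Longrightarrow> a - b \<in> S" by (rule d)
  show "a \<in> S \<Longrightarrow> b \<in> S \<Longrightarrow> a * b \<in> S" using assms by (simp add: subring_set_def)
qed

lemma subring_set_power: "subring_set S \<Longrightarrow> a \<in> S \<Longrightarrow> a ^ n \<in> S"
  by (induction n) (auto simp: subring_set_closed)

lemma subring_set_sum: "subring_set S \<Longrightarrow> (\<And>x. x \<in> A \<Longrightarrow> f x \<in> S) \<Longrightarrow> sum f A \<in> S"
  by (induction A rule: infinite_finite_induct) (auto simp: subring_set_closed)

lemma subring_set_prod: "subring_set S \<Longrightarrow> (\<And>x. x \<in> A \<Longrightarrow> f x \<in> S) \<Longrightarrow> prod f A \<in> S"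
  by (induction A rule: infinite_finite_induct) (auto simp: subring_set_closed)

lemma subring_set_UNIV [simp]: "subring_set UNIV"
  by (simp add: subring_set_def)

lemma ideal_in_closed:
  assumes "ideal_in S I"
  shows "0 \<in> I" "a \<in> I \<Longrightarrow> b \<in> I \<Longrightarrow> a + b \<in> I" "a \<in> S \<Longrightarrow> b \<in> I \<Longrightarrow> a * b \<in> I"
    "a \<in> I \<Longrightarrow> b \<in> S \<Longrightarrow> a * b \<in> I" "a \<in> I \<Longrightarrow> a \<in> S"
  using assms by (auto simp: ideal_in_def mult.commute)

lemma ideal_in_minus:
  assumes "subring_set S" "ideal_in S I"
  shows "a \<in> I \<Longrightarrow> - a \<in> I" "a \<in> I \<Longrightarrow> b \<in> I \<Longrightarrow> a - b \<in> I"
proof -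
  have m: "- a \<in> I" if "a \<in> I" for a
    using ideal_in_closed(3)[OF assms(2), of "- 1" a] that subring_set_closed[OF assms(1)] by simp
  then show "a \<in> I \<Longrightarrow> - a \<in> I" .
  show "a \<in> I \<Longrightarrow> b \<in> I \<Longrightarrow> a - b \<in> I"
    using ideal_in_closed(2)[OF assms(2), of a "- b"] m by simp
qed

lemma ideal_in_sum: "ideal_in S I \<Longrightarrow> (\<And>x. x \<in> A \<Longrightarrow> f x \<in> I) \<Longrightarrow> sum f A \<in> I"
  by (induction A rule: infinite_finite_induct) (auto intro: ideal_in_closed)

lemma prime_inD:
  assumes "prime_in S P"
  shows "ideal_in S P" "1 \<notin> P" "a \<in> S \<Longrightarrow> b \<in> S \<Longrightarrow> a * b \<in> P \<Longrightarrow> a \<in> P \<or> b \<in> P"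
  using assms by (auto simp: prime_in_def)

lemma prime_in_power:
  assumes "subring_set S" "prime_in S P" "a \<in> S" "a ^ n \<in> P"
  shows "a \<in> P"
  using assms(4)
proof (induction n)
  case 0
  then show ?case using prime_inD(2)[OF assms(2)] by simp
next
  case (Suc n)
  then show ?case
    using prime_inD(3)[OF assms(2,3) subring_set_power[OF assms(1,3)]] by auto
qed

lemma ideal_adjoin:
  assumes "ideal_in UNIV Q"
  shows "ideal_in UNIV {q + x * b | q b. q \<in> Q}"
  unfolding ideal_in_def
proof (intro conjI ballI)
  show "0 \<in> {q + x * b | q b. q \<in> Q}"
    using ideal_in_closed(1)[OF assms] by (auto intro!: exI[of _ 0])
  show "a + b \<in> {q + x * b | q b. q \<in> Q}"
    if ab: "a \<in> {q + x * b | q b. q \<in> Q}" "b \<in> {q + x * b | q b. q \<in> Q}" for a b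
  proof -
    obtain q b1 q' b2 where "q \<in> Q" "q' \<in> Q" "a = q + x * b1" "b = q' + x * b2"
      using ab by blast
    then have "a + b = (q + q') + x * (b1 + b2)" "q + q' \<in> Q"
      using ideal_in_closed(2)[OF assms] by (auto simp: algebra_simps)
    then show ?thesis by blast
  qed
  show "a * b \<in> {q + x * b | q b. q \<in> Q}" if ab: "b \<in> {q + x * b | q b. q \<in> Q}" for a b
  proof -
    obtain q b1 where "q \<in> Q" "b = q + x * b1" using ab by blast
    then have "a * b = a * q + x * (a * b1)" "a * q \<in> Q"
      using ideal_in_closed(3)[OF assms] by (auto simp: algebra_simps)
    then show ?thesis by blast
  qed
qed auto

text \<open>Krull's argument: an ideal that is maximal among those avoiding a multiplicative set is prime.
  The maximality is recorded as well, since the lying-over theorem needs it.\<close>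

lemma exists_prime_avoiding:
  fixes I :: "'a::comm_ring_1 set"
  assumes I: "ideal_in UNIV I" and disj: "I \<inter> M = {}"
    and M: "1 \<in> M" "\<And>a b. a \<in> M \<Longrightarrow> b \<in> M \<Longrightarrow> a * b \<in> M"
  obtains Q where "prime_in UNIV Q" "I \<subseteq> Q" "Q \<inter> M = {}"
    "\<And>x. x \<notin> Q \<Longrightarrow> \<exists>q\<in>Q. \<exists>b. q + x * b \<in> M"
proof -
  let ?A = "{Q. ideal_in UNIV Q \<and> I \<subseteq> Q \<and> Q \<inter> M = {}}"
  have "\<exists>Q\<in>?A. \<forall>J\<in>?A. Q \<subseteq> J \<longrightarrow> J = Q"
  proof (rule subset_Zorn_nonempty)
    show "?A \<noteq> {}" using I disj by blast
    fix C assume C: "C \<noteq> {}" "subset.chain ?A C"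
    then have mem: "\<And>Q. Q \<in> C \<Longrightarrow> ideal_in UNIV Q \<and> I \<subseteq> Q \<and> Q \<inter> M = {}"
      by (auto simp: subset.chain_def)
    have "ideal_in UNIV (\<Union>C)"
      unfolding ideal_in_def
    proof (intro conjI ballI)
      show "0 \<in> \<Union>C" using C(1) mem ideal_in_closed(1) by (metis UnionI ex_in_conv)
      show "a + b \<in> \<Union>C" if ab: "a \<in> \<Union>C" "b \<in> \<Union>C" for a b
      proof -
        obtain I1 I2 where XY: "I1 \<in> C" "I2 \<in> C" "a \<in> I1" "b \<in> I2" using ab by blast
        then have "I1 \<subseteq> I2 \<or> I2 \<subseteq> I1"
          using subset.chain_total[OF C(2), of I1 I2] by auto
        then obtain Z where "Z \<in> C" "a \<in> Z" "b \<in> Z" using XY by auto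
        then show ?thesis using mem by (auto intro: ideal_in_closed(2))
      qed
      show "a * b \<in> \<Union>C" if "b \<in> \<Union>C" for a b
        using that mem by (auto intro: ideal_in_closed(3))
    qed auto
    then show "\<Union>C \<in> ?A" using mem C(1) by blast
  qed
  then obtain Q where QA: "Q \<in> ?A" and "\<forall>J\<in>?A. Q \<subseteq> J \<longrightarrow> J = Q" by (rule bexE)
  then have max: "ideal_in UNIV J \<Longrightarrow> I \<subseteq> J \<Longrightarrow> J \<inter> M = {} \<Longrightarrow> Q \<subseteq> J \<Longrightarrow> J = Q" for J
    by simp
  have Q: "ideal_in UNIV Q" "I \<subseteq> Q" "Q \<inter> M = {}" using QA by simp_all
  have big: "\<exists>q\<in>Q. \<exists>b. q + x * b \<in> M" if x: "x \<notin> Q" for x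
  proof (rule ccontr)
    let ?J = "{q + x * b | q b. q \<in> Q}"
    assume "\<not> ?thesis"
    then have "?J \<inter> M = {}" by blast
    moreover have sub: "Q \<subseteq> ?J"
    proof
      fix q assume "q \<in> Q"
      then show "q \<in> ?J" by (intro CollectI exI[of _ q] exI[of _ 0]) simp
    qed
    moreover have "x \<in> ?J"
      by (intro CollectI exI[of _ 0] exI[of _ 1]) (simp add: ideal_in_closed(1)[OF Q(1)])
    ultimately show False using max[OF ideal_adjoin[OF Q(1)]] Q(2) x by blast
  qed
  have "prime_in UNIV Q"
    unfolding prime_in_def
  proof (intro conjI ballI impI)
    show "1 \<notin> Q" using Q(3) M(1) by blast
    fix a b assume ab: "a * b \<in> Q"
    show "a \<in> Q \<or> b \<in> Q"
    proof (rule ccontr)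
      assume "\<not> ?thesis"
      then obtain q1 b1 q2 b2 where 1: "q1 \<in> Q" "q1 + a * b1 \<in> M" "q2 \<in> Q" "q2 + b * b2 \<in> M"
        using big by blast
      have "(q1 + a * b1) * (q2 + b * b2) = q1 * (q2 + b * b2) + (a * b1) * q2 + (a * b) * (b1 * b2)"
        by (simp add: algebra_simps)
      also have "\<dots> \<in> Q"
        using 1 ab by (simp add: ideal_in_closed(2-4)[OF Q(1)])
      finally show False using M(2)[OF 1(2,4)] Q(3) by blast
    qed
  qed (rule Q(1))
  then show ?thesis using Q(2,3) big by (rule that)
qed

definition integral_over :: "'a::comm_ring_1 set \<Rightarrow> 'a \<Rightarrow> bool" where
  "integral_over S b \<longleftrightarrow> (\<exists>p. lead_coeff p = 1 \<and> (\<forall>i. coeff p i \<in> S) \<and> poly p b = 0)"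

lemma prime_in_contract:
  assumes "subring_set S" "prime_in UNIV Q"
  shows "prime_in S (Q \<inter> S)"
  using assms(2) subring_set_closed[OF assms(1)] unfolding prime_in_def ideal_in_def by auto

text \<open>Lying over, in the relative form that also gives going up.  Let \<open>Q\<close> be maximal among the ideals
  that contain \<open>I\<close> and avoid \<open>S - T\<close>.  If an element \<open>r\<close> of \<open>T\<close> were missing from \<open>Q\<close>, then some
  \<open>s = q + r b\<close> with \<open>q\<close> in \<open>Q\<close> would lie in \<open>S - T\<close>; substituting \<open>r b \<equiv> s\<close> in the integral
  equation of \<open>b\<close>, homogenised with \<open>r\<close>, shows that a power of \<open>s\<close> lies in \<open>T\<close> after all.\<close>

lemma lying_over:
  fixes S :: "'a::comm_ring_1 set"
  assumes S: "subring_set S" and int: "\<And>b. integral_over S b"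
    and T: "prime_in S T" and I: "ideal_in UNIV I" and IT: "I \<inter> S \<subseteq> T"
  obtains Q where "prime_in UNIV Q" "I \<subseteq> Q" "Q \<inter> S = T"
proof -
  have Ti: "ideal_in S T" and TS: "T \<subseteq> S" using T by (auto simp: prime_in_def ideal_in_def)
  obtain Q where Q: "prime_in UNIV Q" "I \<subseteq> Q" "Q \<inter> (S - T) = {}"
    and big: "\<And>x. x \<notin> Q \<Longrightarrow> \<exists>q\<in>Q. \<exists>b. q + x * b \<in> S - T"
  proof (rule exists_prime_avoiding[OF I, of "S - T"])
    show "1 \<in> S - T" using subring_set_closed(1)[OF S] prime_inD(2)[OF T] by blast
    show "a * b \<in> S - T" if "a \<in> S - T" "b \<in> S - T" for a b
      using that by (auto dest: prime_inD(3)[OF T] intro: subring_set_closed(6)[OF S])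
  qed (use IT in auto)
  have Qi: "ideal_in UNIV Q" using Q(1) by (rule prime_inD)
  have "r \<in> Q" if r: "r \<in> T" for r
  proof (rule ccontr)
    assume "r \<notin> Q"
    then obtain q b where q: "q \<in> Q" and s: "q + r * b \<in> S - T" using big by blast
    define s where "s = q + r * b"
    obtain p where p: "lead_coeff p = 1" "\<And>i. coeff p i \<in> S" "poly p b = 0"
      using int[of b] unfolding integral_over_def by blast
    define n where "n = degree p"
    let ?f = "\<lambda>i. coeff p i * r ^ (n - i) * s ^ i"
    have "(\<Sum>i\<le>n. coeff p i * r ^ (n - i) * (r * b) ^ i) = r ^ n * poly p b"
      unfolding poly_altdef n_def[symmetric] sum_distrib_left
    proof (rule sum.cong)
      fix i assume "i \<in> {..n}"
      then have "r ^ n = r ^ (n - i) * r ^ i" by (simp flip: power_add)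
      then show "coeff p i * r ^ (n - i) * (r * b) ^ i = r ^ n * (coeff p i * b ^ i)"
        by (simp only: power_mult_distrib ac_simps)
    qed simp
    then have 0: "(\<Sum>i\<le>n. coeff p i * r ^ (n - i) * (r * b) ^ i) = 0" by (simp add: p(3))
    have "(\<Sum>i\<le>n. ?f i) = (\<Sum>i\<le>n. ?f i) - (\<Sum>i\<le>n. coeff p i * r ^ (n - i) * (r * b) ^ i)"
      by (simp only: 0 diff_0_right)
    also have "\<dots> = (\<Sum>i\<le>n. coeff p i * r ^ (n - i) * (s ^ i - (r * b) ^ i))"
      by (simp add: sum_subtractf right_diff_distrib)
    also have "\<dots> \<in> Q"
    proof (rule ideal_in_sum[OF Qi])
      fix i
      have "s ^ i - (r * b) ^ i = q * (\<Sum>j<i. (r * b) ^ (i - Suc j) * s ^ j)"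
        by (simp add: power_diff_sumr2 s_def)
      then show "coeff p i * r ^ (n - i) * (s ^ i - (r * b) ^ i) \<in> Q"
        using ideal_in_closed(3,4)[OF Qi] q by simp
    qed
    finally have Qs: "(\<Sum>i\<le>n. ?f i) \<in> Q" .
    have sS: "s \<in> S" "s \<notin> T" using s by (auto simp: s_def)
    have rS: "r \<in> S" using r TS by blast
    have fS: "?f i \<in> S" for i
      using sS(1) rS p(2) by (intro subring_set_closed(6)[OF S] subring_set_power[OF S])
    have "(\<Sum>i\<le>n. ?f i) \<in> S" by (rule subring_set_sum[OF S fS])
    with Qs Q(3) have "(\<Sum>i\<le>n. ?f i) \<in> T" by blast
    moreover have "(\<Sum>i<n. ?f i) \<in> T"
    proof (rule ideal_in_sum[OF Ti])
      fix i assume "i \<in> {..<n}"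
      then have "n - i = Suc (n - Suc i)" by auto
      then have "?f i = (coeff p i * r ^ (n - Suc i) * s ^ i) * r" by (simp add: ac_simps)
      also have "\<dots> \<in> T"
        using sS(1) rS p(2) r by (intro ideal_in_closed(3)[OF Ti] subring_set_closed(6)[OF S] subring_set_power[OF S])
      finally show "?f i \<in> T" .
    qed
    ultimately have "(\<Sum>i\<le>n. ?f i) - (\<Sum>i<n. ?f i) \<in> T" by (intro ideal_in_minus[OF S Ti])
    moreover have "(\<Sum>i\<le>n. ?f i) - (\<Sum>i<n. ?f i) = s ^ n"
      using p(1) unfolding lessThan_Suc_atMost[symmetric] by (simp add: n_def)
    ultimately show False using prime_in_power[OF S T sS(1)] sS(2) by simp
  qed
  then have "Q \<inter> S = T" using Q(3) TS by auto
  with Q(1,2) show ?thesis by (rule that)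
qed

text \<open>Incomparability: for an element of \<open>Q'\<close> outside \<open>Q\<close>, the constant term of an integral equation
  of minimal degree modulo \<open>Q\<close> separates the two contractions.\<close>

lemma integral_incomparable:
  fixes S :: "'a::comm_ring_1 set"
  assumes S: "subring_set S" and int: "\<And>b. integral_over S b"
    and Q: "prime_in UNIV Q" and Q': "prime_in UNIV Q'" and less: "Q \<subset> Q'"
  shows "Q \<inter> S \<subset> Q' \<inter> S"
proof -
  have Qi: "ideal_in UNIV Q" and Qi': "ideal_in UNIV Q'" using Q Q' by (auto simp: prime_in_def)
  obtain b where b: "b \<in> Q'" "b \<notin> Q" using less by blast
  let ?eq = "\<lambda>p. lead_coeff p = 1 \<and> (\<forall>i. coeff p i \<in> S) \<and> poly p b \<in> Q"
  obtain p0 where "lead_coeff p0 = 1" "\<forall>i. coeff p0 i \<in> S" "poly p0 b = 0"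
    using int[of b] unfolding integral_over_def by blast
  then have "?eq p0" using ideal_in_closed(1)[OF Qi] by simp
  then have "\<exists>p. ?eq p \<and> (\<forall>p'. ?eq p' \<longrightarrow> degree p \<le> degree p')"
    by (rule ex_has_least_nat)
  then obtain p where p: "lead_coeff p = 1" "\<And>i. coeff p i \<in> S" "poly p b \<in> Q"
    and min: "\<And>p'. lead_coeff p' = 1 \<Longrightarrow> (\<forall>i. coeff p' i \<in> S) \<Longrightarrow> poly p' b \<in> Q \<Longrightarrow> degree p \<le> degree p'"
    by blast
  obtain a p' where pp: "p = pCons a p'" by (cases p)
  have "p' \<noteq> 0"
  proof
    assume "p' = 0"
    then have "p = 1" using p(1) pp by (simp add: one_pCons)
    then show False using p(3) prime_inD(2)[OF Q] by simp
  qed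
  then have p': "lead_coeff p' = 1" "\<And>i. coeff p' i \<in> S" "degree p' < degree p"
    using p(1) p(2)[of "Suc _"] pp by auto
  have "poly p' b \<notin> Q" using min[of p'] p' by fastforce
  moreover have "a + b * poly p' b \<in> Q" using p(3) pp by simp
  ultimately have "a \<notin> Q"
    using ideal_in_minus(2)[OF _ Qi, of "a + b * poly p' b" a] b(2) prime_inD(3)[OF Q, of b "poly p' b"]
    by auto
  moreover have "a \<in> Q'"
    using ideal_in_minus(2)[OF _ Qi', of "a + b * poly p' b" "b * poly p' b"]
      \<open>a + b * poly p' b \<in> Q\<close> less b(1) ideal_in_closed(4)[OF Qi', of b "poly p' b"] by auto
  moreover have "a \<in> S" using p(2)[of 0] pp by simp
  ultimately show ?thesis using less by blast
qed

lemma going_up_chain: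
  fixes S :: "'a::comm_ring_1 set" and T :: "nat \<Rightarrow> 'a set"
  assumes S: "subring_set S" and int: "\<And>b. integral_over S b"
    and T: "\<And>i. i \<le> n \<Longrightarrow> prime_in S (T i)" and less: "\<And>i. i < n \<Longrightarrow> T i \<subset> T (Suc i)"
  obtains Q :: "nat \<Rightarrow> 'a set"
  where "\<And>i. i \<le> n \<Longrightarrow> prime_in UNIV (Q i)" "\<And>i. i < n \<Longrightarrow> Q i \<subset> Q (Suc i)"
proof -
  have "\<exists>Q. (\<forall>i\<le>n. prime_in UNIV (Q i) \<and> Q i \<inter> S = T i) \<and> (\<forall>i<n. Q i \<subset> Q (Suc i))"
    using T less
  proof (induction n)
    case 0
    have "ideal_in UNIV ({0} :: 'a set)" by (simp add: ideal_in_def)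
    moreover have "{0} \<inter> S \<subseteq> T 0"
      using ideal_in_closed(1)[OF prime_inD(1)[OF "0.prems"(1)[of 0]]] by auto
    ultimately obtain Q where "prime_in UNIV Q" "Q \<inter> S = T 0"
      by (rule lying_over[OF S int "0.prems"(1)[of 0, simplified]])
    then show ?case by (intro exI[of _ "\<lambda>_. Q"]) simp
  next
    case (Suc n)
    have "\<exists>Q. (\<forall>i\<le>n. prime_in UNIV (Q i) \<and> Q i \<inter> S = T i) \<and> (\<forall>i<n. Q i \<subset> Q (Suc i))"
      by (rule Suc.IH) (simp_all add: Suc.prems)
    then obtain Q where Q: "\<forall>i\<le>n. prime_in UNIV (Q i) \<and> Q i \<inter> S = T i" "\<forall>i<n. Q i \<subset> Q (Suc i)"
      by blast
    have less: "T n \<subset> T (Suc n)" using Suc.prems(2)[of n] by simp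
    obtain Q' where Q': "prime_in UNIV Q'" "Q n \<subseteq> Q'" "Q' \<inter> S = T (Suc n)"
      by (rule lying_over[OF S int Suc.prems(1)[of "Suc n"], of "Q n"]) (use Q(1) less in \<open>auto dest: prime_inD(1)\<close>)
    have "Q n \<subset> Q'" using Q' Q(1) less by blast
    then show ?case using Q Q'
      by (intro exI[of _ "Q(Suc n := Q')"]) (auto simp: less_Suc_eq le_Suc_eq)
  qed
  then obtain Q where "\<forall>i\<le>n. prime_in UNIV (Q i) \<and> Q i \<inter> S = T i" "\<forall>i<n. Q i \<subset> Q (Suc i)"
    by blast
  then show ?thesis by (intro that[of Q]) simp_all
qed

section \<open>Characteristic polynomials and finite extensions\<close>

definition is_hom :: "('a::comm_ring_1 \<Rightarrow> 'b::comm_ring_1) \<Rightarrow> bool" where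
  "is_hom h \<longleftrightarrow> (\<forall>a b. h (a + b) = h a + h b) \<and> (\<forall>a b. h (a * b) = h a * h b) \<and> h 1 = 1"

lemma is_hom_simps:
  assumes "is_hom h"
  shows "h (a + b) = h a + h b" "h (a * b) = h a * h b" "h 1 = 1" "h 0 = 0" "h (- a) = - h a"
    "h (a - b) = h a - h b"
proof -
  show add: "h (a + b) = h a + h b" for a b using assms by (simp add: is_hom_def)
  show "h (a * b) = h a * h b" "h 1 = 1" using assms by (simp_all add: is_hom_def)
  show 0: "h 0 = 0" using add[of 0 0] by simp
  show neg: "h (- a) = - h a" for a using add[of a "- a"] 0 by (simp add: eq_neg_iff_add_eq_0 add.commute)
  show "h (a - b) = h a - h b" using add[of a "- b"] neg[of b] by simp
qed

lemma is_hom_power: "is_hom h \<Longrightarrow> h (a ^ n) = h a ^ n"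
  by (induction n) (simp_all add: is_hom_simps)

lemma is_hom_sum: "is_hom h \<Longrightarrow> h (sum f A) = (\<Sum>x\<in>A. h (f x))"
  by (induction A rule: infinite_finite_induct) (simp_all add: is_hom_simps)

lemma is_hom_prod: "is_hom h \<Longrightarrow> h (prod f A) = (\<Prod>x\<in>A. h (f x))"
  by (induction A rule: infinite_finite_induct) (simp_all add: is_hom_simps)

lemma is_hom_of_nat: "is_hom h \<Longrightarrow> h (of_nat n) = of_nat n"
  by (induction n) (simp_all add: is_hom_simps)

lemma is_hom_of_int: "is_hom h \<Longrightarrow> h (of_int n) = of_int n"
  by (cases n) (simp_all add: is_hom_simps is_hom_of_nat)

lemma is_hom_comp: "is_hom h \<Longrightarrow> is_hom h' \<Longrightarrow> is_hom (\<lambda>x. h (h' x))"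
  by (simp add: is_hom_def)

lemma is_hom_msubst: "is_hom (msubst \<sigma>)"
  by (simp add: is_hom_def)

lemma is_hom_poly: "is_hom (\<lambda>p. poly p x)"
  by (simp add: is_hom_def)

lemma is_hom_map_poly:
  assumes "is_hom h"
  shows "is_hom (map_poly h)"
  unfolding is_hom_def
proof (intro conjI allI)
  have c: "coeff (map_poly h p) i = h (coeff p i)" for p i
    by (simp add: coeff_map_poly is_hom_simps assms)
  show "map_poly h (a + b) = map_poly h a + map_poly h b" for a b
    by (simp add: poly_eq_iff c is_hom_simps assms)
  show "map_poly h (a * b) = map_poly h a * map_poly h b" for a b
    by (simp add: poly_eq_iff c coeff_mult is_hom_simps is_hom_sum assms)
  show "map_poly h 1 = 1" by (simp add: is_hom_simps assms)
qed

lemma det_hom: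
  fixes A :: "'a::comm_ring_1 ^ 'n ^ 'n"
  assumes "is_hom h"
  shows "h (det A) = det (map_mat h A)"
  by (simp add: det_def map_mat_def is_hom_sum is_hom_prod is_hom_of_int is_hom_simps assms)

lemma map_mat_nth [simp]: "map_mat h A $ r $ s = h (A $ r $ s)"
  by (simp add: map_mat_def)

definition charpoly :: "'a::comm_ring_1 ^ 'n ^ 'n \<Rightarrow> 'a poly" where
  "charpoly M = det (\<chi> r s. (if r = s then [:0, 1:] else 0) - [:M $ r $ s:])"

lemma charpoly_hom:
  assumes "is_hom h"
  shows "map_poly h (charpoly M) = charpoly (map_mat h M)"
  unfolding charpoly_def det_hom[OF is_hom_map_poly[OF assms]]
  by (rule arg_cong[of _ _ det])
    (simp add: vec_eq_iff is_hom_simps is_hom_map_poly assms map_poly_pCons)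

lemma poly_charpoly: "poly (charpoly M) x = det (mat x - M)"
  unfolding charpoly_def det_hom[OF is_hom_poly]
  by (rule arg_cong[of _ _ det]) (simp add: vec_eq_iff mat_def)

lemma prod_linear_monic:
  fixes c :: "'i \<Rightarrow> 'a::comm_ring_1"
  assumes "finite A"
  shows "degree (\<Prod>i\<in>A. [:- c i, 1:]) \<le> card A \<and> coeff (\<Prod>i\<in>A. [:- c i, 1:]) (card A) = 1"
  using assms
proof (induction rule: finite_induct)
  case (insert i A)
  let ?p = "\<Prod>i\<in>A. [:- c i, 1:]"
  have "degree ([:- c i, 1:] * ?p) \<le> degree [:- c i, 1:] + degree ?p" by (rule degree_mult_le)
  moreover have "coeff ?p (Suc (card A)) = 0"
    using insert.IH by (intro coeff_eq_0) simp
  ultimately show ?case using insert by simp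
qed simp

text \<open>Only the identity permutation contributes to the leading term.\<close>

lemma charpoly_monic:
  fixes M :: "'a::comm_ring_1 ^ 'n ^ 'n"
  shows "degree (charpoly M) = CARD('n)" "coeff (charpoly M) (CARD('n)) = 1"
proof -
  let ?e = "\<lambda>r s. (if r = s then [:0, 1:] else 0) - [:M $ r $ s:]"
  let ?t = "\<lambda>p. of_int (sign p) * (\<Prod>i\<in>UNIV. ?e i (p i)) :: 'a poly"
  have e: "degree (?e r s) \<le> (if r = s then 1 else 0)" for r s
    by (auto simp: degree_diff_le)
  have small: "degree (?t p) < CARD('n)" if p: "p \<in> {p. p permutes UNIV} - {id}" for p
  proof -
    obtain i where i: "p i \<noteq> i" using p by (auto simp: fun_eq_iff)
    have "degree (?t p) \<le> degree (of_int (sign p) :: 'a poly) + degree (\<Prod>i\<in>UNIV. ?e i (p i))"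
      by (rule degree_mult_le)
    also have "\<dots> = degree (\<Prod>i\<in>UNIV. ?e i (p i))" by simp
    also have "\<dots> \<le> (\<Sum>i\<in>UNIV. degree (?e i (p i)))"
      using degree_prod_sum_le[of UNIV "\<lambda>i. ?e i (p i)"] by (simp add: o_def)
    also have "\<dots> \<le> (\<Sum>j\<in>UNIV. if j \<noteq> i then 1 else 0)"
    proof (rule sum_mono)
      fix j
      show "degree (?e j (p j)) \<le> (if j \<noteq> i then 1 else 0)"
        using e[of j "p j"] i by (auto split: if_splits)
    qed
    also have "\<dots> = card (UNIV - {i})"
    proof -
      have "{j. j \<noteq> i} = UNIV - {i}" by auto
      then show ?thesis by (simp add: sum.If_cases)
    qed
    also have "\<dots> < CARD('n)" by (simp add: card_Diff_subset card_gt_0_iff)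
    finally show ?thesis .
  qed
  have split: "charpoly M = ?t id + (\<Sum>p\<in>{p. p permutes UNIV} - {id}. ?t p)"
    unfolding charpoly_def det_def
    by (subst sum.remove[of _ id]) (simp_all add: permutes_id)
  have id: "?t id = (\<Prod>i\<in>UNIV. [:- M $ i $ i, 1:])" by (simp add: sign_id)
  have rest: "degree (\<Sum>p\<in>{p. p permutes (UNIV::'n set)} - {id}. ?t p) < CARD('n)"
    using small by (intro degree_sum_less) auto
  show 1: "coeff (charpoly M) (CARD('n)) = 1"
    unfolding split id using prod_linear_monic[of "UNIV :: 'n set" "\<lambda>i. M $ i $ i"] coeff_eq_0[OF rest]
    by simp
  have "degree (charpoly M) \<le> CARD('n)"
    unfolding split id using prod_linear_monic[of "UNIV :: 'n set" "\<lambda>i. M $ i $ i"] rest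
    by (intro degree_add_le) auto
  then show "degree (charpoly M) = CARD('n)" using 1 by (simp add: le_antisym le_degree)
qed

lemma subring_set_coeffs:
  assumes "subring_set S"
  shows "subring_set {p. \<forall>i. coeff p i \<in> S}"
  unfolding subring_set_def
  using subring_set_closed[OF assms]
  by (auto simp: coeff_mult intro!: subring_set_sum[OF assms])

lemma det_in_subring:
  assumes "subring_set S" "\<And>r s. A $ r $ s \<in> S"
  shows "det A \<in> S"
proof -
  have nat: "of_nat n \<in> S" for n
    by (induction n) (auto simp: subring_set_closed[OF assms(1)])
  have "of_int n \<in> S" for n
    by (cases n) (auto simp: subring_set_closed(4)[OF assms(1)] nat
        simp del: of_nat_Suc)
  then show ?thesis unfolding det_def
    by (intro subring_set_sum subring_set_closed(6) subring_set_prod assms)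
qed

lemma coeff_charpoly_in_subring:
  assumes "subring_set S" "\<And>r s. M $ r $ s \<in> S"
  shows "coeff (charpoly M) i \<in> S"
proof -
  have "charpoly M \<in> {p. \<forall>i. coeff p i \<in> S}"
    unfolding charpoly_def
    by (rule det_in_subring[OF subring_set_coeffs[OF assms(1)]])
      (auto simp: coeff_pCons subring_set_closed[OF assms(1)] assms(2) split: nat.splits)
  then show ?thesis by simp
qed

text \<open>The determinant annihilates every linear dependence of the rows; over a commutative ring this
  replaces the inverse matrix.\<close>

lemma det_mult_row_dependence:
  fixes A :: "'a::comm_ring_1 ^ 'n ^ 'n"
  assumes "(\<Sum>i\<in>UNIV. x i *s row i A) = 0"
  shows "x k * det A = 0"
proof -
  have "x k * det A = x k * det (\<chi> i. if i = k then row k A else row i A)"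
    by (rule arg_cong[of _ _ "\<lambda>B. x k * det B"]) (simp add: vec_eq_iff row_def)
  also have "\<dots> = det (\<chi> i. if i = k then x k *s row k A else row i A)"
    by (simp add: det_row_mul)
  also have "\<dots> = (\<Sum>j\<in>UNIV. det (\<chi> i. if i = k then x j *s row j A else row i A))"
  proof -
    have "det (\<chi> i. if i = k then x j *s row j A else row i A) = 0" if "j \<noteq> k" for j
    proof -
      have "det (\<chi> i. if i = k then row j A else row i A) = 0"
        by (rule det_identical_rows[of j k]) (use that in \<open>auto simp: row_def vec_eq_iff\<close>)
      then show ?thesis by (simp add: det_row_mul)
    qed
    then show ?thesis by (subst sum.remove[of _ k]) auto
  qed
  also have "\<dots> = det (\<chi> i. if i = k then (\<Sum>j\<in>UNIV. x j *s row j A) else row i A)"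
    by (subst det_linear_row_sum) auto
  also have "\<dots> = 0" unfolding assms by (simp add: det_row_0)
  finally show ?thesis .
qed

text \<open>The determinant trick: multiplication by \<open>b\<close> is given by a matrix with entries in \<open>S\<close>, and
  \<open>b\<close> is a root of the characteristic polynomial of this matrix.\<close>

lemma integral_over_finite:
  fixes e :: "'i::finite \<Rightarrow> 'a::comm_ring_1"
  assumes S: "subring_set S" and e: "e k = 1"
    and span: "\<And>b. \<exists>c. (\<forall>i. c i \<in> S) \<and> b = (\<Sum>i\<in>UNIV. c i * e i)"
  shows "integral_over S b"
proof -
  have "\<exists>C. \<forall>i. (\<forall>j. C i j \<in> S) \<and> b * e i = (\<Sum>j\<in>UNIV. C i j * e j)"
    using span by (intro choice) blast
  then obtain C where C: "\<And>i j. C i j \<in> S" "\<And>i. b * e i = (\<Sum>j\<in>UNIV. C i j * e j)" by blast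
  define M where "M = (\<chi> i j. C j i)"
  have "(\<Sum>i\<in>UNIV. e i *s row i (mat b - M)) = 0"
  proof (rule vec_eq_iff[THEN iffD2], rule allI)
    fix i
    have "(\<Sum>j\<in>UNIV. e j * ((if j = i then b else 0) - C i j)) = b * e i - (\<Sum>j\<in>UNIV. C i j * e j)"
      by (simp add: right_diff_distrib sum_subtractf mult.commute if_distrib[of "\<lambda>x. _ * x"] cong: if_cong)
    then show "(\<Sum>j\<in>UNIV. e j *s row j (mat b - M)) $ i = 0 $ i"
      by (simp add: row_def M_def mat_def C(2))
  qed
  from det_mult_row_dependence[OF this, of k] have "poly (charpoly M) b = 0"
    by (simp add: e poly_charpoly)
  moreover have "coeff (charpoly M) i \<in> S" for i
    by (rule coeff_charpoly_in_subring[OF S]) (simp add: M_def C(1))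
  ultimately show ?thesis
    unfolding integral_over_def using charpoly_monic[of M] by metis
qed

hide_const (open) module.smult

section \<open>Points of prime ideals\<close>

definition polys_over :: "'a::comm_ring_1 set \<Rightarrow> 'a poly set" where
  "polys_over S = {p. \<forall>i. coeff p i \<in> S}"

definition adjoin :: "'a::comm_ring_1 set \<Rightarrow> 'a \<Rightarrow> 'a set" where
  "adjoin S v = {poly p v | p. p \<in> polys_over S}"

text \<open>The homomorphisms \<open>\<eta>\<close> of \<open>k\<close>-algebras from \<open>S\<close> to \<open>k\<close> that vanish on \<open>P\<close>; the values of \<open>\<eta>\<close> outside
  \<open>S\<close> are arbitrary.  The map \<open>\<iota>\<close> makes \<open>S\<close> a \<open>k\<close>-algebra.\<close>

definition place_on :: "('k::field \<Rightarrow> 'a::comm_ring_1) \<Rightarrow> 'a set \<Rightarrow> 'a set \<Rightarrow> ('a \<Rightarrow> 'k) \<Rightarrow> bool" where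
  "place_on \<iota> P S \<eta> \<longleftrightarrow> (\<forall>c. \<eta> (\<iota> c) = c) \<and> (\<forall>a\<in>P \<inter> S. \<eta> a = 0) \<and>
     (\<forall>a\<in>S. \<forall>b\<in>S. \<eta> (a + b) = \<eta> a + \<eta> b \<and> \<eta> (a * b) = \<eta> a * \<eta> b)"

text \<open>The Nullstellensatz for \<open>P \<inter> S\<close>: this prime is an intersection of kernels of places.  In this form
  it passes from \<open>S\<close> to \<open>S[v]\<close>.\<close>

definition has_places :: "('k::field \<Rightarrow> 'a::comm_ring_1) \<Rightarrow> 'a set \<Rightarrow> 'a set \<Rightarrow> bool" where
  "has_places \<iota> P S \<longleftrightarrow> (\<forall>b\<in>S - P. \<exists>\<eta>. place_on \<iota> P S \<eta> \<and> \<eta> b \<noteq> 0)"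

lemma subring_polys_over: "subring_set S \<Longrightarrow> subring_set (polys_over S)"
  unfolding polys_over_def by (rule subring_set_coeffs)

lemma polys_over_intros:
  assumes "subring_set S"
  shows "c \<in> S \<Longrightarrow> [:c:] \<in> polys_over S" "c \<in> S \<Longrightarrow> monom c n \<in> polys_over S"
    "c \<in> S \<Longrightarrow> p \<in> polys_over S \<Longrightarrow> smult c p \<in> polys_over S"
    "p \<in> polys_over S \<Longrightarrow> poly_cutoff n p \<in> polys_over S"
  using subring_set_closed[OF assms]
  by (auto simp: polys_over_def coeff_pCons coeff_poly_cutoff split: nat.splits)

lemma subring_adjoin:
  assumes "subring_set S"
  shows "subring_set (adjoin S v)"
proof -
  note c = subring_set_closed[OF subring_polys_over[OF assms]]
  have "1 \<in> adjoin S v" unfolding adjoin_def using c(1) by (intro CollectI exI[of _ 1]) simp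
  moreover have "poly p v - poly q v \<in> adjoin S v \<and> poly p v * poly q v \<in> adjoin S v"
    if "p \<in> polys_over S" "q \<in> polys_over S" for p q
    unfolding adjoin_def using c(3,6)[OF that] by (metis (mono_tags) mem_Collect_eq poly_diff poly_mult)
  ultimately show ?thesis unfolding subring_set_def by (auto simp: adjoin_def)
qed

lemma adjoin_superset: "subring_set S \<Longrightarrow> S \<subseteq> adjoin S v"
  unfolding adjoin_def
  by (auto intro!: polys_over_intros(1) exI[of _ "[:x:]" for x])

lemma adjoin_generator: "subring_set S \<Longrightarrow> v \<in> adjoin S v"
  unfolding adjoin_def using polys_over_intros(2)[of S 1 1]
  by (auto simp: subring_set_closed poly_monom intro!: exI[of _ "monom 1 1"])

lemma poly_in_ideal:
  assumes "ideal_in UNIV P" "\<And>i. coeff p i \<in> P"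
  shows "poly p v \<in> P"
  unfolding poly_altdef by (intro ideal_in_sum[OF assms(1)] ideal_in_closed(4)[OF assms(1)] assms(2)) simp

text \<open>Dropping the leading terms with coefficients in \<open>P\<close> changes the value only modulo \<open>P\<close>.\<close>

lemma strip_leading:
  assumes S: "subring_set S" and P: "ideal_in UNIV P" and p: "p \<in> polys_over S" "coeff p j \<notin> P"
  obtains p' where "p' \<in> polys_over S" "lead_coeff p' \<notin> P" "degree p' \<le> degree p"
    "poly p v - poly p' v \<in> P"
proof -
  let ?J = "{i. coeff p i \<notin> P}"
  have "i \<le> degree p" if "i \<in> ?J" for i
    using that ideal_in_closed(1)[OF P] by (auto intro: le_degree)
  then have fin: "finite ?J" by (meson finite_nat_set_iff_bounded_le)
  define d where "d = Max ?J"
  have d: "coeff p d \<notin> P" "\<And>i. i > d \<Longrightarrow> coeff p i \<in> P"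
    using Max_in[OF fin] p(2) Max_ge[OF fin] unfolding d_def by fastforce+
  define p' where "p' = poly_cutoff (Suc d) p"
  have c: "coeff p' i = (if i \<le> d then coeff p i else 0)" for i
    by (simp add: p'_def coeff_poly_cutoff less_Suc_eq_le)
  have "coeff p d \<noteq> 0" using d(1) ideal_in_closed(1)[OF P] by metis
  then have deg: "degree p' = d"
    by (intro antisym degree_le le_degree) (auto simp: c)
  have "poly (p - p') v \<in> P"
    using d(2) ideal_in_closed(1)[OF P] by (intro poly_in_ideal[OF P]) (auto simp: c)
  then have diff: "poly p v - poly p' v \<in> P" by simp
  have "degree p' \<le> degree p" using deg \<open>coeff p d \<noteq> 0\<close> le_degree by blast
  moreover have "lead_coeff p' \<notin> P" using d(1) by (simp add: deg c)
  moreover have "p' \<in> polys_over S" using p(1) polys_over_intros(4)[OF S] by (simp add: p'_def)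
  ultimately show ?thesis using diff by (intro that[of p'])
qed

lemma degree_less_if_coeff_0:
  assumes "degree p \<le> n" "coeff p n = 0" "n > 0"
  shows "degree p < n"
  using assms by (cases "degree p = n") auto

lemma pseudo_division:
  assumes S: "subring_set S" and f: "f \<in> polys_over S" "degree f \<ge> 1" and g: "g \<in> polys_over S"
  obtains N q r where "q \<in> polys_over S" "r \<in> polys_over S" "degree r < degree f"
    "degree q \<le> degree g - degree f" "smult (lead_coeff f ^ N) g = q * f + r"
proof -
  note cl = subring_set_closed[OF subring_polys_over[OF S]]
  let ?a = "lead_coeff f"
  have a: "?a \<in> S" using f(1) by (simp add: polys_over_def)
  have "\<exists>N q r. q \<in> polys_over S \<and> r \<in> polys_over S \<and> degree r < degree f \<and>
      degree q \<le> degree g - degree f \<and> smult (?a ^ N) g = q * f + r"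
    using g
  proof (induction "degree g" arbitrary: g rule: less_induct)
    case less
    show ?case
    proof (cases "degree g < degree f")
      case True
      then show ?thesis using less.prems cl(2) by (intro exI[of _ 0] exI[of _ 0] exI[of _ g]) simp
    next
      case False
      let ?m = "monom (lead_coeff g) (degree g - degree f)"
      let ?g = "smult ?a g - ?m * f"
      have m: "?m \<in> polys_over S" using less.prems polys_over_intros(2)[OF S] by (simp add: polys_over_def)
      have gS: "?g \<in> polys_over S" by (intro cl(3) cl(6) polys_over_intros(3)[OF S] a less.prems m f(1))
      have "degree (?m * f) \<le> degree g"
        using degree_mult_le[of ?m f] degree_monom_le[of "lead_coeff g" "degree g - degree f"] False by linarith
      then have "degree ?g \<le> degree g" by (intro degree_diff_le degree_smult_le)
      moreover have "coeff ?g (degree g) = 0"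
        using False by (simp add: coeff_monom_mult mult.commute[of "lead_coeff f" "lead_coeff g"])
      moreover have "degree g > 0" using False f(2) by linarith
      ultimately have "degree ?g < degree g"
        by (rule degree_less_if_coeff_0)
      then obtain N q r where q: "q \<in> polys_over S" "r \<in> polys_over S" "degree r < degree f"
        "degree q \<le> degree ?g - degree f" "smult (?a ^ N) ?g = q * f + r"
        using less.hyps gS by blast
      let ?q = "q + smult (?a ^ N) ?m"
      have "smult (?a ^ Suc N) g = smult (?a ^ N) ?g + smult (?a ^ N) (?m * f)"
        by (simp add: smult_diff_right mult.commute[of ?a])
      also have "\<dots> = ?q * f + r"
        unfolding q(5) by (simp add: distrib_right)
      finally have "smult (?a ^ Suc N) g = ?q * f + r" .
      moreover have "?q \<in> polys_over S"
        by (intro cl(5) q(1) polys_over_intros(3)[OF S subring_set_power[OF S a]] m)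
      moreover have "degree ?q \<le> degree g - degree f"
      proof (rule degree_add_le)
        show "degree q \<le> degree g - degree f" using q(4) \<open>degree ?g < degree g\<close> by linarith
        show "degree (smult (?a ^ N) ?m) \<le> degree g - degree f"
          using degree_smult_le degree_monom_le le_trans by blast
      qed
      ultimately show ?thesis using q(2,3) by blast
    qed
  qed
  then show ?thesis using that by blast
qed

lemma place_on_map_poly:
  assumes S: "subring_set S" and \<iota>: "is_hom \<iota>" "range \<iota> \<subseteq> S" and \<eta>: "place_on \<iota> P S \<eta>"
  shows "\<eta> 0 = 0" "\<eta> 1 = 1" "a \<in> S \<Longrightarrow> \<eta> (a ^ n) = \<eta> a ^ n"
    "p \<in> polys_over S \<Longrightarrow> q \<in> polys_over S \<Longrightarrow> map_poly \<eta> (p + q) = map_poly \<eta> p + map_poly \<eta> q"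
    "p \<in> polys_over S \<Longrightarrow> q \<in> polys_over S \<Longrightarrow> map_poly \<eta> (p - q) = map_poly \<eta> p - map_poly \<eta> q"
    "p \<in> polys_over S \<Longrightarrow> q \<in> polys_over S \<Longrightarrow> map_poly \<eta> (p * q) = map_poly \<eta> p * map_poly \<eta> q"
    "a \<in> S \<Longrightarrow> p \<in> polys_over S \<Longrightarrow> map_poly \<eta> (smult a p) = smult (\<eta> a) (map_poly \<eta> p)"
proof -
  have hom: "\<eta> (a + b) = \<eta> a + \<eta> b" "\<eta> (a * b) = \<eta> a * \<eta> b" if "a \<in> S" "b \<in> S" for a b
    using \<eta> that by (auto simp: place_on_def)
  have \<iota>c: "\<eta> (\<iota> c) = c" for c using \<eta> by (simp add: place_on_def)
  show 0: "\<eta> 0 = 0" and 1: "\<eta> 1 = 1" using \<iota>c[of 0] \<iota>c[of 1] by (simp_all add: is_hom_simps \<iota>(1))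
  show "\<eta> (a ^ n) = \<eta> a ^ n" if "a \<in> S" for a n
    by (induction n) (simp_all add: 1 hom that subring_set_power[OF S])
  have sub: "\<eta> (a - b) = \<eta> a - \<eta> b" if "a \<in> S" "b \<in> S" for a b
    using hom(1)[of "a - b" b] that subring_set_closed(3)[OF S] by (simp add: algebra_simps)
  have sum: "\<eta> (sum F A) = (\<Sum>x\<in>A. \<eta> (F x))" if "\<And>x. x \<in> A \<Longrightarrow> F x \<in> S" for A and F :: "nat \<Rightarrow> 'a"
    using that by (induction A rule: infinite_finite_induct) (auto simp: 0 hom subring_set_sum[OF S])
  have c: "coeff (map_poly \<eta> p) i = \<eta> (coeff p i)" for p i by (simp add: coeff_map_poly 0)
  show "map_poly \<eta> (p + q) = map_poly \<eta> p + map_poly \<eta> q" if "p \<in> polys_over S" "q \<in> polys_over S"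
    using that by (simp add: poly_eq_iff c hom polys_over_def)
  show "map_poly \<eta> (p - q) = map_poly \<eta> p - map_poly \<eta> q" if "p \<in> polys_over S" "q \<in> polys_over S"
    using that by (simp add: poly_eq_iff c sub polys_over_def)
  show "map_poly \<eta> (p * q) = map_poly \<eta> p * map_poly \<eta> q" if "p \<in> polys_over S" "q \<in> polys_over S"
    using that by (simp add: poly_eq_iff c hom coeff_mult sum subring_set_closed(6)[OF S] polys_over_def)
  show "map_poly \<eta> (smult a p) = smult (\<eta> a) (map_poly \<eta> p)" if "a \<in> S" "p \<in> polys_over S"
    using that by (simp add: poly_eq_iff c hom polys_over_def)
qed

text \<open>A place of \<open>S\<close> together with a value \<open>\<xi>\<close> for \<open>v\<close> that respects all relations modulo \<open>P\<close>
  defines a place of \<open>S[v]\<close>.\<close>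

lemma place_extend:
  assumes S: "subring_set S" and \<iota>: "is_hom \<iota>" "range \<iota> \<subseteq> S" and P: "ideal_in UNIV P"
    and \<eta>: "place_on \<iota> P S \<eta>"
    and rel: "\<And>f. f \<in> polys_over S \<Longrightarrow> poly f v \<in> P \<Longrightarrow> poly (map_poly \<eta> f) \<xi> = 0"
  obtains \<eta>' where "place_on \<iota> P (adjoin S v) \<eta>'"
    "\<And>f. f \<in> polys_over S \<Longrightarrow> \<eta>' (poly f v) = poly (map_poly \<eta> f) \<xi>"
proof -
  note cl = subring_set_closed[OF subring_polys_over[OF S]]
  note h = place_on_map_poly[OF S \<iota> \<eta>]
  define rep where "rep x = (SOME p. p \<in> polys_over S \<and> poly p v = x)" for x
  define \<eta>' where "\<eta>' x = poly (map_poly \<eta> (rep x)) \<xi>" for x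
  have val: "\<eta>' (poly f v) = poly (map_poly \<eta> f) \<xi>" if f: "f \<in> polys_over S" for f
  proof -
    have "\<exists>p. p \<in> polys_over S \<and> poly p v = poly f v" using f by blast
    then have "rep (poly f v) \<in> polys_over S \<and> poly (rep (poly f v)) v = poly f v"
      unfolding rep_def by (rule someI_ex)
    then have r: "rep (poly f v) \<in> polys_over S" "poly (rep (poly f v)) v = poly f v" by auto
    have "poly (map_poly \<eta> (rep (poly f v) - f)) \<xi> = 0"
      using r f ideal_in_closed(1)[OF P] by (intro rel cl(3)) simp_all
    then show ?thesis using r f by (simp add: h(5) \<eta>'_def)
  qed
  have \<iota>c: "\<eta> (\<iota> c) = c" for c using \<eta> by (simp add: place_on_def)
  have "place_on \<iota> P (adjoin S v) \<eta>'"
    unfolding place_on_def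
  proof (intro conjI allI ballI)
    fix c
    have "[:\<iota> c:] \<in> polys_over S" using polys_over_intros(1)[OF S] \<iota>(2) by blast
    from val[OF this] show "\<eta>' (\<iota> c) = c" by (simp add: map_poly_pCons h(1) \<iota>c)
  next
    fix a assume "a \<in> P \<inter> adjoin S v"
    then show "\<eta>' a = 0" using val rel by (auto simp: adjoin_def)
  next
    fix a b assume "a \<in> adjoin S v" "b \<in> adjoin S v"
    then obtain p q where pq: "p \<in> polys_over S" "q \<in> polys_over S" "a = poly p v" "b = poly q v"
      by (auto simp: adjoin_def)
    show "\<eta>' (a + b) = \<eta>' a + \<eta>' b"
      using val[OF cl(5)[OF pq(1,2)]] pq by (simp add: val h(4))
    show "\<eta>' (a * b) = \<eta>' a * \<eta>' b"
      using val[OF cl(6)[OF pq(1,2)]] pq by (simp add: val h(6))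
  qed
  then show ?thesis using val by (rule that)
qed

lemma infinite_alg_closed: "infinite (UNIV :: 'k::alg_closed_field set)"
proof
  assume fin: "finite (UNIV :: 'k set)"
  let ?p = "(\<Prod>a\<in>UNIV. [:- a, 1:]) + 1 :: 'k poly"
  have deg: "degree (\<Prod>a\<in>UNIV. [:- a, 1:] :: 'k poly) = card (UNIV :: 'k set)"
    by (subst degree_prod_sum_eq) auto
  have "card (UNIV :: 'k set) > 0" using fin by (simp add: card_gt_0_iff)
  then have "degree ?p > 0" using deg by (subst degree_add_eq_left) auto
  then obtain x where "poly ?p x = 0" using alg_closed_imp_poly_has_root by blast
  moreover have "poly (\<Prod>a\<in>UNIV. [:- a, 1:]) x = 0"
    by (simp add: poly_prod fin)
  ultimately show False by simp
qed

lemma exists_non_root: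
  fixes p :: "'k::alg_closed_field poly"
  assumes "p \<noteq> 0"
  obtains x where "poly p x \<noteq> 0"
  using poly_roots_finite[OF assms] infinite_alg_closed[where 'k = 'k]
  by (metis (mono_tags, lifting) Collect_cong UNIV_def)

text \<open>The induction step of the Nullstellensatz.  A place of \<open>S\<close> that is nonzero at one suitable element
  is extended to \<open>S[v]\<close>, where this element is a coefficient of \<open>b\<close>, or a multiple of \<open>b\<close> modulo \<open>P\<close>,
  according to whether \<open>v\<close> is transcendental or algebraic modulo \<open>P\<close>.\<close>

lemma has_places_adjoin:
  fixes P :: "'a::comm_ring_1 set" and \<iota> :: "'k::alg_closed_field \<Rightarrow> 'a"
  assumes S: "subring_set S" and \<iota>: "is_hom \<iota>" "range \<iota> \<subseteq> S" and P: "prime_in UNIV P"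
    and hp: "has_places \<iota> P S"
  shows "has_places \<iota> P (adjoin S v)"
  unfolding has_places_def
proof
  fix b assume b: "b \<in> adjoin S v - P"
  have Pi: "ideal_in UNIV P" and P1: "1 \<notin> P" and Pp: "\<And>x y. x * y \<in> P \<Longrightarrow> x \<in> P \<or> y \<in> P"
    using P by (auto simp: prime_in_def)
  note Pc = ideal_in_closed[OF Pi]
  note Pm = ideal_in_minus[OF subring_set_UNIV Pi]
  note cl = subring_set_closed[OF subring_polys_over[OF S]]
  have Ppow: "x ^ N \<notin> P" if "x \<notin> P" for x N
    using prime_in_power[OF subring_set_UNIV P, of x N] that by auto
  have Pcong: "x \<in> P \<longleftrightarrow> y \<in> P" if "x - y \<in> P" for x y
    using Pc(2)[OF that, of y] Pm(2)[of x "x - y"] that by auto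
  obtain \<beta> where \<beta>: "\<beta> \<in> polys_over S" "b = poly \<beta> v" using b by (auto simp: adjoin_def)
  define A where "A = {f \<in> polys_over S. lead_coeff f \<notin> P \<and> poly f v \<in> P}"
  have strip: "\<exists>p'. p' \<in> polys_over S \<and> lead_coeff p' \<notin> P \<and> degree p' \<le> degree p \<and> poly p v - poly p' v \<in> P"
    if "p \<in> polys_over S" "coeff p j \<notin> P" for p j
    by (rule strip_leading[OF S Pi that, of v]) blast
  show "\<exists>\<eta>. place_on \<iota> P (adjoin S v) \<eta> \<and> \<eta> b \<noteq> 0"
  proof (cases "A = {}")
    \<comment> \<open>The generator is transcendental modulo \<open>P\<close>: any value outside a finite set will do.\<close>
    case True
    have co: "coeff f i \<in> P" if "f \<in> polys_over S" "poly f v \<in> P" for f i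
    proof (rule ccontr)
      assume "coeff f i \<notin> P"
      from strip[OF that(1) this] obtain p' where p': "p' \<in> polys_over S" "lead_coeff p' \<notin> P" "poly f v - poly p' v \<in> P"
        by auto
      then have "p' \<in> A" using Pcong that(2) by (auto simp: A_def)
      with True show False by simp
    qed
    have "\<exists>i. coeff \<beta> i \<notin> P" using poly_in_ideal[OF Pi, of \<beta> v] b \<beta>(2) by auto
    then obtain i where i: "coeff \<beta> i \<notin> P" ..
    then have "coeff \<beta> i \<in> S - P" using \<beta>(1) by (simp add: polys_over_def)
    then obtain \<eta> where \<eta>: "place_on \<iota> P S \<eta>" "\<eta> (coeff \<beta> i) \<noteq> 0"
      using bspec[OF hp[unfolded has_places_def]] by blast
    note h = place_on_map_poly[OF S \<iota> \<eta>(1)]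
    have "coeff (map_poly \<eta> \<beta>) i \<noteq> 0" using \<eta>(2) by (simp add: coeff_map_poly h(1))
    then have "map_poly \<eta> \<beta> \<noteq> 0" by auto
    then obtain \<xi> where \<xi>: "poly (map_poly \<eta> \<beta>) \<xi> \<noteq> 0" by (rule exists_non_root)
    have rel: "poly (map_poly \<eta> f) \<xi> = 0" if f: "f \<in> polys_over S" "poly f v \<in> P" for f
    proof -
      have "\<eta> (coeff f i) = 0" for i
        using co[OF f] f(1) \<eta>(1) by (simp add: place_on_def polys_over_def)
      then have "map_poly \<eta> f = 0" by (simp add: poly_eq_iff coeff_map_poly h(1))
      then show ?thesis by simp
    qed
    obtain \<eta>' where "place_on \<iota> P (adjoin S v) \<eta>'"
      "\<And>f. f \<in> polys_over S \<Longrightarrow> \<eta>' (poly f v) = poly (map_poly \<eta> f) \<xi>"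
      by (rule place_extend[where v = v, OF S \<iota> Pi \<eta>(1) rel]) (assumption+, rule that, simp_all)
    then show ?thesis using \<beta> \<xi> by (intro exI[of _ \<eta>']) simp
  next
    \<comment> \<open>The generator is algebraic modulo \<open>P\<close>: its value has to be a root of a relation \<open>f\<close> of
      least degree, and \<open>b\<close> divides, modulo \<open>P\<close>, an element \<open>c\<close> of the smaller ring.\<close>
    case False
    then obtain f where "f \<in> A" and "\<forall>g. g \<in> A \<longrightarrow> degree f \<le> degree g"
      using ex_has_least_nat[of "\<lambda>f. f \<in> A" _ degree] by blast
    then have f: "f \<in> polys_over S" "lead_coeff f \<notin> P" "poly f v \<in> P"
      and min: "\<And>g. g \<in> A \<Longrightarrow> degree f \<le> degree g"
      by (auto simp: A_def)
    define a where "a = lead_coeff f"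
    have aS: "a \<in> S" and aP: "a \<notin> P" using f(1,2) by (auto simp: a_def polys_over_def)
    have deg1: "degree f \<ge> 1"
    proof (rule ccontr)
      assume "\<not> ?thesis"
      then have "degree f = 0" by simp
      then obtain c where "f = [:c:]" by (rule degree_eq_zeroE)
      then show False using f(2,3) by simp
    qed
    have co: "coeff g i \<in> P" if "g \<in> polys_over S" "poly g v \<in> P" "degree g < degree f" for g i
    proof (rule ccontr)
      assume "coeff g i \<notin> P"
      from strip[OF that(1) this] obtain p' where p': "p' \<in> polys_over S" "lead_coeff p' \<notin> P"
        "degree p' \<le> degree g" "poly g v - poly p' v \<in> P" by auto
      then have "p' \<in> A" using Pcong that(2) by (auto simp: A_def)
      from min[OF this] show False using p'(3) that(3) by simp
    qed
    \<comment> \<open>Euclid's algorithm for \<open>f\<close> and \<open>\<beta>\<close>: among the polynomials whose value is a multiple of \<open>b\<close>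
      modulo \<open>P\<close>, but not in \<open>P\<close>, one of least degree is a constant.\<close>
    define H where "H = {h \<in> polys_over S. lead_coeff h \<notin> P \<and> poly h v \<notin> P \<and>
        (\<exists>u\<in>polys_over S. poly h v - poly u v * b \<in> P)}"
    have inH: "\<exists>h\<in>H. degree h \<le> degree r"
      if r: "r \<in> polys_over S" "poly r v \<notin> P" "u \<in> polys_over S" "poly r v - poly u v * b \<in> P" for r u
    proof -
      have "\<exists>i. coeff r i \<notin> P" using poly_in_ideal[OF Pi, of r v] r(2) by auto
      then obtain p' where p': "p' \<in> polys_over S" "lead_coeff p' \<notin> P" "degree p' \<le> degree r"
        "poly r v - poly p' v \<in> P" using strip[OF r(1)] by metis
      have "poly p' v - poly u v * b = (poly r v - poly u v * b) - (poly r v - poly p' v)" by simp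
      then have "poly p' v - poly u v * b \<in> P" using Pm(2)[OF r(4) p'(4)] by simp
      moreover have "poly p' v \<notin> P" using Pcong[OF p'(4)] r(2) by simp
      ultimately have "p' \<in> H" using p'(1,2) r(3) by (auto simp: H_def)
      then show ?thesis using p'(3) by blast
    qed
    have "H \<noteq> {}"
      using inH[of \<beta> 1] \<beta> b cl(1) Pc(1) by auto
    then obtain h where "h \<in> H" and "\<forall>g. g \<in> H \<longrightarrow> degree h \<le> degree g"
      using ex_has_least_nat[of "\<lambda>f. f \<in> H" _ degree] by blast
    then have hH: "h \<in> polys_over S" "lead_coeff h \<notin> P" "poly h v \<notin> P"
      and minh: "\<And>g. g \<in> H \<Longrightarrow> degree h \<le> degree g"
      by (auto simp: H_def)
    obtain u where u: "u \<in> polys_over S" "poly h v - poly u v * b \<in> P"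
      using \<open>h \<in> H\<close> by (auto simp: H_def)
    have h_f: "degree h < degree f"
    proof -
      obtain N q r where q: "q \<in> polys_over S" "r \<in> polys_over S" "degree r < degree f"
        "degree q \<le> degree h - degree f" "smult (a ^ N) h = q * f + r"
        by (rule pseudo_division[OF S f(1) deg1 hH(1), folded a_def])
      have e: "a ^ N * poly h v = poly q v * poly f v + poly r v"
        using arg_cong[OF q(5), of "\<lambda>p. poly p v"] by simp
      then have "a ^ N * poly h v - poly r v \<in> P" using Pc(3)[OF _ f(3)] by simp
      moreover have "a ^ N * poly h v \<notin> P" using Pp Ppow[OF aP] hH(3) by blast
      ultimately have "poly r v \<notin> P" using Pcong by blast
      moreover have "poly r v - poly (smult (a ^ N) u) v * b
          = a ^ N * (poly h v - poly u v * b) - poly q v * poly f v"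
        using e by (simp add: algebra_simps)
      then have "poly r v - poly (smult (a ^ N) u) v * b \<in> P"
        using Pm(2)[OF Pc(3)[OF _ u(2)] Pc(3)[OF _ f(3)]] by simp
      ultimately obtain g where "g \<in> H" "degree g \<le> degree r"
        using inH[OF q(2) _ polys_over_intros(3)[OF S subring_set_power[OF S aS] u(1)]] by blast
      then show ?thesis using minh q(3) by fastforce
    qed
    define c where "c = lead_coeff h"
    have cS: "c \<in> S" and cP: "c \<notin> P" using hH(1,2) by (auto simp: c_def polys_over_def)
    have h0: "degree h = 0"
    proof (rule ccontr)
      assume "degree h \<noteq> 0"
      then have h1: "degree h \<ge> 1" by simp
      obtain N q r where q: "q \<in> polys_over S" "r \<in> polys_over S" "degree r < degree h"
        "degree q \<le> degree f - degree h" "smult (c ^ N) f = q * h + r"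
        by (rule pseudo_division[OF S hH(1) h1 f(1), folded c_def])
      have e: "c ^ N * poly f v = poly q v * poly h v + poly r v"
        using arg_cong[OF q(5), of "\<lambda>p. poly p v"] by simp
      have "poly r v - poly (- (q * u)) v * b = c ^ N * poly f v - poly q v * (poly h v - poly u v * b)"
        using e by (simp add: algebra_simps)
      then have "poly r v - poly (- (q * u)) v * b \<in> P"
        using Pm(2)[OF Pc(3)[OF _ f(3)] Pc(3)[OF _ u(2)]] by simp
      then have "poly r v \<in> P"
        using inH[OF q(2) _ cl(4)[OF cl(6)[OF q(1) u(1)]]] minh q(3) by fastforce
      moreover have "c ^ N * poly f v - poly r v = poly q v * poly h v" using e by simp
      ultimately have "poly q v * poly h v \<in> P"
        using Pm(2)[OF Pc(3)[OF _ f(3)], of "c ^ N" "poly r v"] by simp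
      then have "poly q v \<in> P" using Pp hH(3) by blast
      moreover have "degree q < degree f" using q(4) h1 h_f by linarith
      ultimately have "coeff q i \<in> P" for i using co q(1) by blast
      then have "coeff (q * h) (degree f) \<in> P"
        unfolding coeff_mult by (intro ideal_in_sum[OF Pi] Pc(4)) auto
      moreover have "coeff (q * h) (degree f) = c ^ N * a"
        using arg_cong[OF q(5), of "\<lambda>p. coeff p (degree f)"] q(3) h_f
        by (simp add: a_def coeff_eq_0[of r])
      ultimately show False using Pp[of "c ^ N" a] Ppow[OF cP] aP by simp
    qed
    then have hc: "h = [:c:]" using degree_0_id[of h] by (simp add: c_def)
    \<comment> \<open>A place with \<open>\<eta> a \<noteq> 0\<close> preserves the degree of \<open>f\<close> and allows pseudo-division by \<open>f\<close>;
      \<open>\<eta> c \<noteq> 0\<close> makes the value of \<open>b\<close> nonzero.\<close>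
    have "a * c \<in> S - P" using aS cS subring_set_closed(6)[OF S] aP cP Pp by blast
    then obtain \<eta> where \<eta>: "place_on \<iota> P S \<eta>" "\<eta> (a * c) \<noteq> 0"
      using bspec[OF hp[unfolded has_places_def]] by blast
    note hm = place_on_map_poly[OF S \<iota> \<eta>(1)]
    have "\<eta> (a * c) = \<eta> a * \<eta> c" using \<eta>(1) aS cS by (simp add: place_on_def)
    then have \<eta>ac: "\<eta> a \<noteq> 0" "\<eta> c \<noteq> 0" using \<eta>(2) by auto
    have cm: "coeff (map_poly \<eta> p) i = \<eta> (coeff p i)" for p i by (simp add: coeff_map_poly hm(1))
    have "coeff (map_poly \<eta> f) (degree f) \<noteq> 0" using \<eta>ac(1) by (simp add: cm a_def)
    then have "degree (map_poly \<eta> f) > 0" using le_degree deg1 by (metis less_le_trans zero_less_one)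
    then obtain \<xi> where \<xi>: "poly (map_poly \<eta> f) \<xi> = 0" using alg_closed_imp_poly_has_root by blast
    have rel: "poly (map_poly \<eta> g) \<xi> = 0" if g: "g \<in> polys_over S" "poly g v \<in> P" for g
    proof -
      obtain N q r where q: "q \<in> polys_over S" "r \<in> polys_over S" "degree r < degree f"
        "degree q \<le> degree g - degree f" "smult (a ^ N) g = q * f + r"
        by (rule pseudo_division[OF S f(1) deg1 g(1), folded a_def])
      have "poly r v = a ^ N * poly g v - poly q v * poly f v"
        using arg_cong[OF q(5), of "\<lambda>p. poly p v"] by simp
      then have "poly r v \<in> P" using Pm(2)[OF Pc(3)[OF _ g(2)] Pc(3)[OF _ f(3)]] by simp
      then have "\<eta> (coeff r i) = 0" for i
        using co[OF q(2) _ q(3)] q(2) \<eta>(1) by (simp add: place_on_def polys_over_def)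
      then have r0: "map_poly \<eta> r = 0" by (simp add: poly_eq_iff cm)
      have "smult (\<eta> a ^ N) (map_poly \<eta> g) = map_poly \<eta> q * map_poly \<eta> f"
        using arg_cong[OF q(5), of "map_poly \<eta>"] q(1,2) f(1) g(1) cl(6)[OF q(1) f(1)] r0
        by (simp add: hm subring_set_power[OF S aS] aS)
      then have "\<eta> a ^ N * poly (map_poly \<eta> g) \<xi> = 0"
        using \<xi> by (metis mult_zero_right poly_mult poly_smult)
      then show ?thesis using \<eta>ac(1) by simp
    qed
    have "poly ([:c:] - u * \<beta>) v \<in> P" using u(2) hc \<beta>(2) by simp
    then have "poly (map_poly \<eta> ([:c:] - u * \<beta>)) \<xi> = 0"
      by (intro rel cl(3) cl(6) polys_over_intros(1)[OF S] cS u(1) \<beta>(1))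
    then have "\<eta> c = poly (map_poly \<eta> u) \<xi> * poly (map_poly \<eta> \<beta>) \<xi>"
      using u(1) \<beta>(1) cS by (simp add: hm cl(6) polys_over_intros(1)[OF S] map_poly_pCons)
    then have \<beta>\<xi>: "poly (map_poly \<eta> \<beta>) \<xi> \<noteq> 0" using \<eta>ac(2) by auto
    obtain \<eta>' where "place_on \<iota> P (adjoin S v) \<eta>'"
      "\<And>f. f \<in> polys_over S \<Longrightarrow> \<eta>' (poly f v) = poly (map_poly \<eta> f) \<xi>"
      by (rule place_extend[where v = v, OF S \<iota> Pi \<eta>(1) rel]) (assumption+, rule that, simp_all)
    then show ?thesis using \<beta> \<beta>\<xi> by (intro exI[of _ \<eta>']) simp
  qed
qed

lemma is_hom_mconst: "is_hom mconst"
  by (simp add: is_hom_def)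

lemma inj_mconst: "mconst a = mconst b \<longleftrightarrow> a = b"
  by (metis lookup_single_eq mconst_def)

lemma mpoly_in_subring:
  fixes f :: "('v, 'k::comm_ring_1) mpoly"
  assumes S: "subring_set S" and "range mconst \<subseteq> S" "range mvar \<subseteq> S"
  shows "f \<in> S"
proof -
  have "msubst mvar f \<in> S" unfolding msubst_def
    by (intro subring_set_sum[OF S] subring_set_closed(6)[OF S] subring_set_prod[OF S] subring_set_power[OF S])
      (use assms in auto)
  then show ?thesis by (simp add: msubst_id)
qed

lemma subring_set_range:
  assumes "is_hom h"
  shows "subring_set (range h)"
proof -
  have "1 = h 1" "h a - h b = h (a - b)" "h a * h b = h (a * b)" for a b
    by (simp_all add: is_hom_simps[OF assms])
  then show ?thesis unfolding subring_set_def by (metis rangeE rangeI)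
qed

text \<open>Hilbert's Nullstellensatz for a prime ideal, in the form that the points of the ideal detect
  every element outside it.  The variables are adjoined to the constants one by one.\<close>

theorem nullstellensatz_prime:
  fixes P :: "('v::finite, 'k::alg_closed_field) mpoly set"
  assumes P: "prime_in UNIV P" and b: "b \<notin> P"
  obtains \<eta> :: "('v, 'k) mpoly \<Rightarrow> 'k" where "is_hom \<eta>" "\<And>c. \<eta> (mconst c) = c"
    "\<And>f. f \<in> P \<Longrightarrow> \<eta> f = 0" "\<eta> b \<noteq> 0"
proof -
  have Pi: "ideal_in UNIV P" and P1: "1 \<notin> P" using P by (auto simp: prime_in_def)
  have sub: "subring_set (range mconst :: ('v, 'k) mpoly set)"
    by (rule subring_set_range[OF is_hom_mconst])
  have "\<exists>S. subring_set S \<and> range mconst \<subseteq> S \<and> mvar ` set vs \<subseteq> S \<and> has_places mconst P S" for vs :: "'v list"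
  proof (induction vs)
    case Nil
    have "place_on mconst P (range mconst) (inv_into UNIV mconst)"
    proof -
      have inv: "inv_into UNIV mconst (mconst c :: ('v, 'k) mpoly) = c" for c :: 'k
        by (rule inv_f_f) (simp add: inj_def inj_mconst)
      have "c = 0" if "mconst c \<in> P" for c
      proof (rule ccontr)
        assume "c \<noteq> 0"
        then have "mconst (inverse c) * mconst c = (1 :: ('v, 'k) mpoly)" by (simp flip: mconst_simps(4))
        then show False using ideal_in_closed(3)[OF Pi _ that, of "mconst (inverse c)"] P1 by simp
      qed
      then show ?thesis
        unfolding place_on_def using inv by (auto simp only: mconst_simps(3,4)[symmetric] simp_thms)
    qed
    moreover have "inv_into UNIV mconst b' \<noteq> 0" if "b' \<in> range mconst - P" for b' :: "('v, 'k) mpoly"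
      using that ideal_in_closed(1)[OF Pi] by (auto simp: inj_def inj_mconst)
    ultimately have "has_places mconst P (range mconst)" unfolding has_places_def by blast
    then show ?case using sub by auto
  next
    case (Cons v vs)
    then obtain S where S: "subring_set S" "range mconst \<subseteq> S" "mvar ` set vs \<subseteq> S" "has_places mconst P S"
      by blast
    have "has_places mconst P (adjoin S (mvar v))"
      by (rule has_places_adjoin[OF S(1) is_hom_mconst S(2) P S(4)])
    then show ?case
      using S adjoin_superset[OF S(1), of "mvar v"] subring_adjoin[OF S(1), of "mvar v"]
        adjoin_generator[OF S(1), of "mvar v"]
      by (intro exI[of _ "adjoin S (mvar v)"]) auto
  qed
  moreover obtain vs :: "'v list" where "set vs = UNIV" using finite_list[OF finite_class.finite_UNIV] by blast
  ultimately obtain S where S: "subring_set S" "range mconst \<subseteq> S" "range mvar \<subseteq> S" "has_places mconst P S"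
    by metis
  then have "S = UNIV" using mpoly_in_subring by blast
  then obtain \<eta> where \<eta>: "place_on mconst P UNIV \<eta>" "\<eta> b \<noteq> 0"
    using S(4) b unfolding has_places_def by blast
  show ?thesis
  proof (rule that[of \<eta>])
    show "is_hom \<eta>"
      using \<eta>(1) unfolding place_on_def is_hom_def by (metis UNIV_I mconst_simps(2))
  qed (use \<eta> in \<open>auto simp: place_on_def\<close>)
qed

section \<open>Closed irreducible subsets of a spectrum\<close>

definition zero_locus :: "('a, 'b) ring_scheme \<Rightarrow> 'a set \<Rightarrow> 'a set set" where
  "zero_locus R A = {P \<in> spectrum R. A \<subseteq> P}"

lemma closedin_Spec: "closedin (Spec R) C \<longleftrightarrow> (\<exists>A \<subseteq> carrier R. C = zero_locus R A)"
proof
  assume "closedin (Spec R) C"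
  then have C: "C \<subseteq> spectrum R" "openin (Spec R) (spectrum R - C)"
    by (simp_all add: closedin_def topspace_Spec)
  then obtain A where A: "A \<subseteq> carrier R" "spectrum R - C = {P \<in> spectrum R. \<not> A \<subseteq> P}"
    unfolding openin_Spec by auto
  then have "C = zero_locus R A" using C(1) unfolding zero_locus_def by blast
  then show "\<exists>A \<subseteq> carrier R. C = zero_locus R A" using A(1) by blast
next
  assume "\<exists>A \<subseteq> carrier R. C = zero_locus R A"
  then obtain A where A: "A \<subseteq> carrier R" "C = zero_locus R A" by blast
  have "spectrum R - C = {P \<in> spectrum R. \<not> A \<subseteq> P}" unfolding A(2) zero_locus_def by blast
  then have "openin (Spec R) (spectrum R - C)" unfolding openin_Spec using A(1) by blast
  then show "closedin (Spec R) C" by (auto simp: closedin_def topspace_Spec A(2) zero_locus_def)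
qed

lemma prime_carrier: "primeideal P R \<Longrightarrow> P \<subseteq> carrier R"
  by (metis additive_subgroup.a_subset ideal_def primeideal.axioms(1))

text \<open>The generic point of the closure of \<open>Y\<close>, a set that need not be closed itself.\<close>

lemma primeideal_Inter_irreducible:
  fixes R (structure)
  assumes "cring R" and Y: "irreducible_in (Spec R) Y"
  shows "primeideal (\<Inter>Y) R"
proof -
  interpret cring R by fact
  have Ysp: "Y \<subseteq> spectrum R" and Y0: "Y \<noteq> {}"
    and irr: "\<And>C D. closedin (subtopology (Spec R) Y) C \<Longrightarrow> closedin (subtopology (Spec R) Y) D \<Longrightarrow>
      Y = C \<union> D \<Longrightarrow> C = Y \<or> D = Y"
    using Y by (auto simp: irreducible_in_def topspace_Spec)
  have pr: "primeideal Q R" if "Q \<in> Y" for Q using that Ysp by (auto simp: spectrum_def)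
  show ?thesis
  proof (rule primeidealI)
    show "ideal (\<Inter>Y) R" using i_Intersect[of Y] pr Y0 primeideal.axioms(1) by blast
    obtain Q where Q: "Q \<in> Y" using Y0 by blast
    then show "carrier R \<noteq> \<Inter>Y"
      using primeideal.I_notcarr[OF pr[OF Q]] prime_carrier[OF pr[OF Q]] by blast
    fix a b assume ab: "a \<in> carrier R" "b \<in> carrier R" "a \<otimes> b \<in> \<Inter>Y"
    have cl: "closedin (subtopology (Spec R) Y) {Q \<in> Y. x \<in> Q}" if "x \<in> carrier R" for x
    proof -
      have "closedin (Spec R) (zero_locus R {x})" unfolding closedin_Spec using that by blast
      moreover have "{Q \<in> Y. x \<in> Q} = zero_locus R {x} \<inter> Y" using Ysp by (auto simp: zero_locus_def)
      ultimately show ?thesis unfolding closedin_subtopology by blast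
    qed
    have "Y = {Q \<in> Y. a \<in> Q} \<union> {Q \<in> Y. b \<in> Q}"
    proof (intro equalityI subsetI)
      fix Q assume "Q \<in> Y"
      then show "Q \<in> {Q \<in> Y. a \<in> Q} \<union> {Q \<in> Y. b \<in> Q}"
        using primeideal.I_prime[OF pr ab(1,2)] ab(3) by auto
    qed auto
    from irr[OF cl[OF ab(1)] cl[OF ab(2)] this] show "a \<in> \<Inter>Y \<or> b \<in> \<Inter>Y" by blast
  qed fact
qed

lemma irreducible_zero_locus:
  assumes q: "primeideal q R"
  shows "irreducible_in (Spec R) (zero_locus R q)"
  unfolding irreducible_in_def
proof (intro conjI allI impI)
  have qV: "q \<in> zero_locus R q" using q by (simp add: zero_locus_def spectrum_def)
  show "zero_locus R q \<subseteq> topspace (Spec R)" by (auto simp: topspace_Spec zero_locus_def)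
  show "zero_locus R q \<noteq> {}" using qV by blast
  have full: "C = zero_locus R q"
    if C: "closedin (subtopology (Spec R) (zero_locus R q)) C" "q \<in> C" for C
  proof -
    obtain A where A: "C = zero_locus R A \<inter> zero_locus R q"
      using C(1) unfolding closedin_subtopology closedin_Spec by blast
    then have "A \<subseteq> q" using C(2) by (auto simp: zero_locus_def)
    then have "zero_locus R q \<subseteq> zero_locus R A" by (auto simp: zero_locus_def)
    then show ?thesis using A by blast
  qed
  fix C D assume "closedin (subtopology (Spec R) (zero_locus R q)) C \<and>
      closedin (subtopology (Spec R) (zero_locus R q)) D \<and> zero_locus R q = C \<union> D"
  then show "C = zero_locus R q \<or> D = zero_locus R q" using full qV by blast
qed

text \<open>An irreducible set around the zero locus has the point \<open>p\<close>, so the generic point of its closure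
  is contained in \<open>p\<close> and equals \<open>p\<close> by minimality.\<close>

lemma irreducible_component_zero_locus:
  assumes "cring R" and p: "primeideal p R" and min: "\<And>q. primeideal q R \<Longrightarrow> q \<subseteq> p \<Longrightarrow> q = p"
  shows "irreducible_component (Spec R) (zero_locus R p)"
  unfolding irreducible_component_def
proof (intro conjI allI impI)
  show "irreducible_in (Spec R) (zero_locus R p)" by (rule irreducible_zero_locus[OF p])
  fix Y assume Y: "irreducible_in (Spec R) Y \<and> zero_locus R p \<subseteq> Y"
  have "p \<in> Y" using Y p by (auto simp: zero_locus_def spectrum_def)
  then have "\<Inter>Y = p" using min[OF primeideal_Inter_irreducible[OF assms(1)]] Y by blast
  then have "Y \<subseteq> zero_locus R p" using Y by (auto simp: zero_locus_def irreducible_in_def topspace_Spec)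
  then show "Y = zero_locus R p" using Y by blast
qed

text \<open>Chains of closed irreducible subsets correspond to chains of primes, in the reverse order.\<close>

lemma krull_dim_zero_locus:
  fixes N :: nat and q :: "nat \<Rightarrow> 'a set"
  assumes R: "cring R" and p: "p \<subseteq> carrier R"
    and q: "\<And>i. i \<le> N \<Longrightarrow> primeideal (q i) R" "\<And>i. i \<le> N \<Longrightarrow> p \<subseteq> q i" "\<And>i. i < N \<Longrightarrow> q i \<subset> q (Suc i)"
    and bound: "\<And>n t. (\<And>i. i \<le> n \<Longrightarrow> primeideal (t i) R) \<Longrightarrow> (\<And>i. i \<le> n \<Longrightarrow> p \<subseteq> t i) \<Longrightarrow>
      (\<And>i. i < n \<Longrightarrow> t i \<subset> t (Suc i)) \<Longrightarrow> n \<le> N"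
  shows "krull_dim (subtopology (Spec R) (zero_locus R p)) = enat N"
proof -
  let ?T = "subtopology (Spec R) (zero_locus R p)"
  have clV: "closedin (Spec R) (zero_locus R p)" unfolding closedin_Spec using p by blast
  have sub: "closedin ?T Z \<and> irreducible_in ?T Z \<longleftrightarrow>
      closedin (Spec R) Z \<and> irreducible_in (Spec R) Z \<and> Z \<subseteq> zero_locus R p" for Z
  proof -
    have "irreducible_in ?T Z \<longleftrightarrow> irreducible_in (Spec R) Z" if Z: "Z \<subseteq> zero_locus R p"
    proof -
      have "subtopology ?T Z = subtopology (Spec R) Z"
        using Z by (simp add: subtopology_subtopology Int_absorb1)
      moreover have "topspace ?T = zero_locus R p" by (auto simp: topspace_Spec zero_locus_def)
      moreover have "Z \<subseteq> topspace (Spec R)" using Z by (auto simp: topspace_Spec zero_locus_def)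
      ultimately show ?thesis using Z by (simp add: irreducible_in_def)
    qed
    then show ?thesis unfolding closedin_closed_subtopology[OF clV] by blast
  qed
  let ?C = "{enat n | n. \<exists>Z :: nat \<Rightarrow> 'a set set.
     (\<forall>i\<le>n. closedin ?T (Z i) \<and> irreducible_in ?T (Z i)) \<and> (\<forall>i<n. Z i \<subset> Z (Suc i))}"
  have upper: "x \<le> enat N" if xC: "x \<in> ?C" for x
  proof -
    obtain n Z where x: "x = enat n" and Z: "\<And>i. i \<le> n \<Longrightarrow> closedin ?T (Z i) \<and> irreducible_in ?T (Z i)"
      "\<And>i. i < n \<Longrightarrow> Z i \<subset> Z (Suc i)"
      using xC by blast
    have Zc: "closedin (Spec R) (Z i)" "irreducible_in (Spec R) (Z i)" "Z i \<subseteq> zero_locus R p" if "i \<le> n" for i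
      using Z(1)[OF that] unfolding sub by auto
    have Zeq: "Z i = zero_locus R (\<Inter>(Z i))" if i: "i \<le> n" for i
    proof -
      obtain A where A: "Z i = zero_locus R A" using Zc(1)[OF i] unfolding closedin_Spec by blast
      have "Z i \<subseteq> spectrum R" unfolding A by (auto simp: zero_locus_def)
      moreover have "A \<subseteq> \<Inter>(Z i)" unfolding A by (auto simp: zero_locus_def)
      ultimately show ?thesis unfolding zero_locus_def using A[unfolded zero_locus_def] by blast
    qed
    have "n \<le> N"
    proof (rule bound[of n "\<lambda>i. \<Inter>(Z (n - i))"])
      show "primeideal (\<Inter>(Z (n - i))) R" for i
        using primeideal_Inter_irreducible[OF R Zc(2)] by simp
      show "p \<subseteq> \<Inter>(Z (n - i))" for i
        using Zc(3)[of "n - i"] by (auto simp: zero_locus_def)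
      show "\<Inter>(Z (n - i)) \<subset> \<Inter>(Z (n - Suc i))" if i: "i < n" for i
      proof -
        have s: "Z (n - Suc i) \<subset> Z (n - i)" using Z(2)[of "n - Suc i"] i by (simp add: Suc_diff_Suc)
        then have "\<Inter>(Z (n - i)) \<noteq> \<Inter>(Z (n - Suc i))"
          using Zeq[of "n - i"] Zeq[of "n - Suc i"] by auto
        then show ?thesis using s by blast
      qed
    qed
    then show ?thesis by (simp add: x)
  qed
  have "enat N \<in> ?C"
  proof -
    have ne: "zero_locus R (q i) \<subset> zero_locus R (q j)" if "i \<le> N" "j \<le> N" "q j \<subset> q i" for i j
    proof -
      have "q j \<in> zero_locus R (q j)" using q(1) that by (simp add: zero_locus_def spectrum_def)
      moreover have "q j \<notin> zero_locus R (q i)" using that by (auto simp: zero_locus_def)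
      ultimately show ?thesis using that(3) by (auto simp: zero_locus_def)
    qed
    have 1: "closedin ?T (zero_locus R (q (N - i))) \<and> irreducible_in ?T (zero_locus R (q (N - i)))" for i
      unfolding sub
    proof (intro conjI)
      have pr: "primeideal (q (N - i)) R" "p \<subseteq> q (N - i)" using q(1,2) by simp_all
      show "closedin (Spec R) (zero_locus R (q (N - i)))"
        unfolding closedin_Spec using prime_carrier[OF pr(1)] by blast
      show "irreducible_in (Spec R) (zero_locus R (q (N - i)))" by (rule irreducible_zero_locus[OF pr(1)])
      show "zero_locus R (q (N - i)) \<subseteq> zero_locus R p" using pr(2) by (auto simp: zero_locus_def)
    qed
    have 2: "zero_locus R (q (N - i)) \<subset> zero_locus R (q (N - Suc i))" if "i < N" for i
      using q(3)[of "N - Suc i"] that by (intro ne) (simp_all add: Suc_diff_Suc)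
    show ?thesis using 1 2 by (intro CollectI exI[of _ N] conjI refl exI[of _ "\<lambda>i. zero_locus R (q (N - i))"]) auto
  qed
  then show ?thesis unfolding krull_dim_def using upper by (intro antisym Sup_least Sup_upper) auto
qed

section \<open>Homomorphisms whose target is integral over the image\<close>

text \<open>The source is a ring with a carrier, as for rings of invariants; the target is a whole type,
  in which subrings, ideals and primes are plain sets.\<close>

locale hom_to_type = cring R for R :: "('r, 's) ring_scheme" (structure) +
  fixes h :: "'r \<Rightarrow> 'b::comm_ring_1"
  assumes h_add: "a \<in> carrier R \<Longrightarrow> b \<in> carrier R \<Longrightarrow> h (a \<oplus> b) = h a + h b"
    and h_mult: "a \<in> carrier R \<Longrightarrow> b \<in> carrier R \<Longrightarrow> h (a \<otimes> b) = h a * h b"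
    and h_one: "h \<one> = 1"
begin

definition comap :: "'b set \<Rightarrow> 'r set" where
  "comap T = {x \<in> carrier R. h x \<in> T}"

lemma h_zero: "h \<zero> = 0"
  using h_add[of \<zero> \<zero>] by simp

lemma h_minus: "a \<in> carrier R \<Longrightarrow> b \<in> carrier R \<Longrightarrow> h (a \<ominus> b) = h a - h b"
  using h_add[of "a \<ominus> b" b] by (simp add: a_minus_def a_assoc l_neg)

lemma subring_image: "subring_set (h ` carrier R)"
  unfolding subring_set_def
proof (intro conjI ballI)
  show "1 \<in> h ` carrier R" using h_one by (metis image_eqI one_closed)
  fix a b assume "a \<in> h ` carrier R" "b \<in> h ` carrier R"
  then obtain x y where xy: "x \<in> carrier R" "y \<in> carrier R" "a = h x" "b = h y" by blast
  show "a - b \<in> h ` carrier R" using h_minus[OF xy(1,2)] xy by (metis image_eqI minus_closed)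
  show "a * b \<in> h ` carrier R" using h_mult[OF xy(1,2)] xy by (metis image_eqI m_closed)
qed

lemma primeideal_comap:
  assumes T: "prime_in (h ` carrier R) T"
  shows "primeideal (comap T) R"
proof (rule primeidealI)
  have Ti: "ideal_in (h ` carrier R) T" using T by (rule prime_inD)
  show "ideal (comap T) R"
  proof (rule idealI)
    show "subgroup (comap T) (add_monoid R)"
    proof (rule subgroup.intro)
      show "comap T \<subseteq> carrier (add_monoid R)" by (auto simp: comap_def)
      show "\<one>\<^bsub>add_monoid R\<^esub> \<in> comap T" using ideal_in_closed(1)[OF Ti] h_zero by (simp add: comap_def)
      show "inv\<^bsub>add_monoid R\<^esub> a \<in> comap T" if mem: "a \<in> comap T" for a
      proof -
        have a: "a \<in> carrier R" "h a \<in> T" using mem by (auto simp: comap_def)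
        have "h (\<ominus> a) = - h a" using h_minus[of \<zero> a] a(1) h_zero by (simp add: a_minus_def)
        then have "\<ominus> a \<in> comap T"
          using a ideal_in_minus(1)[OF subring_image Ti a(2)] by (simp add: comap_def)
        then show ?thesis by (simp add: a_inv_def)
      qed
      show "a \<otimes>\<^bsub>add_monoid R\<^esub> b \<in> comap T" if "a \<in> comap T" "b \<in> comap T" for a b
        using that ideal_in_closed(2)[OF Ti] by (auto simp: comap_def h_add)
    qed
  qed (use ideal_in_closed(3,4)[OF Ti] in \<open>auto simp: comap_def h_mult ring_axioms\<close>)
  show "carrier R \<noteq> comap T" using prime_inD(2)[OF T] h_one one_closed unfolding comap_def by force
  show "a \<in> comap T \<or> b \<in> comap T" if "a \<in> carrier R" "b \<in> carrier R" "a \<otimes> b \<in> comap T" for a b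
    using that prime_inD(3)[OF T, of "h a" "h b"] by (auto simp: comap_def h_mult)
qed (rule is_cring)

lemma mem_prime_over_kernel:
  assumes q: "primeideal q R" "comap {0} \<subseteq> q" and x: "x \<in> carrier R" "y \<in> q" "h x = h y"
  shows "x \<in> q"
proof -
  interpret q: primeideal q R by fact
  have y: "y \<in> carrier R" using x(2) q.a_subset by blast
  have "x \<ominus> y \<in> comap {0}" using x y by (simp add: comap_def h_minus)
  then have "(x \<ominus> y) \<oplus> y \<in> q" using q(2) x(2) q.a_closed by blast
  then show ?thesis using x y by (simp add: a_minus_def a_assoc l_neg)
qed

lemma prime_in_image:
  assumes q: "primeideal q R" "comap {0} \<subseteq> q"
  shows "prime_in (h ` carrier R) (h ` q)" "comap (h ` q) = q"
proof -
  interpret q: primeideal q R by fact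
  have qR: "q \<subseteq> carrier R" by (rule q.a_subset)
  show eq: "comap (h ` q) = q"
    using mem_prime_over_kernel[OF q] qR by (auto simp: comap_def)
  have mem: "x \<in> q" if "x \<in> carrier R" "h x \<in> h ` q" for x
    using eq that by (auto simp: comap_def)
  show "prime_in (h ` carrier R) (h ` q)"
    unfolding prime_in_def ideal_in_def
  proof (intro conjI ballI impI)
    show "h ` q \<subseteq> h ` carrier R" using qR by blast
    show "0 \<in> h ` q" using h_zero q.zero_closed by (metis image_eqI)
    show "a + b \<in> h ` q" if "a \<in> h ` q" "b \<in> h ` q" for a b
      using that qR h_add q.a_closed by (smt (verit, best) imageE image_eqI subsetD)
    show "a * b \<in> h ` q" if "a \<in> h ` carrier R" "b \<in> h ` q" for a b
      using that qR h_mult q.I_l_closed by (smt (verit, best) imageE image_eqI subsetD)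
    show "1 \<notin> h ` q"
      using mem[of \<one>] h_one q.I_notcarr q.one_imp_carrier by auto
    fix a b assume "a \<in> h ` carrier R" "b \<in> h ` carrier R" and ab: "a * b \<in> h ` q"
    then obtain x y where xy: "x \<in> carrier R" "y \<in> carrier R" "a = h x" "b = h y" by blast
    then have "x \<otimes> y \<in> q" using mem[of "x \<otimes> y"] ab by (simp add: h_mult)
    then show "a \<in> h ` q \<or> b \<in> h ` q" using q.I_prime xy by blast
  qed
qed

lemma prime_in_zero: "prime_in UNIV ({0} :: 'b set) \<Longrightarrow> prime_in (h ` carrier R) {0}"
  using prime_in_contract[OF subring_image, of "{0}"] subring_set_closed(2)[OF subring_image]
  by (simp add: Int_absorb2)

text \<open>The dimension of the closure of the image is the dimension of the target: chains of primes go up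
  along the integral extension, and contract to strict chains by incomparability.\<close>

lemma krull_dim_kernel:
  fixes Q :: "nat \<Rightarrow> 'b set"
  assumes int: "\<And>b. integral_over (h ` carrier R) b"
    and Q: "\<And>i. i \<le> N \<Longrightarrow> prime_in UNIV (Q i)" "\<And>i. i < N \<Longrightarrow> Q i \<subset> Q (Suc i)"
    and bound: "\<And>n (Q :: nat \<Rightarrow> 'b set). (\<And>i. i \<le> n \<Longrightarrow> prime_in UNIV (Q i)) \<Longrightarrow>
      (\<And>i. i < n \<Longrightarrow> Q i \<subset> Q (Suc i)) \<Longrightarrow> n \<le> N"
  shows "krull_dim (subtopology (Spec R) (zero_locus R (comap {0}))) = enat N"
proof (rule krull_dim_zero_locus[OF is_cring, of _ _ "\<lambda>i. comap (Q i \<inter> h ` carrier R)"])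
  let ?S = "h ` carrier R"
  show "comap {0} \<subseteq> carrier R" by (auto simp: comap_def)
  show "primeideal (comap (Q i \<inter> ?S)) R" if "i \<le> N" for i
    by (rule primeideal_comap[OF prime_in_contract[OF subring_image Q(1)[OF that]]])
  show "comap {0} \<subseteq> comap (Q i \<inter> ?S)" if "i \<le> N" for i
    using ideal_in_closed(1)[OF prime_inD(1)[OF Q(1)[OF that]]] by (auto simp: comap_def)
  show "comap (Q i \<inter> ?S) \<subset> comap (Q (Suc i) \<inter> ?S)" if "i < N" for i
  proof -
    have "Q i \<inter> ?S \<subset> Q (Suc i) \<inter> ?S"
      by (rule integral_incomparable[OF subring_image int Q(1) Q(1) Q(2)]) (use that in auto)
    then show ?thesis by (auto simp: comap_def)
  qed
  fix n and t :: "nat \<Rightarrow> 'r set"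
  assume t: "\<And>i. i \<le> n \<Longrightarrow> primeideal (t i) R" "\<And>i. i \<le> n \<Longrightarrow> comap {0} \<subseteq> t i"
    "\<And>i. i < n \<Longrightarrow> t i \<subset> t (Suc i)"
  obtain Q' :: "nat \<Rightarrow> 'b set" where
    "\<And>i. i \<le> n \<Longrightarrow> prime_in UNIV (Q' i)" "\<And>i. i < n \<Longrightarrow> Q' i \<subset> Q' (Suc i)"
  proof (rule going_up_chain[OF subring_image int, of n "\<lambda>i. h ` t i"])
    show "prime_in ?S (h ` t i)" if "i \<le> n" for i using prime_in_image(1)[OF t(1,2)] that by blast
    show "h ` t i \<subset> h ` t (Suc i)" if i: "i < n" for i
    proof -
      have "comap (h ` t i) \<noteq> comap (h ` t (Suc i))"
        using prime_in_image(2)[OF t(1,2)] t(3)[OF i] i by (metis Suc_leI less_imp_le psubset_eq)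
      then show ?thesis using t(3)[OF i] by auto
    qed
  qed blast
  then show "n \<le> N" by (rule bound)
qed

end

section \<open>The dimension of a polynomial ring\<close>

text \<open>Naming the variables by natural numbers orders the monomials linearly, so that leading terms
  multiply.\<close>

lemma mpoly_mult_eq_0:
  fixes f g :: "('v::finite, 'k::field) mpoly"
  assumes "f * g = 0"
  shows "f = 0 \<or> g = 0"
proof -
  obtain i :: "'v \<Rightarrow> nat" where i: "inj i"
    using finite_imp_inj_to_nat_seg[of "UNIV :: 'v set"] by blast
  let ?J = "msubst (\<lambda>v. mvar (i v)) :: ('v, 'k) mpoly \<Rightarrow> (nat, 'k) mpoly"
  have J: "f = 0" if "?J f = 0" for f
  proof -
    have "msubst (\<lambda>n. mvar (inv_into UNIV i n)) (?J f) = msubst mvar f"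
      unfolding msubst_msubst by (simp add: inv_f_f[OF i])
    then show ?thesis using that by (simp add: msubst_id)
  qed
  have "?J f * ?J g = 0" using assms by (metis msubst_0 msubst_mult)
  then show ?thesis using J mult_eq_0_iff by blast
qed

lemma prime_in_msubst_kernel:
  fixes \<sigma> :: "'w \<Rightarrow> ('v::finite, 'k::field) mpoly"
  shows "prime_in UNIV {f. msubst \<sigma> f = 0}"
  using mpoly_mult_eq_0 by (auto simp: prime_in_def ideal_in_def)

lemma prime_in_zero_mpoly: "prime_in UNIV ({0} :: ('v::finite, 'k::field) mpoly set)"
  using prime_in_msubst_kernel[of "mvar :: 'v \<Rightarrow> ('v, 'k) mpoly"] by (simp add: msubst_id)

lemma mvar_neq_0: "(mvar v :: ('v, 'k::field) mpoly) \<noteq> 0"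
proof
  assume "(mvar v :: ('v, 'k) mpoly) = 0"
  then have "Poly_Mapping.lookup (mvar v :: ('v, 'k) mpoly) (Poly_Mapping.single v 1) = 0" by simp
  then show False by (simp add: mvar_def)
qed

text \<open>The kernels of the maps that set the first \<open>i\<close> variables to \<open>0\<close>.\<close>

lemma mpoly_prime_chain:
  obtains Q :: "nat \<Rightarrow> ('v::finite, 'k::field) mpoly set"
  where "\<And>i. i \<le> CARD('v) \<Longrightarrow> prime_in UNIV (Q i)" "\<And>i. i < CARD('v) \<Longrightarrow> Q i \<subset> Q (Suc i)"
proof -
  obtain idx :: "'v \<Rightarrow> nat" where idx: "bij_betw idx UNIV {0..<CARD('v)}"
    using ex_bij_betw_finite_nat[OF finite_class.finite_UNIV] by blast
  let ?\<sigma> = "\<lambda>i v. if idx v < i then 0 else mvar v :: ('v, 'k) mpoly"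
  let ?Q = "\<lambda>i. {f. msubst (?\<sigma> i) f = 0}"
  show ?thesis
  proof (rule that)
    show "prime_in UNIV (?Q i)" for i by (rule prime_in_msubst_kernel)
    fix i assume i: "i < CARD('v)"
    have eq: "msubst (?\<sigma> (Suc i)) f = msubst (?\<sigma> (Suc i)) (msubst (?\<sigma> i) f)" for f
      unfolding msubst_msubst by (rule arg_cong[of _ _ "\<lambda>\<sigma>. msubst \<sigma> f"]) auto
    have "?Q i \<subseteq> ?Q (Suc i)"
    proof
      fix f assume "f \<in> ?Q i"
      then show "f \<in> ?Q (Suc i)" using eq[of f] by simp
    qed
    moreover obtain v where "idx v = i"
      using idx i unfolding bij_betw_def by (metis atLeastLessThan_iff imageE zero_le)
    then have "mvar v \<in> ?Q (Suc i)" "mvar v \<notin> ?Q i" by (simp_all add: mvar_neq_0)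
    ultimately show "?Q i \<subset> ?Q (Suc i)" by blast
  qed
qed

lemma vector_space_mpoly: "vector_space (\<lambda>a f. mconst a * f :: ('v, 'k::field) mpoly)"
  by unfold_locales (simp_all add: algebra_simps)

lemma family_dependent:
  fixes f :: "'i \<Rightarrow> ('v, 'k::field) mpoly"
  assumes "finite I" "finite B" "card B < card I"
    and span: "\<And>i. i \<in> I \<Longrightarrow> f i \<in> module.span (\<lambda>a f. mconst a * f) B"
  shows "\<exists>c. (\<exists>i\<in>I. c i \<noteq> 0) \<and> (\<Sum>i\<in>I. mconst (c i) * f i) = 0"
proof (cases "inj_on f I")
  case False
  then obtain i j where ij: "i \<in> I" "j \<in> I" "i \<noteq> j" "f i = f j" by (auto simp: inj_on_def)
  let ?c = "\<lambda>l. if l = i then 1 else if l = j then - 1 else 0 :: 'k"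
  have "(\<Sum>l\<in>I. mconst (?c l) * f l) = (\<Sum>l\<in>{i, j}. mconst (?c l) * f l)"
    using ij assms(1) by (intro sum.mono_neutral_right) auto
  also have "\<dots> = mconst (1 + (- 1)) * f j"
    using ij unfolding mconst_simps(3) distrib_right by simp
  also have "\<dots> = 0" by simp
  finally show ?thesis using ij(1) by (intro exI[of _ ?c]) auto
next
  case True
  interpret V: vector_space "\<lambda>a f. mconst a * f :: ('v, 'k) mpoly" by (rule vector_space_mpoly)
  have "card (f ` I) > card B" using assms(3) True by (simp add: card_image)
  then have "V.dependent (f ` I)"
    using V.independent_span_bound[of B "f ` I"] assms(2) span by (auto simp: not_le[symmetric])
  then obtain u where u: "\<exists>v\<in>f ` I. u v \<noteq> 0" "(\<Sum>v\<in>f ` I. mconst (u v) * v) = 0"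
    using V.dependent_finite[of "f ` I"] assms(1) by auto
  then show ?thesis
    by (intro exI[of _ "\<lambda>i. u (f i)"]) (auto simp: sum.reindex[OF True] o_def)
qed

definition exponents_le :: "nat \<Rightarrow> ('v \<Rightarrow>\<^sub>0 nat) set" where
  "exponents_le n = {m. \<forall>v. Poly_Mapping.lookup m v \<le> n}"

lemma exponents_le:
  shows "finite (exponents_le n :: ('v::finite \<Rightarrow>\<^sub>0 nat) set)"
    "card (exponents_le n :: ('v \<Rightarrow>\<^sub>0 nat) set) \<le> Suc n ^ CARD('v)"
proof -
  let ?F = "PiE UNIV (\<lambda>_. {..n}) :: ('v \<Rightarrow> nat) set"
  have fin: "finite ?F" by (intro finite_PiE) auto
  have inj: "inj_on Poly_Mapping.lookup (exponents_le n :: ('v \<Rightarrow>\<^sub>0 nat) set)"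
    by (auto intro: inj_onI simp: poly_mapping_eqI)
  have sub: "Poly_Mapping.lookup ` (exponents_le n :: ('v \<Rightarrow>\<^sub>0 nat) set) \<subseteq> ?F"
    by (auto simp: exponents_le_def)
  show "finite (exponents_le n :: ('v \<Rightarrow>\<^sub>0 nat) set)" using inj_on_finite[OF inj sub fin] .
  have "card ?F = Suc n ^ CARD('v)" by (simp add: card_PiE)
  then show "card (exponents_le n :: ('v \<Rightarrow>\<^sub>0 nat) set) \<le> Suc n ^ CARD('v)"
    using card_inj_on_le[OF inj sub fin] by simp
qed

lemma keys_mult_exponents:
  fixes f g :: "('v, 'k::comm_ring_1) mpoly"
  assumes "Poly_Mapping.keys f \<subseteq> exponents_le a" "Poly_Mapping.keys g \<subseteq> exponents_le b"
  shows "Poly_Mapping.keys (f * g) \<subseteq> exponents_le (a + b)"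
  using keys_mult[of f g] assms by (force simp: exponents_le_def lookup_add intro: add_mono)

lemma keys_power_exponents:
  fixes f :: "('v, 'k::comm_ring_1) mpoly"
  assumes "Poly_Mapping.keys f \<subseteq> exponents_le a"
  shows "Poly_Mapping.keys (f ^ n) \<subseteq> exponents_le (n * a)"
proof (induction n)
  case 0
  then show ?case by (auto simp: exponents_le_def)
next
  case (Suc n)
  then show ?case using keys_mult_exponents[OF assms Suc] by (simp add: add.commute)
qed

lemma keys_prod_exponents:
  fixes f :: "'i \<Rightarrow> ('v, 'k::comm_ring_1) mpoly"
  assumes "\<And>i. i \<in> I \<Longrightarrow> Poly_Mapping.keys (f i) \<subseteq> exponents_le a"
  shows "Poly_Mapping.keys (prod f I) \<subseteq> exponents_le (card I * a)"
  using assms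
proof (induction I rule: infinite_finite_induct)
  case (insert i I)
  then have "Poly_Mapping.keys (f i * prod f I) \<subseteq> exponents_le (a + card I * a)"
    by (intro keys_mult_exponents) auto
  then show ?case using insert by simp
qed (auto simp: exponents_le_def)

lemma span_exponents:
  fixes f :: "('v::finite, 'k::field) mpoly"
  assumes "Poly_Mapping.keys f \<subseteq> A" "finite A"
  shows "f \<in> module.span (\<lambda>a f. mconst a * f) ((\<lambda>m. Poly_Mapping.single m 1) ` A)"
proof -
  interpret V: vector_space "\<lambda>a f. mconst a * f :: ('v, 'k) mpoly" by (rule vector_space_mpoly)
  have "f = (\<Sum>m\<in>Poly_Mapping.keys f. Poly_Mapping.single m (Poly_Mapping.lookup f m))"
    by (rule poly_mapping_eqI)
      (simp add: lookup_sum lookup_single when_def in_keys_iff sum.delta' finite_keys)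
  also have "\<dots> = (\<Sum>m\<in>Poly_Mapping.keys f. mconst (Poly_Mapping.lookup f m) * Poly_Mapping.single m 1)"
    by (simp add: mconst_def mult_single)
  also have "\<dots> \<in> V.span ((\<lambda>m. Poly_Mapping.single m 1) ` A)"
    using assms by (intro V.span_sum V.span_scale V.span_base) auto
  finally show ?thesis .
qed

text \<open>More elements than variables are algebraically dependent: among the monomials of bounded degree
  in the \<open>x j\<close> there are more than the dimension of the space of polynomials that contains them.\<close>

lemma algebraically_dependent:
  fixes x :: "nat \<Rightarrow> ('v::finite, 'k::field) mpoly"
  defines "N \<equiv> CARD('v)"
  obtains E :: "(nat \<Rightarrow> nat) set" and c where "finite E" "E \<noteq> {}" "\<forall>e\<in>E. c e \<noteq> 0"
    "E \<subseteq> extensional {..N}"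
    "(\<Sum>e\<in>E. mconst (c e) * (\<Prod>j\<in>{..N}. x j ^ e j)) = 0"
proof -
  have "\<exists>d. \<forall>j\<le>N. Poly_Mapping.keys (x j) \<subseteq> exponents_le d"
  proof -
    let ?K = "\<Union>j\<le>N. \<Union>m\<in>Poly_Mapping.keys (x j). range (Poly_Mapping.lookup m)"
    have fin: "finite ?K" by auto
    have "Poly_Mapping.lookup m v \<le> Max ?K" if "j \<le> N" "m \<in> Poly_Mapping.keys (x j)" for j m v
      using that by (intro Max_ge[OF fin]) auto
    then show ?thesis by (intro exI[of _ "Max ?K"]) (auto simp: exponents_le_def)
  qed
  then obtain d where d: "\<And>j. j \<le> N \<Longrightarrow> Poly_Mapping.keys (x j) \<subseteq> exponents_le d" by blast
  \<comment> \<open>There are \<open>D\<^sup>N\<^sup>+\<^sup>1\<close> monomials in the \<open>x j\<close> with exponents below \<open>D\<close>, in a space of dimension at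
    most \<open>(k D)\<^sup>N\<close>; so \<open>D > k\<^sup>N\<close> is large enough.\<close>
  define k where "k = Suc (Suc N * d)"
  define D where "D = Suc (k ^ N)"
  let ?F = "PiE {..N} (\<lambda>_. {..<D}) :: (nat \<Rightarrow> nat) set"
  let ?B = "exponents_le (Suc N * (D * d)) :: ('v \<Rightarrow>\<^sub>0 nat) set"
  let ?m = "\<lambda>e. \<Prod>j\<in>{..N}. x j ^ e j"
  have cF: "card ?F = D ^ Suc N" by (simp add: card_PiE)
  have "card ((\<lambda>m. Poly_Mapping.single m (1::'k)) ` ?B) \<le> card ?B"
    by (rule card_image_le[OF exponents_le(1)])
  also have "\<dots> \<le> Suc (Suc N * (D * d)) ^ N" using exponents_le(2)[where 'v = 'v] by (simp add: N_def)
  also have "\<dots> \<le> (k * D) ^ N"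
  proof (rule power_mono)
    have "1 \<le> D" by (simp add: D_def)
    then have "Suc (Suc N * d * D) \<le> k * D" by (simp add: k_def)
    then show "Suc (Suc N * (D * d)) \<le> k * D" by (simp only: ac_simps)
  qed simp
  also have "\<dots> = k ^ N * D ^ N" by (simp add: power_mult_distrib)
  also have "\<dots> < D * D ^ N" by (rule mult_strict_right_mono) (simp_all add: D_def)
  finally have card: "card ((\<lambda>m. Poly_Mapping.single m (1::'k)) ` ?B) < card ?F" by (simp add: cF)
  have "\<exists>c. (\<exists>e\<in>?F. c e \<noteq> 0) \<and> (\<Sum>e\<in>?F. mconst (c e) * ?m e) = 0"
  proof (rule family_dependent[OF _ _ card])
    show "finite ?F" by (intro finite_PiE) auto
    show "finite ((\<lambda>m. Poly_Mapping.single m (1::'k)) ` ?B)" using exponents_le(1) by blast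
    fix e assume e: "e \<in> ?F"
    have "Poly_Mapping.keys (x j ^ e j) \<subseteq> exponents_le (D * d)" if "j \<in> {..N}" for j
    proof -
      have "e j < D" using e that by (auto simp: PiE_def Pi_def)
      then have "exponents_le (e j * d) \<subseteq> (exponents_le (D * d) :: ('v \<Rightarrow>\<^sub>0 nat) set)"
        using mult_right_mono[of "e j" D d] by (auto simp: exponents_le_def intro: order_trans)
      then show ?thesis using keys_power_exponents[OF d, of j "e j"] that by auto
    qed
    then have "Poly_Mapping.keys (?m e) \<subseteq> exponents_le (card {..N} * (D * d))"
      by (rule keys_prod_exponents)
    then show "?m e \<in> module.span (\<lambda>a f. mconst a * f) ((\<lambda>m. Poly_Mapping.single m 1) ` ?B)"
      by (intro span_exponents exponents_le(1)) simp
  qed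
  then obtain c where c: "\<exists>e\<in>?F. c e \<noteq> 0" "(\<Sum>e\<in>?F. mconst (c e) * ?m e) = 0" by blast
  have finF: "finite ?F" by (intro finite_PiE) auto
  let ?E = "{e \<in> ?F. c e \<noteq> 0}"
  have "(\<Sum>e\<in>?E. mconst (c e) * ?m e) = (\<Sum>e\<in>?F. mconst (c e) * ?m e)"
    by (rule sum.mono_neutral_left[OF finF]) auto
  then show ?thesis using c finite_subset[OF _ finF, of ?E] by (intro that[of ?E c]) (auto simp: PiE_def)
qed

text \<open>Elements chosen from the successive steps of a chain of primes are algebraically independent: in
  a relation among them one divides by the smallest power of the first element and then reduces
  modulo it, which removes one element and climbs one step.\<close>

lemma mpoly_chain_bound:
  fixes Q :: "nat \<Rightarrow> ('v::finite, 'k::field) mpoly set"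
  assumes Q: "\<And>i. i \<le> n \<Longrightarrow> prime_in UNIV (Q i)" "\<And>i. i < n \<Longrightarrow> Q i \<subset> Q (Suc i)"
  shows "n \<le> CARD('v)"
proof (rule ccontr)
  define N where "N = CARD('v)"
  assume "\<not> ?thesis"
  then have n: "Suc N \<le> n" by (simp add: N_def)
  have "\<exists>x. x \<in> Q (Suc i) \<and> x \<notin> Q i" if "i \<le> N" for i using Q(2)[of i] that n by auto
  then obtain x where x: "\<And>i. i \<le> N \<Longrightarrow> x i \<in> Q (Suc i)" "\<And>i. i \<le> N \<Longrightarrow> x i \<notin> Q i" by metis
  obtain E0 :: "(nat \<Rightarrow> nat) set" and c where E0: "finite E0" "E0 \<noteq> {}" "\<forall>e\<in>E0. c e \<noteq> 0"
    "E0 \<subseteq> extensional {..N}"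
    "(\<Sum>e\<in>E0. mconst (c e) * (\<Prod>j\<in>{..N}. x j ^ e j)) = 0"
    unfolding N_def by (rule algebraically_dependent[where x = x])
  let ?m = "\<lambda>i e. \<Prod>j\<in>{i..N}. x j ^ e j"
  \<comment> \<open>After \<open>i\<close> steps the remaining monomials agree in the first \<open>i\<close> exponents, which have been removed;
    in the end a nonzero constant lies in a prime.\<close>
  have "\<exists>E\<subseteq>E0. E \<noteq> {} \<and> (\<forall>e\<in>E. \<forall>e'\<in>E. \<forall>j<i. e j = e' j) \<and> (\<Sum>e\<in>E. mconst (c e) * ?m i e) \<in> Q i"
    if "i \<le> Suc N" for i
    using that
  proof (induction i)
    case 0
    have "{0..N} = {..N}" by auto
    then show ?case using E0(2,5) ideal_in_closed(1)[OF prime_inD(1)[OF Q(1)[of 0]]]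
      by (intro exI[of _ E0]) simp
  next
    case (Suc i)
    obtain E where E: "E \<subseteq> E0" "E \<noteq> {}" "\<forall>e\<in>E. \<forall>e'\<in>E. \<forall>j<i. e j = e' j"
      "(\<Sum>e\<in>E. mconst (c e) * ?m i e) \<in> Q i"
      using Suc.IH[OF Suc_leD[OF Suc.prems]] by (elim exE conjE)
    have iN: "i \<le> N" using Suc.prems by simp
    have finE: "finite E" using E(1) E0(1) finite_subset by blast
    define \<mu> where "\<mu> = Min ((\<lambda>e. e i) ` E)"
    have \<mu>: "\<mu> \<in> (\<lambda>e. e i) ` E" "\<And>e. e \<in> E \<Longrightarrow> \<mu> \<le> e i"
      unfolding \<mu>_def using finE E(2) by (auto intro: Min_in)
    have Qi: "prime_in UNIV (Q i)" and QS: "prime_in UNIV (Q (Suc i))" using Q(1) iN n by simp_all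
    have QSi: "ideal_in UNIV (Q (Suc i))" by (rule prime_inD[OF QS])
    have split: "?m i e = x i ^ e i * ?m (Suc i) e" for e
      using iN by (simp add: prod.atLeast_Suc_atMost)
    let ?t = "\<lambda>e. mconst (c e) * (x i ^ (e i - \<mu>) * ?m (Suc i) e)"
    have "(\<Sum>e\<in>E. mconst (c e) * ?m i e) = x i ^ \<mu> * (\<Sum>e\<in>E. ?t e)"
      unfolding sum_distrib_left
    proof (rule sum.cong[OF refl])
      fix e assume "e \<in> E"
      then have "x i ^ e i = x i ^ \<mu> * x i ^ (e i - \<mu>)" using \<mu>(2) by (simp flip: power_add)
      then show "mconst (c e) * ?m i e = x i ^ \<mu> * ?t e" unfolding split by (simp add: ac_simps)
    qed
    then have "x i ^ \<mu> * (\<Sum>e\<in>E. ?t e) \<in> Q i" using E(4) by simp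
    moreover have "x i ^ \<mu> \<notin> Q i"
      using prime_in_power[OF subring_set_UNIV Qi, of "x i" \<mu>] x(2)[OF iN] by auto
    ultimately have "(\<Sum>e\<in>E. ?t e) \<in> Q i" using prime_inD(3)[OF Qi UNIV_I UNIV_I] by auto
    then have 1: "(\<Sum>e\<in>E. ?t e) \<in> Q (Suc i)" using Q(2)[of i] iN n by auto
    let ?E' = "{e \<in> E. e i = \<mu>}"
    have 2: "(\<Sum>e\<in>E - ?E'. ?t e) \<in> Q (Suc i)"
    proof (rule ideal_in_sum[OF QSi])
      fix e assume "e \<in> E - ?E'"
      then have "e i - \<mu> = Suc (e i - Suc \<mu>)" using \<mu>(2)[of e] by auto
      then have "?t e = (mconst (c e) * x i ^ (e i - Suc \<mu>) * ?m (Suc i) e) * x i"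
        by (simp add: ac_simps)
      then show "?t e \<in> Q (Suc i)" using ideal_in_closed(3)[OF QSi _ x(1)[OF iN]] by simp
    qed
    have "(\<Sum>e\<in>E. ?t e) = (\<Sum>e\<in>E - ?E'. ?t e) + (\<Sum>e\<in>?E'. ?t e)"
      using finE by (intro sum.subset_diff) auto
    then have "(\<Sum>e\<in>?E'. ?t e) \<in> Q (Suc i)"
      using ideal_in_minus(2)[OF subring_set_UNIV QSi 1 2] by simp
    moreover have "(\<Sum>e\<in>?E'. ?t e) = (\<Sum>e\<in>?E'. mconst (c e) * ?m (Suc i) e)"
      by (rule sum.cong) auto
    ultimately have "(\<Sum>e\<in>?E'. mconst (c e) * ?m (Suc i) e) \<in> Q (Suc i)" by simp
    moreover have "?E' \<subseteq> E0" "?E' \<noteq> {}" using E(1) \<mu>(1) by auto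
    moreover have "\<forall>e\<in>?E'. \<forall>e'\<in>?E'. \<forall>j<Suc i. e j = e' j"
      using E(3) by (simp add: less_Suc_eq)
    ultimately show ?case by (intro exI[of _ ?E'] conjI)
  qed
  from this[OF le_refl] obtain E where E: "E \<subseteq> E0" "E \<noteq> {}" "\<forall>e\<in>E. \<forall>e'\<in>E. \<forall>j<Suc N. e j = e' j"
    "(\<Sum>e\<in>E. mconst (c e) * ?m (Suc N) e) \<in> Q (Suc N)" by (elim exE conjE)
  obtain e where e: "e \<in> E" using E(2) by blast
  have "e' = e" if "e' \<in> E" for e'
  proof (rule extensionalityI)
    show "e' \<in> extensional {..N}" "e \<in> extensional {..N}" using E(1) E0(4) e that by auto
    show "e' j = e j" if "j \<in> {..N}" for j using E(3) e \<open>e' \<in> E\<close> that by (simp add: less_Suc_eq_le)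
  qed
  then have "E = {e}" using e by blast
  then have "mconst (c e) \<in> Q (Suc N)" using E(4) by simp
  moreover have "mconst (inverse (c e)) * mconst (c e) = (1 :: ('v, 'k) mpoly)"
    using E0(3) E(1) e by (auto simp flip: mconst_simps(4))
  moreover have QS: "prime_in UNIV (Q (Suc N))" using Q(1) n by simp
  ultimately show False
    using ideal_in_closed(3)[OF prime_inD(1)[OF QS], of "mconst (inverse (c e))" "mconst (c e)"] prime_inD(2)[OF QS]
    by auto
qed

section \<open>Regular semisimple matrices\<close>

primrec mat_pow :: "'a::comm_ring_1 ^ 'n ^ 'n \<Rightarrow> nat \<Rightarrow> 'a ^ 'n ^ 'n" where
  "mat_pow M 0 = mat 1"
| "mat_pow M (Suc j) = M ** mat_pow M j"

definition diag_mat :: "('n \<Rightarrow> 'a::comm_ring_1) \<Rightarrow> 'a ^ 'n ^ 'n" where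
  "diag_mat l = (\<chi> r s. if r = s then l r else 0)"

lemma diag_mat_nth: "diag_mat l $ r $ s = (if r = s then l r else 0)"
  by (simp add: diag_mat_def)

text \<open>The value \<open>\<chi>'(M)\<close>, where \<open>\<chi>\<close> is the characteristic polynomial of \<open>M\<close>.\<close>

definition deriv_mat :: "'a::comm_ring_1 ^ 'n ^ 'n \<Rightarrow> 'a ^ 'n ^ 'n" where
  "deriv_mat M = (\<chi> r s. \<Sum>j<CARD('n). of_nat (Suc j) * coeff (charpoly M) (Suc j) * mat_pow M j $ r $ s)"

text \<open>Up to sign the discriminant of the characteristic polynomial, the product of the values of \<open>\<chi>'\<close>
  at the eigenvalues.\<close>

definition disc_mat :: "'a::comm_ring_1 ^ 'n ^ 'n \<Rightarrow> 'a" where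
  "disc_mat M = det (deriv_mat M)"

text \<open>The divided difference \<open>(\<chi>(x) - \<chi>(y)) / (x - y)\<close> applied to \<open>Y\<close>, where \<open>x\<close> and \<open>y\<close> act as left and right
  multiplication by \<open>M\<close>.  If \<open>M\<close> has distinct eigenvalues, it is \<open>\<chi>'(M) E\<close>, where \<open>E\<close> is the
  projection of \<open>Y\<close> to the centralizer of \<open>M\<close>.\<close>

definition bezout_mat :: "'a::comm_ring_1 ^ 'n ^ 'n \<Rightarrow> 'a ^ 'n ^ 'n \<Rightarrow> 'a ^ 'n ^ 'n" where
  "bezout_mat M Y = (\<chi> r s. \<Sum>j<CARD('n). coeff (charpoly M) (Suc j) *
     (\<Sum>k\<le>j. (mat_pow M k ** Y ** mat_pow M (j - k)) $ r $ s))"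

text \<open>The numerator in Cramer's rule for an entry of \<open>E\<close> in \<open>\<chi>'(M) E = bezout_mat M Y\<close>.  On pencils it
  satisfies the same degree bound as the denominator \<open>disc_mat M\<close>.\<close>

definition proj_numerator :: "'a::comm_ring_1 ^ 'n ^ 'n \<Rightarrow> 'a ^ 'n ^ 'n \<Rightarrow> 'n \<Rightarrow> 'n \<Rightarrow> 'a" where
  "proj_numerator M Y r s = det (\<chi> i j. if j = r then bezout_mat M Y $ i $ s else deriv_mat M $ i $ j)"

lemma map_mat_mult:
  assumes "is_hom h"
  shows "map_mat h (A ** B) = map_mat h A ** map_mat h B"
  by (simp add: vec_eq_iff matrix_matrix_mult_def is_hom_sum is_hom_simps assms)

lemma map_mat_mat: "is_hom h \<Longrightarrow> map_mat h (mat c) = mat (h c)"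
  by (simp add: vec_eq_iff mat_def is_hom_simps)

lemma mat_pow_hom: "is_hom h \<Longrightarrow> map_mat h (mat_pow M j) = mat_pow (map_mat h M) j"
  by (induction j) (simp_all add: map_mat_mult map_mat_mat is_hom_simps)

lemma coeff_charpoly_hom: "is_hom h \<Longrightarrow> h (coeff (charpoly M) j) = coeff (charpoly (map_mat h M)) j"
  by (simp add: coeff_map_poly is_hom_simps flip: charpoly_hom)

lemma disc_mat_hom:
  assumes "is_hom h"
  shows "h (disc_mat M) = disc_mat (map_mat h M)"
proof -
  have "h (mat_pow M j $ r $ s) = mat_pow (map_mat h M) j $ r $ s" for j r s
    by (simp flip: mat_pow_hom[OF assms])
  then have "map_mat h (deriv_mat M) = deriv_mat (map_mat h M)"
    by (simp add: vec_eq_iff deriv_mat_def is_hom_sum is_hom_simps is_hom_of_nat coeff_charpoly_hom assms)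
  then show ?thesis by (simp add: disc_mat_def det_hom[OF assms])
qed

lemma mat_mult_commute: "mat c ** A = A ** mat (c :: 'a::comm_ring_1)"
  by (simp add: vec_eq_iff mat_def matrix_matrix_mult_def if_distrib[of "\<lambda>x. x * _"]
      if_distrib[of "\<lambda>x. _ * x"] mult.commute cong: if_cong)

lemma det_conj:
  fixes P :: "'a::comm_ring_1 ^ 'n ^ 'n"
  assumes "P ** Q = mat 1"
  shows "det (P ** A ** Q) = det A"
proof -
  have "det P * det Q = 1" using arg_cong[OF assms, of det] by (simp add: det_mul)
  then have "det A * (det P * det Q) = det A" by simp
  then show ?thesis by (simp add: det_mul ac_simps)
qed

lemma charpoly_conj:
  fixes P :: "'a::comm_ring_1 ^ 'n ^ 'n"
  assumes "P ** Q = mat 1"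
  shows "charpoly (P ** M ** Q) = charpoly M"
proof -
  let ?c = "map_mat (\<lambda>a. [:a:]) :: 'a ^ 'n ^ 'n \<Rightarrow> 'a poly ^ 'n ^ 'n"
  have hom: "is_hom (\<lambda>a. [:a:] :: 'a poly)" by (simp add: is_hom_def one_pCons)
  have cp: "charpoly M = det (mat [:0, 1:] - ?c M)" for M :: "'a ^ 'n ^ 'n"
    unfolding charpoly_def by (rule arg_cong[of _ _ det]) (simp add: vec_eq_iff mat_def)
  have PQ: "?c P ** ?c Q = mat 1" 
    unfolding map_mat_mult[OF hom, symmetric] assms map_mat_mat[OF hom] by (simp add: one_pCons[symmetric])
  have "mat [:0, 1:] - ?c (P ** M ** Q) = ?c P ** (mat [:0, 1:] - ?c M) ** ?c Q"
  proof -
    have "?c P ** mat [:0, 1:] ** ?c Q = ?c P ** (mat [:0, 1:] ** ?c Q)" by (simp only: matrix_mul_assoc)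
    also have "\<dots> = (?c P ** ?c Q) ** mat [:0, 1:]"
      unfolding mat_mult_commute[of _ "?c Q"] by (simp only: matrix_mul_assoc)
    finally have "?c P ** mat [:0, 1:] ** ?c Q = mat [:0, 1:]" by (simp add: PQ)
    then show ?thesis by (simp add: matrix_sub_distrib map_mat_mult[OF hom])
  qed
  then show ?thesis unfolding cp by (simp add: det_conj[OF PQ])
qed

lemma mat_pow_conj:
  fixes P :: "'a::comm_ring_1 ^ 'n ^ 'n"
  assumes "P ** Q = mat 1" "Q ** P = mat 1"
  shows "mat_pow (P ** M ** Q) j = P ** mat_pow M j ** Q"
proof (induction j)
  case 0
  show ?case by (simp add: assms)
next
  case (Suc j)
  have "mat_pow (P ** M ** Q) (Suc j) = P ** M ** (Q ** P) ** mat_pow M j ** Q"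
    by (simp add: Suc matrix_mul_assoc)
  then show ?case by (simp add: assms matrix_mul_assoc)
qed

lemma conj_linear_comb:
  fixes P Q :: "'a::comm_ring_1 ^ 'n ^ 'n" and F :: "'j \<Rightarrow> 'a ^ 'n ^ 'n"
  shows "(\<chi> r s. \<Sum>j\<in>J. c j * (P ** F j ** Q) $ r $ s) = P ** (\<chi> r s. \<Sum>j\<in>J. c j * F j $ r $ s) ** Q"
proof (induction J rule: infinite_finite_induct)
  case (insert x J)
  have ins: "(\<chi> r s. \<Sum>j\<in>insert x J. c j * F j $ r $ s)
      = mat (c x) ** F x + (\<chi> r s. \<Sum>j\<in>J. c j * F j $ r $ s)" for F :: "_ \<Rightarrow> 'a ^ 'n ^ 'n"
    using insert by (simp add: vec_eq_iff mat_def matrix_matrix_mult_def if_distrib[of "\<lambda>x. x * _"] cong: if_cong)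
  have comm: "mat (c x) ** (P ** F x ** Q) = P ** (mat (c x) ** F x) ** Q"
  proof -
    have "mat (c x) ** (P ** F x ** Q) = (mat (c x) ** P) ** F x ** Q" by (simp only: matrix_mul_assoc)
    then show ?thesis unfolding mat_mult_commute[of _ P] by (simp only: matrix_mul_assoc)
  qed
  show ?case
    unfolding ins[of F] ins[of "\<lambda>j. P ** F j ** Q"] insert.IH comm
    by (simp only: matrix_add_ldistrib matrix_add_rdistrib')
qed (simp_all add: vec_eq_iff matrix_matrix_mult_def)

lemma deriv_mat_conj:
  fixes P :: "'a::comm_ring_1 ^ 'n ^ 'n"
  assumes "P ** Q = mat 1" "Q ** P = mat 1"
  shows "deriv_mat (P ** M ** Q) = P ** deriv_mat M ** Q"
  unfolding deriv_mat_def charpoly_conj[OF assms(1)] mat_pow_conj[OF assms] by (rule conj_linear_comb)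

lemma disc_mat_conj:
  fixes P :: "'a::comm_ring_1 ^ 'n ^ 'n"
  assumes "P ** Q = mat 1" "Q ** P = mat 1"
  shows "disc_mat (P ** M ** Q) = disc_mat M"
  by (simp add: disc_mat_def deriv_mat_conj[OF assms] det_conj[OF assms(1)])

lemma bezout_mat_conj:
  fixes P :: "'a::comm_ring_1 ^ 'n ^ 'n"
  assumes "P ** Q = mat 1" "Q ** P = mat 1"
  shows "bezout_mat (P ** M ** Q) (P ** Y ** Q) = P ** bezout_mat M Y ** Q"
proof -
  have t: "P ** A ** Q ** (P ** Y ** Q) ** (P ** B ** Q) = P ** (A ** Y ** B) ** Q" for A B
  proof -
    have "P ** A ** Q ** (P ** Y ** Q) ** (P ** B ** Q) = P ** A ** (Q ** P) ** Y ** (Q ** P) ** B ** Q"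
      by (simp only: matrix_mul_assoc)
    then show ?thesis by (simp add: assms matrix_mul_assoc)
  qed
  let ?F = "\<lambda>M Y j. \<chi> r s. \<Sum>k\<le>j. 1 * (mat_pow M k ** Y ** mat_pow M (j - k)) $ r $ s"
  have F: "?F (P ** M ** Q) (P ** Y ** Q) j = P ** ?F M Y j ** Q" for j
    unfolding mat_pow_conj[OF assms] t by (rule conj_linear_comb[where c = "\<lambda>_. 1"])
  have B: "bezout_mat M Y = (\<chi> r s. \<Sum>j<CARD('n). coeff (charpoly M) (Suc j) * ?F M Y j $ r $ s)"
    for M Y :: "'a ^ 'n ^ 'n"
    by (simp add: bezout_mat_def vec_eq_iff)
  show ?thesis unfolding B F charpoly_conj[OF assms(1)] by (rule conj_linear_comb)
qed

lemma diag_mat_mult: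
  fixes A :: "'a::comm_ring_1 ^ 'n ^ 'n"
  shows "(diag_mat l ** A) $ r $ s = l r * A $ r $ s" "(A ** diag_mat l) $ r $ s = A $ r $ s * l s"
  by (simp_all add: diag_mat_def matrix_matrix_mult_def if_distrib[of "\<lambda>x. x * _"]
      if_distrib[of "\<lambda>x. _ * x"] cong: if_cong)

lemma mat_pow_diag: "mat_pow (diag_mat l) j = diag_mat (\<lambda>r. l r ^ j)"
  by (induction j) (auto simp: vec_eq_iff diag_mat_mult mat_def, auto simp: diag_mat_nth)

lemma det_diag_mat: "det (diag_mat l :: 'a::comm_ring_1 ^ 'n ^ 'n) = (\<Prod>r\<in>UNIV. l r)"
  by (subst det_diagonal) (auto simp: diag_mat_nth)

lemma charpoly_diag: "charpoly (diag_mat l :: 'a::comm_ring_1 ^ 'n ^ 'n) = (\<Prod>r\<in>UNIV. [:- l r, 1:])"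
  unfolding charpoly_def by (subst det_diagonal) (auto simp: diag_mat_nth)

lemma poly_charpoly_diag:
  fixes l :: "'n::finite \<Rightarrow> 'k::field"
  shows "poly (charpoly (diag_mat l :: 'k ^ 'n ^ 'n)) (l r) = 0"
  by (auto simp: charpoly_diag poly_prod)

lemma poly_charpoly_sum:
  fixes M :: "'a::comm_ring_1 ^ 'n ^ 'n"
  shows "poly (charpoly M) x = coeff (charpoly M) 0 + (\<Sum>j<CARD('n). coeff (charpoly M) (Suc j) * x ^ Suc j)"
  unfolding poly_altdef charpoly_monic(1) by (subst sum.atMost_shift) simp

lemma poly_eq_sum_le:
  fixes p :: "'a::comm_ring_1 poly"
  assumes "degree p \<le> d"
  shows "poly p x = (\<Sum>j\<le>d. coeff p j * x ^ j)"
  unfolding poly_altdef using assms by (intro sum.mono_neutral_left) (auto intro: le_degree)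

lemma poly_pderiv_charpoly:
  fixes M :: "'k::field ^ 'n ^ 'n"
  shows "poly (pderiv (charpoly M)) x = (\<Sum>j<CARD('n). of_nat (Suc j) * coeff (charpoly M) (Suc j) * x ^ j)"
proof -
  have "degree (pderiv (charpoly M)) \<le> CARD('n) - 1"
    by (intro degree_le) (auto simp: coeff_pderiv charpoly_monic(1) intro!: coeff_eq_0)
  then have "poly (pderiv (charpoly M)) x = (\<Sum>j\<le>CARD('n) - 1. coeff (pderiv (charpoly M)) j * x ^ j)"
    by (rule poly_eq_sum_le)
  also have "{..CARD('n) - 1} = {..<CARD('n)}" by (cases "CARD('n)") (auto simp: lessThan_Suc_atMost)
  finally show ?thesis by (simp add: coeff_pderiv)
qed

lemma pderiv_charpoly_diag:
  fixes l :: "'n::finite \<Rightarrow> 'k::field"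
  shows "poly (pderiv (charpoly (diag_mat l :: 'k ^ 'n ^ 'n))) (l r) = (\<Prod>s\<in>UNIV - {r}. l r - l s)"
proof -
  have "charpoly (diag_mat l :: 'k ^ 'n ^ 'n) = [:- l r, 1:] * (\<Prod>s\<in>UNIV - {r}. [:- l s, 1:])"
    unfolding charpoly_diag by (subst prod.remove[of _ r]) auto
  then show ?thesis
    by (simp add: pderiv_mult pderiv_pCons poly_prod del: mult_pCons_left mult_pCons_right)
qed

lemma deriv_mat_diag:
  fixes l :: "'n::finite \<Rightarrow> 'k::field"
  shows "deriv_mat (diag_mat l :: 'k ^ 'n ^ 'n) = diag_mat (\<lambda>r. poly (pderiv (charpoly (diag_mat l :: 'k ^ 'n ^ 'n))) (l r))"
proof -
  have "deriv_mat (diag_mat l :: 'k ^ 'n ^ 'n) $ r $ s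
      = (if r = s then \<Sum>j<CARD('n). of_nat (Suc j) * coeff (charpoly (diag_mat l :: 'k ^ 'n ^ 'n)) (Suc j) * l r ^ j else 0)"
    for r s unfolding deriv_mat_def mat_pow_diag by (simp add: diag_mat_nth)
  then show ?thesis unfolding poly_pderiv_charpoly by (simp add: vec_eq_iff diag_mat_nth)
qed

lemma disc_mat_diag:
  fixes l :: "'n::finite \<Rightarrow> 'k::field"
  shows "disc_mat (diag_mat l :: 'k ^ 'n ^ 'n) = (\<Prod>r\<in>UNIV. \<Prod>s\<in>UNIV - {r}. l r - l s)"
  by (simp add: disc_mat_def deriv_mat_diag det_diag_mat pderiv_charpoly_diag)

lemma disc_mat_diag_nonzero:
  fixes l :: "'n::finite \<Rightarrow> 'k::field"
  shows "disc_mat (diag_mat l :: 'k ^ 'n ^ 'n) \<noteq> 0 \<longleftrightarrow> inj l"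
  unfolding disc_mat_diag by (auto simp: inj_def)

text \<open>Entrywise, the Bezout matrix of a diagonal matrix multiplies by the divided difference of the
  characteristic polynomial at two eigenvalues, which is \<open>0\<close> off the diagonal and the derivative
  on it.\<close>

lemma bezout_mat_diag:
  fixes l :: "'n::finite \<Rightarrow> 'k::field" and Y :: "'k ^ 'n ^ 'n"
  assumes "inj l"
  shows "bezout_mat (diag_mat l) Y = deriv_mat (diag_mat l) ** diag_mat (\<lambda>r. Y $ r $ r)"
proof -
  let ?cp = "charpoly (diag_mat l :: 'k ^ 'n ^ 'n)"
  define T where "T = (\<lambda>x y. \<Sum>j<CARD('n). coeff ?cp (Suc j) * (\<Sum>k\<le>j. x ^ k * y ^ (j - k)))"
  have off: "T x y = 0" if "x \<noteq> y" "poly ?cp x = 0" "poly ?cp y = 0" for x y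
  proof -
    have eq: "(x - y) * (\<Sum>k\<le>j. x ^ k * y ^ (j - k)) = x ^ Suc j - y ^ Suc j" for j
      unfolding power_diff_sumr2[of x "Suc j" y] lessThan_Suc_atMost by (simp add: mult.commute)
    have "(x - y) * T x y = (\<Sum>j<CARD('n). (x - y) * (coeff ?cp (Suc j) * (\<Sum>k\<le>j. x ^ k * y ^ (j - k))))"
      unfolding T_def by (rule sum_distrib_left)
    also have "\<dots> = (\<Sum>j<CARD('n). coeff ?cp (Suc j) * (x ^ Suc j - y ^ Suc j))"
      by (intro sum.cong refl) (simp only: mult.left_commute[of "x - y" "coeff _ _"] eq)
    also have "\<dots> = poly ?cp x - poly ?cp y"
      unfolding poly_charpoly_sum by (simp add: right_diff_distrib sum_subtractf)
    finally show ?thesis using that by simp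
  qed
  have on: "T x x = poly (pderiv ?cp) x" for x
  proof -
    have "(\<Sum>k\<le>j. x ^ k * x ^ (j - k)) = of_nat (Suc j) * x ^ j" for j
    proof -
      have "(\<Sum>k\<le>j. x ^ k * x ^ (j - k)) = (\<Sum>k\<le>j. x ^ j)"
        by (rule sum.cong) (simp_all flip: power_add)
      then show ?thesis by simp
    qed
    then show ?thesis unfolding T_def poly_pderiv_charpoly by (simp add: ac_simps)
  qed
  have "(mat_pow (diag_mat l) k ** Y ** mat_pow (diag_mat l) (j - k)) $ r $ s
      = (l r ^ k * l s ^ (j - k)) * Y $ r $ s" for k j r s
    by (simp add: mat_pow_diag diag_mat_mult)
  then have "bezout_mat (diag_mat l) Y $ r $ s = T (l r) (l s) * Y $ r $ s" for r s
    unfolding bezout_mat_def T_def by (simp add: sum_distrib_left sum_distrib_right mult.assoc)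
  moreover have "T (l r) (l s) = 0" if "r \<noteq> s" for r s
    using that assms by (intro off poly_charpoly_diag) (auto simp: inj_eq)
  ultimately show ?thesis
    unfolding deriv_mat_diag by (simp add: vec_eq_iff diag_mat_mult) (simp add: diag_mat_nth on)
qed

definition is_diag :: "'a::zero ^ 'n ^ 'n \<Rightarrow> bool" where
  "is_diag A \<longleftrightarrow> (\<forall>r s. r \<noteq> s \<longrightarrow> A $ r $ s = 0)"

lemma is_diag_commute_distinct:
  fixes l :: "'n::finite \<Rightarrow> 'k::field"
  assumes "inj l" "diag_mat l ** A = A ** diag_mat l"
  shows "is_diag A"
  unfolding is_diag_def
proof (intro allI impI)
  fix r s :: 'n assume "r \<noteq> s"
  have "l r * A $ r $ s = A $ r $ s * l s" using diag_mat_mult assms(2) by metis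
  then have "(l r - l s) * A $ r $ s = 0" by (simp add: algebra_simps)
  then show "A $ r $ s = 0" using \<open>r \<noteq> s\<close> assms(1) by (auto simp: inj_eq)
qed

text \<open>For \<open>g' = g\<^sup>-\<^sup>1\<close>, the projection to the matrices that are diagonal in the basis of the columns of \<open>g\<close>,
  which form the centralizer of \<open>g D g\<^sup>-\<^sup>1\<close> when \<open>D\<close> is diagonal with distinct entries.\<close>

definition eigen_proj :: "'a::comm_ring_1 ^ 'n ^ 'n \<Rightarrow> 'a ^ 'n ^ 'n \<Rightarrow> 'a ^ 'n ^ 'n \<Rightarrow> 'a ^ 'n ^ 'n" where
  "eigen_proj g g' Y = g ** diag_mat (\<lambda>r. (g' ** Y ** g) $ r $ r) ** g'"

text \<open>Cramer's rule.  The left-hand side depends on \<open>M\<close> only, not on the choice of eigenvectors.\<close>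

lemma proj_numerator_eq:
  fixes g :: "'k::field ^ 'n ^ 'n"
  assumes g: "g ** g' = mat 1" "g' ** g = mat 1" and l: "inj l" and M: "M = g ** diag_mat l ** g'"
  shows "proj_numerator M Y r s = eigen_proj g g' Y $ r $ s * disc_mat M"
proof -
  let ?Y = "g' ** Y ** g"
  have Y: "Y = g ** ?Y ** g'"
  proof -
    have "g ** ?Y ** g' = (g ** g') ** Y ** (g ** g')" by (simp only: matrix_mul_assoc)
    then show ?thesis by (simp add: g)
  qed
  have "bezout_mat M Y = g ** bezout_mat (diag_mat l) ?Y ** g'"
    unfolding M by (subst Y) (rule bezout_mat_conj[OF g])
  also have "\<dots> = g ** deriv_mat (diag_mat l) ** (g' ** g) ** diag_mat (\<lambda>r. ?Y $ r $ r) ** g'"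
    unfolding bezout_mat_diag[OF l] by (simp add: g matrix_mul_assoc)
  also have "\<dots> = deriv_mat M ** eigen_proj g g' Y"
    unfolding M deriv_mat_conj[OF g] eigen_proj_def by (simp only: matrix_mul_assoc)
  finally have "bezout_mat M Y $ i $ s = (deriv_mat M *v column s (eigen_proj g g' Y)) $ i" for i
    by (simp add: matrix_matrix_mult_def matrix_vector_mult_def column_def)
  then have "proj_numerator M Y r s = column s (eigen_proj g g' Y) $ r * det (deriv_mat M)"
    unfolding proj_numerator_def by (simp add: cramer_lemma cong: if_cong)
  then show ?thesis by (simp add: disc_mat_def column_def)
qed

lemma eigen_proj_id:
  fixes g :: "'k::field ^ 'n ^ 'n"
  assumes g: "g ** g' = mat 1" "g' ** g = mat 1" and "is_diag (g' ** Y ** g)"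
  shows "eigen_proj g g' Y = Y"
proof -
  have "diag_mat (\<lambda>r. (g' ** Y ** g) $ r $ r) = g' ** Y ** g"
    using assms(3) by (auto simp: vec_eq_iff diag_mat_nth is_diag_def)
  then have "eigen_proj g g' Y = (g ** g') ** Y ** (g ** g')"
    unfolding eigen_proj_def by (simp only: matrix_mul_assoc)
  then show ?thesis by (simp add: g)
qed

lemma eigen_proj_diag:
  fixes g :: "'k::field ^ 'n ^ 'n"
  assumes g: "g' ** g = mat 1"
  shows "is_diag (g' ** eigen_proj g g' Y ** g)"
proof -
  have "g' ** eigen_proj g g' Y ** g = (g' ** g) ** diag_mat (\<lambda>r. (g' ** Y ** g) $ r $ r) ** (g' ** g)"
    unfolding eigen_proj_def by (simp only: matrix_mul_assoc)
  then show ?thesis by (simp add: g is_diag_def diag_mat_nth)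
qed

text \<open>If the determinant of \<open>\<chi>'(M)\<close> is nonzero, then no root of the characteristic polynomial \<open>\<chi>\<close> is a
  root of \<open>\<chi>'\<close>, because \<open>\<chi>'(M)\<close> acts on an eigenvector by the value of \<open>\<chi>'\<close> at the eigenvalue.
  So there are as many eigenvalues as rows.\<close>

lemma diagonalizable_if_disc_nonzero:
  fixes M :: "'k::alg_closed_field ^ 'n ^ 'n"
  assumes "disc_mat M \<noteq> 0"
  obtains g g' :: "'k ^ 'n ^ 'n" and l where "g ** g' = mat 1" "g' ** g = mat 1" "inj l" "M = g ** diag_mat l ** g'"
proof -
  let ?p = "charpoly M"
  have inv: "invertible (deriv_mat M)" using assms by (simp add: disc_mat_def invertible_det_nz)
  have eig: "\<exists>v. v \<noteq> 0 \<and> M *v v = a *s v" if "poly ?p a = 0" for a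
  proof -
    have "\<not> invertible (mat a - M)" using that by (simp add: poly_charpoly invertible_det_nz)
    then obtain v where "v \<noteq> 0" "(mat a - M) *v v = 0"
      using matrix_left_invertible_ker invertible_left_inverse by metis
    moreover have "(mat a - M) *v v = a *s v - M *v v"
      by (simp add: matrix_vector_mult_diff_rdistrib)
        (simp add: vec_eq_iff matrix_vector_mult_def mat_def if_distrib[of "\<lambda>x. x * _"] cong: if_cong)
    ultimately show ?thesis by auto
  qed
  have pow: "mat_pow M j *v v = a ^ j *s v" if "M *v v = a *s v" for a v j
    by (induction j) (simp_all add: that vec.scale flip: matrix_vector_mul_assoc)
  have simple: "poly (pderiv ?p) a \<noteq> 0" if a: "poly ?p a = 0" for a
  proof
    assume 0: "poly (pderiv ?p) a = 0"
    obtain v where v: "v \<noteq> 0" "M *v v = a *s v" using eig[OF a] by blast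
    have "(deriv_mat M *v v) $ r = 0" for r
    proof -
      have "(deriv_mat M *v v) $ r = (\<Sum>s\<in>UNIV. \<Sum>j<CARD('n). of_nat (Suc j) * coeff ?p (Suc j) * (mat_pow M j $ r $ s * v $ s))"
        by (simp add: deriv_mat_def matrix_vector_mult_def sum_distrib_right mult.assoc)
      also have "\<dots> = (\<Sum>j<CARD('n). of_nat (Suc j) * coeff ?p (Suc j) * (mat_pow M j *v v) $ r)"
        by (subst sum.swap) (simp add: matrix_vector_mult_def sum_distrib_left)
      also have "\<dots> = poly (pderiv ?p) a * v $ r"
        unfolding pow[OF v(2)] poly_pderiv_charpoly by (simp add: sum_distrib_right mult.assoc)
      finally show ?thesis using 0 by simp
    qed
    then have "deriv_mat M *v v = 0" by (simp add: vec_eq_iff)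
    then show False
      using inv v(1) matrix_left_invertible_ker[of "deriv_mat M"] invertible_left_inverse by blast
  qed
  have p0: "?p \<noteq> 0" using charpoly_monic(2)[of M] by auto
  obtain A where A: "size A = degree ?p" "?p = smult (lead_coeff ?p) (\<Prod>x\<in>#A. [:- x, 1:])"
    using alg_closed_imp_factorization[OF p0] by blast
  have pA: "?p = (\<Prod>x\<in>#A. [:- x, 1:])" using A(2) charpoly_monic[of M] by simp
  have root: "poly ?p x = 0" if "x \<in># A" for x
    unfolding pA using that by (auto dest!: multi_member_split)
  have count: "count A x \<le> 1" for x
  proof (rule ccontr)
    assume "\<not> ?thesis"
    then have c2: "count A x \<ge> 2" by simp
    then have "x \<in># A" by (simp flip: count_greater_zero_iff)
    then obtain A' where A': "A = add_mset x A'" by (blast dest: multi_member_split)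
    then have "x \<in># A'" using c2 by (simp flip: count_greater_zero_iff)
    then obtain B where "A' = add_mset x B" by (blast dest: multi_member_split)
    with A' have "A = {#x, x#} + B" by simp
    then have "?p = [:- x, 1:] * ([:- x, 1:] * (\<Prod>x\<in>#B. [:- x, 1:]))" unfolding pA by simp
    then have "poly ?p x = 0" "poly (pderiv ?p) x = 0"
      by (simp_all add: pderiv_mult del: mult_pCons_left mult_pCons_right)
    then show False using simple by blast
  qed
  have "size A = (\<Sum>x\<in>set_mset A. count A x)" by (rule size_multiset_overloaded_eq)
  also have "\<dots> = (\<Sum>x\<in>set_mset A. 1)"
    using count by (intro sum.cong refl antisym) (auto simp: Suc_le_eq)
  finally have "card (set_mset A) = CARD('n)" using A(1) charpoly_monic(1)[of M] by simp
  then obtain l where l: "bij_betw l (UNIV :: 'n set) (set_mset A)"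
    using finite_same_card_bij[of "UNIV :: 'n set" "set_mset A"] by auto
  then have inj: "inj l" and lroot: "poly ?p (l i) = 0" for i
    using root by (auto simp: bij_betw_def)
  have "\<exists>v. \<forall>i. v i \<noteq> 0 \<and> M *v v i = l i *s v i" using eig[OF lroot] by (intro choice) blast
  then obtain v where v: "\<And>i. v i \<noteq> 0" "\<And>i. M *v v i = l i *s v i" by blast
  define g where "g = (\<chi> r i. v i $ r)"
  have Mg: "M ** g = g ** diag_mat l"
  proof -
    have "(M ** g) $ r $ i = (M *v v i) $ r" for r i
      by (simp add: g_def matrix_matrix_mult_def matrix_vector_mult_def)
    then show ?thesis by (simp add: vec_eq_iff v(2) diag_mat_mult) (simp add: g_def)
  qed
  have "c = 0" if c: "g *v c = 0" for c
  proof -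
    have j: "(\<Sum>i\<in>UNIV. l i ^ j * (c $ i * v i $ r)) = 0" for j r
    proof -
      have "mat_pow M j ** g = g ** diag_mat (\<lambda>i. l i ^ j)"
      proof (induction j)
        case 0
        have "diag_mat (\<lambda>i. 1) = (mat 1 :: 'k ^ 'n ^ 'n)" by (simp add: vec_eq_iff diag_mat_nth mat_def)
        then show ?case by simp
      next
        case (Suc j)
        have "mat_pow M (Suc j) ** g = (M ** g) ** diag_mat (\<lambda>i. l i ^ j)"
          by (simp add: Suc flip: matrix_mul_assoc)
        also have "\<dots> = g ** (diag_mat l ** diag_mat (\<lambda>i. l i ^ j))" by (simp add: Mg matrix_mul_assoc)
        also have "diag_mat l ** diag_mat (\<lambda>i. l i ^ j) = diag_mat (\<lambda>i. l i ^ Suc j)"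
          by (simp add: vec_eq_iff diag_mat_mult) (simp add: diag_mat_nth)
        finally show ?case .
      qed
      then have "(g ** diag_mat (\<lambda>i. l i ^ j)) *v c = mat_pow M j *v (g *v c)"
        by (simp add: matrix_vector_mul_assoc)
      then have "((g ** diag_mat (\<lambda>i. l i ^ j)) *v c) $ r = 0" by (simp add: c)
      then show ?thesis by (simp add: matrix_vector_mult_def diag_mat_mult g_def ac_simps)
    qed
    have poly: "(\<Sum>i\<in>UNIV. poly q (l i) * (c $ i * v i $ r)) = 0" for q r
    proof -
      have "(\<Sum>i\<in>UNIV. poly q (l i) * (c $ i * v i $ r))
          = (\<Sum>j\<le>degree q. coeff q j * (\<Sum>i\<in>UNIV. l i ^ j * (c $ i * v i $ r)))"
        unfolding poly_altdef sum_distrib_left sum_distrib_right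
        by (subst sum.swap) (simp add: mult.assoc)
      then show ?thesis by (simp add: j)
    qed
    have "c $ k = 0" for k
    proof -
      define q where "q = (\<Prod>i\<in>UNIV - {k}. [:- l i, 1:])"
      have q0: "poly q (l i) = 0" if "i \<noteq> k" for i using that by (auto simp: q_def poly_prod)
      have qk: "poly q (l k) \<noteq> 0" using inj by (auto simp: q_def poly_prod inj_eq)
      have "poly q (l k) * (c $ k * v k $ r) = 0" for r
        using poly[of q r] q0 by (simp add: sum.remove[of _ k])
      then have "c $ k * v k $ r = 0" for r using qk by simp
      moreover obtain r where "v k $ r \<noteq> 0" using v(1)[of k] by (auto simp: vec_eq_iff)
      ultimately show ?thesis by (metis mult_eq_0_iff)
    qed
    then show ?thesis by (simp add: vec_eq_iff)
  qed
  then have "\<exists>B. B ** g = mat 1" unfolding matrix_left_invertible_ker by blast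
  then obtain g' where g': "g' ** g = mat 1" ..
  then have g: "g ** g' = mat 1" by (simp add: matrix_left_right_inverse)
  have "M = M ** (g ** g')" by (simp add: g)
  also have "\<dots> = g ** diag_mat l ** g'" by (simp add: matrix_mul_assoc Mg)
  finally show ?thesis by (rule that[OF g g' inj])
qed

section \<open>Commuting pencils of matrices\<close>

text \<open>A predicate on functions lets degree bounds pass through sums, products and determinants of
  functions with values in a ring of scalars.\<close>

definition polyfun :: "nat \<Rightarrow> ('k::comm_ring_1 \<Rightarrow> 'k) \<Rightarrow> bool" where
  "polyfun d f \<longleftrightarrow> (\<exists>p. degree p \<le> d \<and> (\<forall>t. f t = poly p t))"

lemma polyfun_const: "polyfun d (\<lambda>t. c)"
  unfolding polyfun_def by (intro exI[of _ "[:c:]"]) simp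

lemma polyfun_linear: "polyfun 1 (\<lambda>t. a + t * c)"
  unfolding polyfun_def by (intro exI[of _ "[:a, c:]"]) simp

lemma polyfun_add:
  assumes "polyfun d f" "polyfun d g"
  shows "polyfun d (\<lambda>t. f t + g t)"
proof -
  obtain p q where "degree p \<le> d" "\<forall>t. f t = poly p t" "degree q \<le> d" "\<forall>t. g t = poly q t"
    using assms unfolding polyfun_def by blast
  then show ?thesis unfolding polyfun_def by (intro exI[of _ "p + q"]) (simp add: degree_add_le)
qed

lemma polyfun_mult:
  assumes "polyfun d f" "polyfun e g" "d + e \<le> m"
  shows "polyfun m (\<lambda>t. f t * g t)"
proof -
  obtain p q where pq: "degree p \<le> d" "\<forall>t. f t = poly p t" "degree q \<le> e" "\<forall>t. g t = poly q t"
    using assms unfolding polyfun_def by blast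
  then have "degree (p * q) \<le> m" using degree_mult_le[of p q] assms(3) by linarith
  then show ?thesis unfolding polyfun_def using pq by (intro exI[of _ "p * q"]) simp
qed

lemma polyfun_sum: "(\<And>x. x \<in> A \<Longrightarrow> polyfun d (f x)) \<Longrightarrow> polyfun d (\<lambda>t. \<Sum>x\<in>A. f x t)"
  by (induction A rule: infinite_finite_induct) (simp_all add: polyfun_const polyfun_add)

lemma polyfun_prod: "(\<And>x. x \<in> A \<Longrightarrow> polyfun d (f x)) \<Longrightarrow> polyfun (card A * d) (\<lambda>t. \<Prod>x\<in>A. f x t)"
proof (induction A rule: infinite_finite_induct)
  case (insert x A)
  then have "polyfun (card (insert x A) * d) (\<lambda>t. f x t * (\<Prod>x\<in>A. f x t))"
    by (intro polyfun_mult[of d _ "card A * d"]) simp_all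
  then show ?case using insert by simp
qed (simp_all add: polyfun_const)

lemma polyfun_det:
  fixes A :: "'k::comm_ring_1 \<Rightarrow> 'k ^ 'n ^ 'n"
  assumes "\<And>r s. polyfun d (\<lambda>t. A t $ r $ s)"
  shows "polyfun (CARD('n) * d) (\<lambda>t. det (A t))"
  unfolding det_def
  by (intro polyfun_sum polyfun_mult[OF polyfun_const[of 0] polyfun_prod[of UNIV d]] assms) simp

text \<open>The analogue of \<open>polyfun\<close> for functions with polynomial values, where the variable of these
  polynomials counts as degree one.\<close>

definition bipolyfun :: "nat \<Rightarrow> ('k::comm_ring_1 \<Rightarrow> 'k poly) \<Rightarrow> bool" where
  "bipolyfun d f \<longleftrightarrow> (\<forall>j. if j \<le> d then polyfun (d - j) (\<lambda>t. coeff (f t) j) else (\<forall>t. coeff (f t) j = 0))"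

lemma bipolyfunD: "bipolyfun d f \<Longrightarrow> j \<le> d \<Longrightarrow> polyfun (d - j) (\<lambda>t. coeff (f t) j)"
  "bipolyfun d f \<Longrightarrow> j > d \<Longrightarrow> coeff (f t) j = 0"
  unfolding bipolyfun_def by (metis, metis not_less)

lemma bipolyfun_add: "bipolyfun d f \<Longrightarrow> bipolyfun d g \<Longrightarrow> bipolyfun d (\<lambda>t. f t + g t)"
  unfolding bipolyfun_def by (simp add: polyfun_add)

lemma bipolyfun_0: "bipolyfun d (\<lambda>t. 0)"
  unfolding bipolyfun_def by (simp add: polyfun_const)

lemma bipolyfun_of_int: "bipolyfun 0 (\<lambda>t. of_int n)"
  unfolding bipolyfun_def by (auto simp: of_int_poly coeff_pCons polyfun_const split: nat.splits)

lemma bipolyfun_mult: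
  assumes "bipolyfun d f" "bipolyfun e g"
  shows "bipolyfun (d + e) (\<lambda>t. f t * g t)"
  unfolding bipolyfun_def
proof (intro allI)
  fix j
  have 0: "coeff (f t) i * coeff (g t) (j - i) = 0" if "i > d \<or> j - i > e" for i t
    using that bipolyfunD(2)[OF assms(1)] bipolyfunD(2)[OF assms(2)] by auto
  have 1: "polyfun (d + e - j) (\<lambda>t. coeff (f t) i * coeff (g t) (j - i))" if i: "i \<le> j" "j \<le> d + e" for i
  proof (cases "i > d \<or> j - i > e")
    case True
    then show ?thesis using 0 by (simp add: polyfun_const)
  next
    case False
    then show ?thesis
      using i by (intro polyfun_mult[OF bipolyfunD(1)[OF assms(1)] bipolyfunD(1)[OF assms(2)]]) auto
  qed
  show "if j \<le> d + e then polyfun (d + e - j) (\<lambda>t. coeff (f t * g t) j) else \<forall>t. coeff (f t * g t) j = 0"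
  proof (cases "j \<le> d + e")
    case True
    have "polyfun (d + e - j) (\<lambda>t. \<Sum>i\<le>j. coeff (f t) i * coeff (g t) (j - i))"
      using True by (intro polyfun_sum 1) auto
    then show ?thesis using True by (simp add: coeff_mult)
  next
    case False
    then have "coeff (f t) i * coeff (g t) (j - i) = 0" if "i \<le> j" for i t
      using that by (intro 0) auto
    then show ?thesis using False by (simp add: coeff_mult)
  qed
qed

lemma bipolyfun_prod:
  assumes "finite A" "\<And>x. x \<in> A \<Longrightarrow> bipolyfun 1 (f x)"
  shows "bipolyfun (card A) (\<lambda>t. \<Prod>x\<in>A. f x t)"
  using assms
proof (induction A rule: finite_induct)
  case empty
  then show ?case using bipolyfun_of_int[of 1] by simp
next
  case (insert x A)
  then have "bipolyfun (1 + card A) (\<lambda>t. f x t * (\<Prod>x\<in>A. f x t))" by (intro bipolyfun_mult) simp_all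
  then show ?case using insert by simp
qed

lemma bipolyfun_sum: "(\<And>x. x \<in> A \<Longrightarrow> bipolyfun d (f x)) \<Longrightarrow> bipolyfun d (\<lambda>t. \<Sum>x\<in>A. f x t)"
  by (induction A rule: infinite_finite_induct) (simp_all add: bipolyfun_0 bipolyfun_add)

definition pencil :: "'a::comm_ring_1 ^ 'n ^ 'n \<Rightarrow> 'a ^ 'n ^ 'n \<Rightarrow> 'a \<Rightarrow> 'a ^ 'n ^ 'n" where
  "pencil A C t = (\<chi> r s. A $ r $ s + t * C $ r $ s)"

text \<open>The entries of \<open>x I - (A + t C)\<close> have total degree \<open>1\<close> in \<open>x\<close> and \<open>t\<close>.\<close>

lemma polyfun_coeff_charpoly:
  fixes A C :: "'k::comm_ring_1 ^ 'n ^ 'n"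
  assumes "j \<le> CARD('n)"
  shows "polyfun (CARD('n) - j) (\<lambda>t. coeff (charpoly (pencil A C t)) j)"
proof -
  have e: "bipolyfun 1 (\<lambda>t. (if r = s then [:0, 1:] else 0) - [:pencil A C t $ r $ s:])" for r s
    unfolding bipolyfun_def
  proof (intro allI)
    fix j
    have "polyfun 1 (\<lambda>t. - A $ r $ s + t * - C $ r $ s)" by (rule polyfun_linear)
    then show "if j \<le> 1 then polyfun (1 - j) (\<lambda>t. coeff ((if r = s then [:0, 1:] else 0) - [:pencil A C t $ r $ s:]) j)
      else \<forall>t. coeff ((if r = s then [:0, 1:] else 0) - [:pencil A C t $ r $ s:]) j = 0"
      by (cases j) (auto simp: pencil_def coeff_pCons polyfun_const algebra_simps split: nat.splits)
  qed
  have "bipolyfun (CARD('n)) (\<lambda>t. charpoly (pencil A C t))"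
    unfolding charpoly_def det_def
  proof (rule bipolyfun_sum)
    fix p :: "'n \<Rightarrow> 'n"
    have "bipolyfun (0 + CARD('n)) (\<lambda>t. of_int (sign p) * (\<Prod>i\<in>UNIV. (if i = p i then [:0, 1:] else 0) - [:pencil A C t $ i $ p i:]))"
      by (intro bipolyfun_mult bipolyfun_of_int bipolyfun_prod e) simp
    then show "bipolyfun (CARD('n)) (\<lambda>t. of_int (sign p) *
        (\<Prod>i\<in>UNIV. (\<chi> r s. (if r = s then [:0, 1:] else 0) - [:pencil A C t $ r $ s:]) $ i $ p i))"
      by simp
  qed
  then show ?thesis using assms by (rule bipolyfunD)
qed

lemma polyfun_mat_pow: "polyfun j (\<lambda>t. mat_pow (pencil A C t) j $ r $ s)"
proof (induction j arbitrary: r)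
  case 0
  show ?case by (simp add: polyfun_const)
next
  case (Suc j)
  show ?case
    unfolding mat_pow.simps matrix_matrix_mult_def pencil_def[of A C]
    using polyfun_linear Suc[unfolded pencil_def]
    by (simp, intro polyfun_sum polyfun_mult[of 1 _ j]) auto
qed

lemma polyfun_deriv_mat:
  fixes A C :: "'k::comm_ring_1 ^ 'n ^ 'n"
  shows "polyfun (CARD('n) - 1) (\<lambda>t. deriv_mat (pencil A C t) $ r $ s)"
  unfolding deriv_mat_def vec_lambda_beta
proof (rule polyfun_sum)
  fix j assume "j \<in> {..<CARD('n)}"
  then show "polyfun (CARD('n) - 1) (\<lambda>t. of_nat (Suc j) * coeff (charpoly (pencil A C t)) (Suc j) * mat_pow (pencil A C t) j $ r $ s)"
    by (intro polyfun_mult[OF polyfun_mult[OF polyfun_const[of 0] polyfun_coeff_charpoly order_refl] polyfun_mat_pow]) auto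
qed

lemma polyfun_bezout_mat:
  fixes A C :: "'k::comm_ring_1 ^ 'n ^ 'n"
  shows "polyfun (CARD('n) - 1) (\<lambda>t. bezout_mat (pencil A C t) Y $ r $ s)"
  unfolding bezout_mat_def vec_lambda_beta
proof (rule polyfun_sum)
  fix j assume j: "j \<in> {..<CARD('n)}"
  have "polyfun j (\<lambda>t. (mat_pow (pencil A C t) k ** Y ** mat_pow (pencil A C t) (j - k)) $ r $ s)" if "k \<in> {..j}" for k
    unfolding matrix_matrix_mult_def vec_lambda_beta
    using that
    by (intro polyfun_sum polyfun_mult[OF polyfun_sum polyfun_mat_pow, of UNIV k]
        polyfun_mult[OF polyfun_mat_pow polyfun_const[of 0]]) auto
  then have "polyfun j (\<lambda>t. \<Sum>k\<le>j. (mat_pow (pencil A C t) k ** Y ** mat_pow (pencil A C t) (j - k)) $ r $ s)"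
    by (rule polyfun_sum)
  then show "polyfun (CARD('n) - 1) (\<lambda>t. coeff (charpoly (pencil A C t)) (Suc j) *
      (\<Sum>k\<le>j. (mat_pow (pencil A C t) k ** Y ** mat_pow (pencil A C t) (j - k)) $ r $ s))"
    using j by (intro polyfun_mult[OF polyfun_coeff_charpoly]) auto
qed

lemma polyfun_disc_mat:
  fixes A C :: "'k::comm_ring_1 ^ 'n ^ 'n"
  shows "polyfun (CARD('n) * (CARD('n) - 1)) (\<lambda>t. disc_mat (pencil A C t))"
  unfolding disc_mat_def by (rule polyfun_det[OF polyfun_deriv_mat])

lemma polyfun_proj_numerator:
  fixes A C :: "'k::comm_ring_1 ^ 'n ^ 'n"
  shows "polyfun (CARD('n) * (CARD('n) - 1)) (\<lambda>t. proj_numerator (pencil A C t) Y r s)"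
  unfolding proj_numerator_def
proof (rule polyfun_det)
  fix i j
  show "polyfun (CARD('n) - 1) (\<lambda>t. (\<chi> i j. if j = r then bezout_mat (pencil A C t) Y $ i $ s
      else deriv_mat (pencil A C t) $ i $ j) $ i $ j)"
    using polyfun_deriv_mat[of A C i j] polyfun_bezout_mat[of A C Y i s] by (cases "j = r") simp_all
qed

text \<open>A Sylvester matrix for the discriminants of two pencils, written in terms of their values at the
  points \<open>\<tau> i\<close>.  Values, unlike coefficients, are visibly polynomial in the matrices and invariant
  under conjugation.  The discriminants have degree at most \<open>n (n - 1)\<close> for \<open>n = CARD('n)\<close>.  The
  second one is multiplied by \<open>t\<^sup>n\<close> and both are treated as polynomials of degree at most \<open>n\<^sup>2\<close>, which
  makes the size of the matrix that of the type \<open>bool \<times> 'n \<times> 'n\<close>.\<close>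

definition sylvester_matrix ::
  "('n \<times> 'n \<Rightarrow> nat) \<Rightarrow> (bool \<times> 'n \<times> 'n \<Rightarrow> 'a::comm_ring_1) \<Rightarrow> 'a ^ 'n ^ 'n \<Rightarrow> 'a ^ 'n ^ 'n \<Rightarrow>
    'a ^ 'n ^ 'n \<Rightarrow> 'a ^ 'n ^ 'n \<Rightarrow> 'a ^ (bool \<times> 'n \<times> 'n) ^ (bool \<times> 'n \<times> 'n)" where
  "sylvester_matrix \<iota> \<tau> A B C D = (\<chi> i j.
     if fst j then \<tau> i ^ \<iota> (snd j) * disc_mat (pencil A C (\<tau> i))
     else \<tau> i ^ (\<iota> (snd j) + CARD('n)) * disc_mat (pencil B D (\<tau> i)))"

lemma sum_bool_prod:
  fixes F :: "bool \<times> 'm::finite \<Rightarrow> 'a::comm_monoid_add"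
  shows "(\<Sum>j\<in>UNIV. F j) = (\<Sum>q\<in>UNIV. F (True, q)) + (\<Sum>q\<in>UNIV. F (False, q))"
proof -
  have "(\<Sum>j\<in>UNIV. F j) = (\<Sum>j\<in>UNIV \<times> UNIV. F j)" by (simp only: UNIV_Times_UNIV)
  also have "\<dots> = (\<Sum>b\<in>UNIV. \<Sum>q\<in>UNIV. F (b, q))" by (simp add: sum.cartesian_product)
  finally show ?thesis by (simp add: UNIV_bool add.commute)
qed

lemma poly_sum_enum:
  fixes U :: "'a::comm_ring_1 poly" and \<iota> :: "'m::finite \<Rightarrow> nat"
  assumes \<iota>: "bij_betw \<iota> UNIV {..<N}" and U: "\<And>j. j \<ge> N \<Longrightarrow> coeff U j = 0"
  shows "(\<Sum>q\<in>UNIV. coeff U (\<iota> q) * x ^ \<iota> q) = poly U x"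
proof -
  have "(\<Sum>q\<in>UNIV. coeff U (\<iota> q) * x ^ \<iota> q) = (\<Sum>j<N. coeff U j * x ^ j)"
    by (rule sum.reindex_bij_betw[OF \<iota>])
  also have "\<dots> = (\<Sum>j\<le>N. coeff U j * x ^ j)"
    unfolding lessThan_Suc_atMost[symmetric] using U by simp
  also have "\<dots> = poly U x"
    using U by (intro poly_eq_sum_le[symmetric] degree_le) auto
  finally show ?thesis .
qed

text \<open>The values of \<open>U p + t\<^sup>n V q\<close> at the points \<open>\<tau> i\<close> are the product of the Sylvester matrix with the
  vector of the coefficients of \<open>U\<close> and \<open>V\<close>.\<close>

lemma sylvester_kernel:
  fixes A B C D :: "'k::field ^ 'n ^ 'n"
  assumes \<iota>: "bij_betw \<iota> (UNIV :: ('n \<times> 'n) set) {..<CARD('n) * CARD('n)}"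
    and det: "det (sylvester_matrix \<iota> \<tau> A B C D) \<noteq> 0"
    and p: "\<And>t. disc_mat (pencil A C t) = poly p t" "\<And>t. disc_mat (pencil B D t) = poly q t"
    and U: "\<And>j. j \<ge> CARD('n) * CARD('n) \<Longrightarrow> coeff U j = 0"
    and V: "\<And>j. j \<ge> CARD('n) * CARD('n) \<Longrightarrow> coeff V j = 0"
    and eq: "U * p + monom 1 (CARD('n)) * V * q = 0"
  shows "U = 0" "V = 0"
proof -
  let ?K = "sylvester_matrix \<iota> \<tau> A B C D"
  define w :: "'k ^ (bool \<times> 'n \<times> 'n)" where "w = (\<chi> j. coeff (if fst j then U else V) (\<iota> (snd j)))"
  have "(?K *v w) $ i = 0" for i
  proof -
    have "poly U (\<tau> i) = (\<Sum>j\<in>UNIV. coeff U (\<iota> j) * \<tau> i ^ \<iota> j)"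
      by (rule poly_sum_enum[OF \<iota>, symmetric]) (rule U)
    then have 1: "(\<Sum>j\<in>UNIV. \<tau> i ^ \<iota> j * poly p (\<tau> i) * coeff U (\<iota> j)) = poly U (\<tau> i) * poly p (\<tau> i)"
      by (simp only: sum_distrib_left sum_distrib_right ac_simps)
    have "poly V (\<tau> i) = (\<Sum>j\<in>UNIV. coeff V (\<iota> j) * \<tau> i ^ \<iota> j)"
      by (rule poly_sum_enum[OF \<iota>, symmetric]) (rule V)
    then have 2: "(\<Sum>j\<in>UNIV. \<tau> i ^ (\<iota> j + CARD('n)) * poly q (\<tau> i) * coeff V (\<iota> j))
        = poly V (\<tau> i) * (\<tau> i ^ CARD('n) * poly q (\<tau> i))"
      by (simp only: sum_distrib_left sum_distrib_right power_add ac_simps)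
    have "(?K *v w) $ i = (\<Sum>j\<in>UNIV. ?K $ i $ j * w $ j)" by (simp add: matrix_vector_mult_def)
    also have "\<dots> = (\<Sum>j\<in>UNIV. \<tau> i ^ \<iota> j * poly p (\<tau> i) * coeff U (\<iota> j))
        + (\<Sum>j\<in>UNIV. \<tau> i ^ (\<iota> j + CARD('n)) * poly q (\<tau> i) * coeff V (\<iota> j))"
      unfolding sum_bool_prod by (simp add: sylvester_matrix_def w_def p)
    also have "\<dots> = poly (U * p + monom 1 (CARD('n)) * V * q) (\<tau> i)"
      unfolding 1 2 by (simp add: poly_monom mult.left_commute mult.assoc)
    finally show ?thesis by (simp add: eq)
  qed
  then have "?K *v w = 0" by (simp add: vec_eq_iff)
  moreover have "invertible ?K" using det by (simp add: invertible_det_nz)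
  ultimately have w0: "w = 0" using matrix_left_invertible_ker[of ?K] invertible_left_inverse by metis
  have w: "coeff (if b then U else V) (\<iota> j) = 0" for b j
  proof -
    have "w $ (b, j) = 0" by (simp only: w0 zero_index)
    then show ?thesis by (simp add: w_def)
  qed
  have idx: "\<exists>q. j = \<iota> q" if "j < CARD('n) * CARD('n)" for j
  proof -
    have "j \<in> range \<iota>" using that \<iota> by (simp add: bij_betw_def)
    then show ?thesis by blast
  qed
  have "coeff U j = 0" for j
    using U[of j] idx[of j] w[of True] by (cases "j < CARD('n) * CARD('n)") auto
  then show "U = 0" by (simp add: poly_eq_iff)
  have "coeff V j = 0" for j
    using V[of j] idx[of j] w[of False] by (cases "j < CARD('n) * CARD('n)") auto
  then show "V = 0" by (simp add: poly_eq_iff)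
qed

lemma pencil_conj:
  fixes A C g g' :: "'a::comm_ring_1 ^ 'n ^ 'n"
  shows "g' ** pencil A C t ** g = pencil (g' ** A ** g) (g' ** C ** g) t"
proof -
  have p: "pencil A C t = A + mat t ** C" for A C :: "'a ^ 'n ^ 'n"
    by (simp add: vec_eq_iff pencil_def mat_def matrix_matrix_mult_def if_distrib[of "\<lambda>x. x * _"] cong: if_cong)
  have "g' ** (mat t ** C) ** g = (g' ** mat t) ** C ** g" by (simp only: matrix_mul_assoc)
  also have "\<dots> = mat t ** (g' ** C ** g)"
    unfolding mat_mult_commute[of t g', symmetric] by (simp only: matrix_mul_assoc)
  finally show ?thesis unfolding p by (simp add: matrix_add_ldistrib matrix_add_rdistrib')
qed

text \<open>The key step.  For almost all \<open>t\<close> the commuting matrices \<open>A + t C\<close> and \<open>B + t D\<close> are regular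
  semisimple with the same eigenprojections, so each entry of the projection \<open>E\<^sub>t\<close> of a matrix to their
  common centralizer is a rational function of \<open>t\<close> in two ways, with the two discriminants as
  denominators and with numerators of no larger degree.  As the discriminants are coprime, also at
  infinity, \<open>E\<^sub>t\<close> does not depend on \<open>t\<close>.  So all the matrices \<open>A + t C\<close> and \<open>B + t D\<close> lie in one and the
  same diagonalizable algebra.\<close>

theorem commuting_pencils_diagonalizable:
  fixes A B C D :: "'k::alg_closed_field ^ 'n ^ 'n"
  assumes AB: "A ** B = B ** A" and CD: "C ** D = D ** C"
    and mix: "A ** D - D ** A + (C ** B - B ** C) = 0"
    and \<iota>: "bij_betw \<iota> (UNIV :: ('n \<times> 'n) set) {..<CARD('n) * CARD('n)}"
    and det: "det (sylvester_matrix \<iota> \<tau> A B C D) \<noteq> 0"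
  obtains g g' :: "'k ^ 'n ^ 'n" where "g ** g' = mat 1" "g' ** g = mat 1" "is_diag (g' ** A ** g)" "is_diag (g' ** B ** g)"
    "is_diag (g' ** C ** g)" "is_diag (g' ** D ** g)"
proof -
  let ?n = "CARD('n)"
  define m where "m = ?n * (?n - 1)"
  have n0: "?n > 0" by simp
  have mn: "m + ?n = ?n * ?n" unfolding m_def using n0 by (cases "?n") simp_all
  have mlt: "m < ?n * ?n" using mn n0 by linarith
  obtain p where p: "degree p \<le> m" "\<And>t. disc_mat (pencil A C t) = poly p t"
    using polyfun_disc_mat[of A C] unfolding polyfun_def m_def by blast
  obtain q where q: "degree q \<le> m" "\<And>t. disc_mat (pencil B D t) = poly q t"
    using polyfun_disc_mat[of B D] unfolding polyfun_def m_def by blast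
  note ker = sylvester_kernel[OF \<iota> det p(2) q(2)]
  have one: "coeff (1 :: 'k poly) j = 0" if "j \<ge> ?n * ?n" for j
    using that mlt by (intro coeff_eq_0) simp
  have p0: "p \<noteq> 0" using ker(1)[of 1 0] one by auto
  have q0: "q \<noteq> 0" using ker(2)[of 0 1] one by auto
  have cp: "coeff p j = 0" if "j \<ge> ?n * ?n" for j
    using that p(1) mlt by (intro coeff_eq_0) linarith
  \<comment> \<open>If \<open>q\<close> had smaller degree, the trivial syzygy \<open>(t\<^sup>n q) p = p (t\<^sup>n q)\<close> would lie in the kernel.\<close>
  have qm: "coeff q m \<noteq> 0"
  proof
    assume 0: "coeff q m = 0"
    have "coeff (monom 1 ?n * q) j = 0" if "j \<ge> ?n * ?n" for j
    proof -
      have "coeff q (j - ?n) = 0"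
        using 0 that q(1) mn by (cases "j - ?n = m") (auto intro!: coeff_eq_0)
      then show ?thesis by (simp add: coeff_monom_mult)
    qed
    then show False using ker(2)[of "monom 1 ?n * q" "- p"] cp p0 by (simp add: ac_simps)
  qed
  define good where "good t \<longleftrightarrow> poly p t \<noteq> 0 \<and> poly q t \<noteq> 0" for t
  have "finite {t. poly (p * q) t = 0}" using p0 q0 by (intro poly_roots_finite) simp
  then have fin: "finite (- Collect good)"
    by (rule rev_finite_subset) (auto simp: good_def)
  have inf: "infinite (Collect good)"
    using fin infinite_alg_closed[where 'k = 'k] by (metis finite_compl)
  have comm: "pencil A C t ** pencil B D t = pencil B D t ** pencil A C t" for t
  proof -
    have "(pencil A C t ** pencil B D t - pencil B D t ** pencil A C t) $ r $ s =
        (A ** B - B ** A) $ r $ s + t * (A ** D - D ** A + (C ** B - B ** C)) $ r $ s + t * t * (C ** D - D ** C) $ r $ s"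
      for r s
      by (simp add: matrix_matrix_mult_def pencil_def sum_distrib_left sum.distrib sum_subtractf[symmetric] algebra_simps)
        (simp add: sum_subtractf sum.distrib algebra_simps)
    then have "pencil A C t ** pencil B D t - pencil B D t ** pencil A C t = 0"
      by (simp add: vec_eq_iff AB CD mix)
    then show ?thesis by simp
  qed
  have both: "is_diag (g' ** pencil B D t ** g) \<and>
      (\<exists>l'. inj l' \<and> pencil B D t = g ** diag_mat l' ** g')"
    if t: "good t" and g: "g ** g' = mat 1" "g' ** g = mat 1" and l: "inj l"
      and M: "pencil A C t = g ** diag_mat l ** g'" for t and g g' :: "'k ^ 'n ^ 'n" and l
  proof -
    let ?N = "g' ** pencil B D t ** g"
    have N: "pencil B D t = g ** ?N ** g'"
    proof -
      have "g ** ?N ** g' = (g ** g') ** pencil B D t ** (g ** g')" by (simp only: matrix_mul_assoc)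
      then show ?thesis by (simp add: g)
    qed
    have d: "diag_mat l = g' ** pencil A C t ** g"
    proof -
      have "g' ** pencil A C t ** g = (g' ** g) ** diag_mat l ** (g' ** g)"
        unfolding M by (simp only: matrix_mul_assoc)
      then show ?thesis by (simp add: g)
    qed
    have "diag_mat l ** ?N = g' ** pencil A C t ** (g ** g') ** pencil B D t ** g"
      unfolding d by (simp only: matrix_mul_assoc)
    also have "\<dots> = g' ** (pencil A C t ** pencil B D t) ** g" by (simp add: g matrix_mul_assoc)
    also have "\<dots> = g' ** pencil B D t ** (g ** g') ** pencil A C t ** g"
      unfolding comm by (simp add: g matrix_mul_assoc)
    also have "\<dots> = ?N ** diag_mat l" unfolding d by (simp only: matrix_mul_assoc)
    finally have dg: "is_diag ?N" by (rule is_diag_commute_distinct[OF l])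
    then have "?N = diag_mat (\<lambda>r. ?N $ r $ r)" by (auto simp: vec_eq_iff diag_mat_nth is_diag_def)
    then obtain l' where l': "?N = diag_mat l'" by blast
    then have N': "pencil B D t = g ** diag_mat l' ** g'" using N by simp
    have "disc_mat (diag_mat l' :: 'k ^ 'n ^ 'n) = disc_mat (pencil B D t)"
      unfolding N' by (rule disc_mat_conj[OF g, symmetric])
    then have "inj l'" using t q(2) by (simp add: good_def flip: disc_mat_diag_nonzero)
    then show ?thesis using dg N' by blast
  qed
  have const: "\<exists>\<kappa>. \<forall>t (g :: 'k ^ 'n ^ 'n) g' l. good t \<and> g ** g' = mat 1 \<and> g' ** g = mat 1 \<and> inj l \<and>
      pencil A C t = g ** diag_mat l ** g' \<longrightarrow> eigen_proj g g' Y $ r $ s = \<kappa>" for Y r s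
  proof -
    obtain a where a: "degree a \<le> m" "\<And>t. proj_numerator (pencil A C t) Y r s = poly a t"
      using polyfun_proj_numerator[of A C Y r s] unfolding polyfun_def m_def by blast
    obtain b where b: "degree b \<le> m" "\<And>t. proj_numerator (pencil B D t) Y r s = poly b t"
      using polyfun_proj_numerator[of B D Y r s] unfolding polyfun_def m_def by blast
    have "poly (a * q - b * p) t = 0" if t: "good t" for t
    proof -
      have "disc_mat (pencil A C t) \<noteq> 0" using t p(2) by (simp add: good_def)
      then obtain g g' :: "'k ^ 'n ^ 'n" and l where g: "g ** g' = mat 1" "g' ** g = mat 1" "inj l" "pencil A C t = g ** diag_mat l ** g'"
        by (rule diagonalizable_if_disc_nonzero)
      obtain l' where l': "inj l'" "pencil B D t = g ** diag_mat l' ** g'" using both[OF t g] by blast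
      have "poly a t = eigen_proj g g' Y $ r $ s * poly p t"
        using proj_numerator_eq[OF g, of Y r s] by (simp add: a p)
      moreover have "poly b t = eigen_proj g g' Y $ r $ s * poly q t"
        using proj_numerator_eq[OF g(1,2) l', of Y r s] by (simp add: b q)
      ultimately show ?thesis by simp
    qed
    then have "Collect good \<subseteq> {t. poly (a * q - b * p) t = 0}" by auto
    then have "infinite {t. poly (a * q - b * p) t = 0}" using inf finite_subset by blast
    then have cross: "a * q = b * p" using poly_roots_finite[of "a * q - b * p"] by auto
    \<comment> \<open>The relation \<open>a q = b p\<close> makes \<open>(b - \<kappa> q, a - \<kappa> p)\<close> a syzygy for every \<open>\<kappa>\<close>; cancelling the leading
      term of \<open>b\<close> brings the degree into the range where the kernel is zero, so \<open>a / p = \<kappa>\<close>.\<close>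
    define \<kappa> where "\<kappa> = coeff b m / coeff q m"
    let ?U = "monom 1 ?n * (b - smult \<kappa> q)" and ?V = "- (a - smult \<kappa> p)"
    have "?V = 0"
    proof (rule ker(2)[of ?U])
      show "coeff ?U j = 0" if j: "j \<ge> ?n * ?n" for j
      proof -
        have "coeff (b - smult \<kappa> q) (j - ?n) = 0"
        proof (cases "j - ?n = m")
          case True
          then show ?thesis using qm by (simp add: \<kappa>_def)
        next
          case False
          then have "j - ?n > m" using j mn by linarith
          then show ?thesis using b(1) q(1) by (simp add: coeff_eq_0)
        qed
        then show ?thesis by (simp add: coeff_monom_mult)
      qed
      show "coeff ?V j = 0" if "j \<ge> ?n * ?n" for j
        using that a(1) mlt cp by (simp add: coeff_eq_0)
      have "(b - smult \<kappa> q) * p - (a - smult \<kappa> p) * q = 0"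
        using cross by (simp add: algebra_simps)
      then have "monom 1 ?n * ((b - smult \<kappa> q) * p - (a - smult \<kappa> p) * q) = 0" by simp
      then show "?U * p + monom 1 ?n * ?V * q = 0"
        by (simp add: algebra_simps)
    qed
    then have ap: "a = smult \<kappa> p" by simp
    have "eigen_proj g g' Y $ r $ s = \<kappa>"
      if "good t" "g ** g' = mat 1" "g' ** g = mat 1" "inj l" "pencil A C t = g ** diag_mat l ** g'" for t and g g' :: "'k ^ 'n ^ 'n" and l
      using proj_numerator_eq[OF that(2-5), of Y r s] that(1) by (simp add: a p ap good_def)
    then show ?thesis by (intro exI[of _ \<kappa>] allI impI, elim conjE)
  qed
  obtain t0 where t0: "good t0" using infinite_imp_nonempty[OF inf] by auto
  have "infinite (Collect good - {t0})" using inf by simp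
  from infinite_imp_nonempty[OF this] obtain t1 where t1: "good t1" "t1 \<noteq> t0" by auto
  have d0: "disc_mat (pencil A C t0) \<noteq> 0" and d1: "disc_mat (pencil A C t1) \<noteq> 0"
    using t0 t1 p(2) by (simp_all add: good_def)
  obtain g g' :: "'k ^ 'n ^ 'n" and l
    where g: "g ** g' = mat 1" "g' ** g = mat 1" "inj l" "pencil A C t0 = g ** diag_mat l ** g'"
    by (rule diagonalizable_if_disc_nonzero[OF d0])
  obtain h h' :: "'k ^ 'n ^ 'n" and l1
    where h: "h ** h' = mat 1" "h' ** h = mat 1" "inj l1" "pencil A C t1 = h ** diag_mat l1 ** h'"
    by (rule diagonalizable_if_disc_nonzero[OF d1])
  have transfer: "is_diag (g' ** Y ** g)" if "is_diag (h' ** Y ** h)" for Y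
  proof -
    have "eigen_proj g g' Y $ r $ s = eigen_proj h h' Y $ r $ s" for r s
    proof -
      obtain \<kappa> where \<kappa>: "\<forall>t (g :: 'k ^ 'n ^ 'n) g' l. good t \<and> g ** g' = mat 1 \<and> g' ** g = mat 1 \<and> inj l \<and>
          pencil A C t = g ** diag_mat l ** g' \<longrightarrow> eigen_proj g g' Y $ r $ s = \<kappa>"
        using const[of Y r s] by (rule exE)
      show ?thesis
        using \<kappa>[rule_format, of t0 g g' l] \<kappa>[rule_format, of t1 h h' l1] t0 t1(1) g h by simp
    qed
    then have "eigen_proj g g' Y = eigen_proj h h' Y" by (simp add: vec_eq_iff)
    then have "eigen_proj g g' Y = Y" using eigen_proj_id[OF h(1,2) that] by simp
    then show ?thesis using eigen_proj_diag[OF g(2), of Y] by simp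
  qed
  have dA: "is_diag (k' ** pencil A C t ** k)"
    if "k' ** k = mat 1" "pencil A C t = k ** diag_mat l ** k'" for k k' :: "'k ^ 'n ^ 'n" and t l
  proof -
    have "k' ** pencil A C t ** k = (k' ** k) ** diag_mat l ** (k' ** k)"
      unfolding that(2) by (simp only: matrix_mul_assoc)
    then show ?thesis by (simp add: that(1) is_diag_def diag_mat_nth)
  qed
  have lin: "is_diag P \<and> is_diag Q" if "is_diag (pencil P Q t0)" "is_diag (pencil P Q t1)" for P Q :: "'k ^ 'n ^ 'n"
  proof -
    have "P $ r $ s = 0 \<and> Q $ r $ s = 0" if "r \<noteq> s" for r s
    proof -
      have e: "P $ r $ s + t0 * Q $ r $ s = 0" "P $ r $ s + t1 * Q $ r $ s = 0"
        using \<open>is_diag (pencil P Q t0)\<close> \<open>is_diag (pencil P Q t1)\<close> that by (auto simp: is_diag_def pencil_def)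
      have "(t1 - t0) * Q $ r $ s = (P $ r $ s + t1 * Q $ r $ s) - (P $ r $ s + t0 * Q $ r $ s)"
        by (simp add: algebra_simps)
      also have "\<dots> = 0" by (simp only: e diff_self)
      finally have "Q $ r $ s = 0" using t1(2) by simp
      then show ?thesis using e(1) by simp
    qed
    then show ?thesis by (simp add: is_diag_def)
  qed
  have "is_diag (g' ** A ** g) \<and> is_diag (g' ** C ** g)"
    using dA[OF g(2,4)] transfer[OF dA[OF h(2,4)]] by (intro lin) (simp_all add: pencil_conj)
  moreover have "is_diag (g' ** B ** g) \<and> is_diag (g' ** D ** g)"
    using both[OF t0 g] transfer[of "pencil B D t1"] both[OF t1(1) h] by (intro lin) (simp_all add: pencil_conj)
  ultimately show ?thesis by (intro that[OF g(1,2)]) simp_all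
qed

section \<open>An invariant that detects simultaneous diagonalizability\<close>

definition mpoly_eval :: "('v \<Rightarrow> 'k) \<Rightarrow> ('v, 'k::comm_ring_1) mpoly \<Rightarrow> 'k" where
  "mpoly_eval x f = Poly_Mapping.lookup (msubst (\<lambda>v. mconst (x v)) f :: ('v, 'k) mpoly) 0"

lemma mconst_mpoly_eval:
  fixes f :: "('v, 'k::comm_ring_1) mpoly"
  shows "mconst (mpoly_eval x f) = (msubst (\<lambda>v. mconst (x v)) f :: ('v, 'k::comm_ring_1) mpoly)"
proof -
  note S = subring_set_range[OF is_hom_mconst]
  have "msubst (\<lambda>v. mconst (x v)) f \<in> range (mconst :: 'k \<Rightarrow> ('v, 'k) mpoly)"
    unfolding msubst_def
    by (intro subring_set_sum[OF S] subring_set_closed(6)[OF S] subring_set_prod[OF S] subring_set_power[OF S]) simp_all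
  then obtain c where c: "msubst (\<lambda>v. mconst (x v)) f = (mconst c :: ('v, 'k) mpoly)" by blast
  have "Poly_Mapping.lookup (mconst c :: ('v, 'k) mpoly) 0 = c" by (simp add: mconst_def)
  then show ?thesis by (simp only: mpoly_eval_def c)
qed

lemma mpoly_eval_simps:
  fixes x :: "'v \<Rightarrow> 'k::comm_ring_1"
  shows "is_hom (mpoly_eval x)" "mpoly_eval x (mconst c) = c" "mpoly_eval x (mvar v) = x v"
proof -
  have inj: "a = b" if "mconst a = (mconst b :: ('v, 'k) mpoly)" for a b using that inj_mconst by blast
  show "is_hom (mpoly_eval x)"
    unfolding is_hom_def by (intro conjI allI; rule inj) (simp_all add: mconst_mpoly_eval)
  show "mpoly_eval x (mconst c) = c" "mpoly_eval x (mvar v) = x v"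
    by (rule inj, simp add: mconst_mpoly_eval)+
qed

lemma is_hom_mpoly_eqI:
  assumes "is_hom F" "is_hom G" "\<And>c. F (mconst c) = G (mconst c)" "\<And>v. F (mvar v) = G (mvar v)"
  shows "F f = G f"
  by (rule hom_eqI_mpoly[of F G]) (simp_all add: is_hom_simps assms)

lemma det_sylvester_hom:
  assumes "is_hom h"
  shows "h (det (sylvester_matrix \<iota> \<tau> A B C D)) =
    det (sylvester_matrix \<iota> (\<lambda>i. h (\<tau> i)) (map_mat h A) (map_mat h B) (map_mat h C) (map_mat h D))"
proof -
  have p: "map_mat h (pencil A C t) = pencil (map_mat h A) (map_mat h C) (h t)" for A C t
    by (simp add: vec_eq_iff pencil_def is_hom_simps assms)
  show ?thesis
    unfolding det_hom[OF assms]
    by (intro arg_cong[of _ _ det])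
      (simp add: vec_eq_iff sylvester_matrix_def is_hom_simps is_hom_power disc_mat_hom p assms)
qed

lemma sylvester_conj:
  fixes A B C D P Q :: "'a::comm_ring_1 ^ 'n ^ 'n"
  assumes "P ** Q = mat 1" "Q ** P = mat 1"
  shows "sylvester_matrix \<iota> \<tau> (P ** A ** Q) (P ** B ** Q) (P ** C ** Q) (P ** D ** Q) = sylvester_matrix \<iota> \<tau> A B C D"
proof -
  have "disc_mat (pencil (P ** E ** Q) (P ** F ** Q) t) = disc_mat (pencil E F t)" for E F t
    unfolding pencil_conj[symmetric] by (rule disc_mat_conj[OF assms])
  then show ?thesis by (simp add: sylvester_matrix_def vec_eq_iff)
qed

text \<open>For \<open>C = B = 0\<close> and diagonal \<open>A = D\<close> with distinct entries, one discriminant is constant and the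
  other one is a monomial of the largest possible degree, so the Sylvester matrix is a rescaled
  Vandermonde matrix.\<close>

lemma det_sylvester_nonzero:
  fixes l :: "'n::finite \<Rightarrow> 'k::field"
  assumes \<iota>: "bij_betw \<iota> (UNIV :: ('n \<times> 'n) set) {..<CARD('n) * CARD('n)}"
    and \<tau>: "inj \<tau>" and l: "inj l"
  shows "det (sylvester_matrix \<iota> \<tau> (diag_mat l) 0 0 (diag_mat l) :: 'k ^ (bool \<times> 'n \<times> 'n) ^ (bool \<times> 'n \<times> 'n)) \<noteq> 0"
proof -
  let ?K = "sylvester_matrix \<iota> \<tau> (diag_mat l) 0 0 (diag_mat l) :: 'k ^ (bool \<times> 'n \<times> 'n) ^ (bool \<times> 'n \<times> 'n)"
  let ?n = "CARD('n)"
  let ?N = "?n * ?n"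
  define a where "a = disc_mat (diag_mat l :: 'k ^ 'n ^ 'n)"
  have a0: "a \<noteq> 0" using l by (simp add: a_def disc_mat_diag_nonzero)
  have 1: "pencil (diag_mat l) 0 t = diag_mat l" "pencil 0 (diag_mat l) t = diag_mat (\<lambda>r. t * l r)" for t
    by (simp_all add: vec_eq_iff pencil_def diag_mat_nth)
  have 2: "disc_mat (diag_mat (\<lambda>r. t * l r) :: 'k ^ 'n ^ 'n) = t ^ (?n * (?n - 1)) * a" for t
  proof -
    have "(\<Prod>s\<in>UNIV - {r}. t * l r - t * l s) = t ^ (?n - 1) * (\<Prod>s\<in>UNIV - {r}. l r - l s)" for r
      by (simp add: prod.distrib card_Diff_subset flip: right_diff_distrib)
    then show ?thesis unfolding a_def disc_mat_diag 
      by (simp add: prod.distrib mult.commute[of "CARD('n)" "CARD('n) - Suc 0"] power_mult)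
  qed
  have mn: "?n * (?n - 1) + ?n = ?N" by (cases ?n) simp_all
  have \<iota>lt: "\<iota> q < ?N" for q using \<iota> by (auto simp: bij_betw_def)
  have \<iota>lt2: "\<iota> q < 2 * ?N" for q by (rule less_le_trans[OF \<iota>lt]) simp
  have \<iota>inj: "\<iota> q = \<iota> q' \<longleftrightarrow> q = q'" for q q' using \<iota> by (auto simp: bij_betw_def inj_eq)
  have "w = 0" if w: "?K *v w = 0" for w
  proof -
    define W where "W = (\<Sum>q\<in>UNIV. monom (a * w $ (True, q)) (\<iota> q)) + (\<Sum>q\<in>UNIV. monom (a * w $ (False, q)) (\<iota> q + ?N))"
    have "poly W (\<tau> i) = 0" for i
    proof -
      have t: "\<tau> i ^ (\<iota> q + ?n) * (\<tau> i ^ (?n * (?n - 1)) * a) = a * \<tau> i ^ (\<iota> q + ?N)" for q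
      proof -
        have "\<tau> i ^ (\<iota> q + ?n) * (\<tau> i ^ (?n * (?n - 1)) * a) = a * \<tau> i ^ (\<iota> q + (?n * (?n - 1) + ?n))"
          unfolding power_add by (simp only: ac_simps)
        then show ?thesis unfolding mn .
      qed
      have K: "?K $ i $ (True, q) = a * \<tau> i ^ \<iota> q" "?K $ i $ (False, q) = a * \<tau> i ^ (\<iota> q + ?N)" for q
        unfolding sylvester_matrix_def vec_lambda_beta fst_conv snd_conv 1 2 t by (simp_all add: a_def)
      have "poly W (\<tau> i) = (\<Sum>j\<in>UNIV. ?K $ i $ j * w $ j)"
        unfolding sum_bool_prod W_def K by (simp add: poly_sum poly_monom ac_simps)
      also have "\<dots> = (?K *v w) $ i" by (simp add: matrix_vector_mult_def)
      finally show ?thesis by (simp add: w)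
    qed
    then have "range \<tau> \<subseteq> {x. poly W x = 0}" by auto
    moreover have "card (range \<tau>) = 2 * ?N" using \<tau> by (simp add: card_image)
    moreover have "degree W < 2 * ?N" unfolding W_def
    proof (rule degree_add_less)
      have N0: "0 < 2 * ?N" by simp
      show "degree (\<Sum>q\<in>UNIV. monom (a * w $ (True, q)) (\<iota> q)) < 2 * ?N"
        by (intro degree_sum_less[OF _ N0] le_less_trans[OF degree_monom_le] \<iota>lt2)
      show "degree (\<Sum>q\<in>UNIV. monom (a * w $ (False, q)) (\<iota> q + ?N)) < 2 * ?N"
        using \<iota>lt by (intro degree_sum_less[OF _ N0] le_less_trans[OF degree_monom_le]) simp
    qed
    ultimately have W0: "W = 0"
      using card_mono[of "{x. poly W x = 0}" "range \<tau>"] poly_roots_finite[of W] card_poly_roots_bound[of W]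
      by (cases "W = 0") auto
    have ne: "\<iota> q + ?N \<noteq> \<iota> q'" for q q' using \<iota>lt[of q'] by simp
    have "w $ (True, q) = 0" for q
    proof -
      have "coeff W (\<iota> q) = a * w $ (True, q)"
        by (simp add: W_def coeff_sum \<iota>inj ne if_distrib cong: if_cong)
      then show ?thesis using W0 a0 by simp
    qed
    moreover have "w $ (False, q) = 0" for q
    proof -
      have "coeff W (\<iota> q + ?N) = a * w $ (False, q)"
        by (simp add: W_def coeff_sum \<iota>inj ne[symmetric] if_distrib cong: if_cong)
      then show ?thesis using W0 a0 by simp
    qed
    ultimately have "w $ j = 0" for j by (cases j; cases "fst j") auto
    then show ?thesis by (simp add: vec_eq_iff)
  qed
  then have "\<exists>B. B ** ?K = mat 1" unfolding matrix_left_invertible_ker by blast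
  then show ?thesis using invertible_det_nz invertible_left_inverse by blast
qed

lemma inj_finite_to_alg_closed:
  obtains l :: "'i::finite \<Rightarrow> 'k::alg_closed_field" where "inj l"
proof -
  obtain T :: "'k set" where T: "finite T" "card T = CARD('i)"
    using infinite_arbitrarily_large[OF infinite_alg_closed] by blast
  then obtain l where "bij_betw l (UNIV :: 'i set) T"
    using finite_same_card_bij[of "UNIV :: 'i set" T] by auto
  then show ?thesis using that by (auto simp: bij_betw_def)
qed

text \<open>The resultant of the discriminants of the generic pencils \<open>B\<^sub>1\<^sub>1 + t B\<^sub>2\<^sub>1\<close> and \<open>B\<^sub>1\<^sub>2 + t B\<^sub>2\<^sub>2\<close>, in the
  form of the determinant above.\<close>

definition diagonalizability_invariant ::
  "('n \<times> 'n \<Rightarrow> nat) \<Rightarrow> (bool \<times> 'n \<times> 'n \<Rightarrow> 'k) \<Rightarrow> ('n::finite, 'k::field) adhm_poly" where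
  "diagonalizability_invariant \<iota> \<tau> = det (sylvester_matrix \<iota> (\<lambda>i. mconst (\<tau> i))
     (generic_matrix I11) (generic_matrix I12) (generic_matrix I21) (generic_matrix I22))"

lemma diagonalizability_invariant_hom:
  fixes h :: "('n::finite, 'k::field) adhm_poly \<Rightarrow> 'b::comm_ring_1"
  assumes "is_hom h"
  shows "h (diagonalizability_invariant \<iota> \<tau>) = det (sylvester_matrix \<iota> (\<lambda>i. h (mconst (\<tau> i)))
     (map_mat h (generic_matrix I11)) (map_mat h (generic_matrix I12))
     (map_mat h (generic_matrix I21)) (map_mat h (generic_matrix I22)))"
  unfolding diagonalizability_invariant_def by (rule det_sylvester_hom[OF assms])

lemma is_hom_gl_act: "is_hom (gl_act g)"
  unfolding gl_act_def by (rule is_hom_msubst)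

lemma is_hom_diag_pullback: "is_hom diag_pullback"
  unfolding diag_pullback_def by (rule is_hom_msubst)

lemma const_matrix_inv:
  fixes g :: "'k::field ^ 'n ^ 'n"
  assumes "invertible g"
  shows "(const_matrix g :: ('v, 'k) mpoly ^ 'n ^ 'n) ** const_matrix (matrix_inv g) = mat 1"
    "(const_matrix (matrix_inv g) :: ('v, 'k) mpoly ^ 'n ^ 'n) ** const_matrix g = mat 1"
  by (simp_all add: matrix_inv_mult assms const_matrix_1 flip: const_matrix_mult)

lemma gl_act_diagonalizability_invariant:
  assumes "invertible g"
  shows "gl_act g (diagonalizability_invariant \<iota> \<tau>) = diagonalizability_invariant \<iota> \<tau>"
proof -
  have "gl_act g (mconst c) = mconst c" for c by (simp add: gl_act_def)
  then show ?thesis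
    unfolding diagonalizability_invariant_hom[OF is_hom_gl_act] map_mat_gl_act
    by (simp add: sylvester_conj[OF const_matrix_inv[OF assms]] diagonalizability_invariant_def)
qed

lemma diag_pullback_diagonalizability_invariant:
  fixes \<tau> :: "bool \<times> 'n::finite \<times> 'n \<Rightarrow> 'k::alg_closed_field"
  assumes \<iota>: "bij_betw \<iota> (UNIV :: ('n \<times> 'n) set) {..<CARD('n) * CARD('n)}" and \<tau>: "inj \<tau>"
  shows "diag_pullback (diagonalizability_invariant \<iota> \<tau>) \<noteq> 0"
proof
  assume 0: "diag_pullback (diagonalizability_invariant \<iota> \<tau>) = 0"
  obtain l :: "'n \<Rightarrow> 'k" where l: "inj l"
    by (rule inj_finite_to_alg_closed)
  define y where "y = (\<lambda>(r, a). if a = I11 \<or> a = I22 then l r else 0)"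
  have y: "y (r, I11) = l r" "y (r, I22) = l r" "y (r, I12) = 0" "y (r, I21) = 0" for r
    by (simp_all add: y_def)
  let ?h = "\<lambda>f. mpoly_eval y (diag_pullback f)"
  have hom: "is_hom ?h" by (rule is_hom_comp[OF mpoly_eval_simps(1) is_hom_diag_pullback])
  have var: "?h (mvar (a, r, s)) = (if r = s then y (r, a) else 0)" for a r s
    by (simp add: diag_pullback_def mpoly_eval_simps is_hom_simps(4)[OF mpoly_eval_simps(1)])
  have const: "?h (mconst c) = c" for c by (simp add: diag_pullback_def mpoly_eval_simps)
  have "map_mat ?h (generic_matrix I11) = diag_mat l" "map_mat ?h (generic_matrix I22) = diag_mat l"
    "map_mat ?h (generic_matrix I12) = 0" "map_mat ?h (generic_matrix I21) = 0"
    using y by (simp_all add: vec_eq_iff generic_matrix_def var diag_mat_nth)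
  then have "?h (diagonalizability_invariant \<iota> \<tau>) = det (sylvester_matrix \<iota> \<tau> (diag_mat l) 0 0 (diag_mat l))"
    unfolding diagonalizability_invariant_hom[OF hom] by (simp add: const)
  then show False
    using det_sylvester_nonzero[OF \<iota> \<tau> l] 0 by (simp add: is_hom_simps(4)[OF mpoly_eval_simps(1)])
qed

section \<open>The ideal of the image is a minimal prime\<close>

lemma ideal_in_adhm_ideal: "ideal_in UNIV (adhm_ideal :: ('n::finite, 'k::comm_ring_1) adhm_poly set)"
  unfolding ideal_in_def using adhm_ideal_closed[where 'n = 'n and 'k = 'k] by blast

definition gl_invariant :: "('n::finite, 'k::field) adhm_poly \<Rightarrow> bool" where
  "gl_invariant f \<longleftrightarrow> (\<forall>g. invertible g \<longrightarrow> gl_act g f - f \<in> adhm_ideal)"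

lemma coset_eq_iff:
  fixes f g :: "('n::finite, 'k::comm_ring_1) adhm_poly"
  shows "(+) f ` adhm_ideal = (+) g ` adhm_ideal \<longleftrightarrow> f - g \<in> adhm_ideal"
proof
  assume "(+) f ` adhm_ideal = (+) g ` adhm_ideal"
  moreover have "f \<in> (+) f ` adhm_ideal" using adhm_ideal_closed(2) by (intro image_eqI[of _ _ 0]) simp_all
  ultimately show "f - g \<in> adhm_ideal" by auto
next
  assume fg: "f - g \<in> adhm_ideal"
  have sub: "(+) a ` adhm_ideal \<subseteq> (+) b ` adhm_ideal" if "a - b \<in> adhm_ideal" for a b :: "('n, 'k) adhm_poly"
  proof
    fix x assume "x \<in> (+) a ` adhm_ideal"
    then obtain i where i: "i \<in> adhm_ideal" "x = a + i" by blast
    then have "x = b + ((a - b) + i)" "(a - b) + i \<in> adhm_ideal" using adhm_ideal_closed(1)[OF that] by simp_all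
    then show "x \<in> (+) b ` adhm_ideal" by blast
  qed
  have "g - f \<in> adhm_ideal" using ideal_in_minus(1)[OF subring_set_UNIV ideal_in_adhm_ideal fg] by simp
  then show "(+) f ` adhm_ideal = (+) g ` adhm_ideal" using sub[OF fg] sub[of g f] by blast
qed

lemma carrier_M0_ring:
  "F \<in> carrier M0_ring \<longleftrightarrow> (\<exists>f. gl_invariant f \<and> F = (+) f ` (adhm_ideal :: ('n::finite, 'k::field) adhm_poly set))"
proof -
  have "gl_act g ` (+) f ` adhm_ideal = (+) f ` adhm_ideal \<longleftrightarrow> gl_act g f - f \<in> adhm_ideal"
    if "invertible g" for g and f :: "('n, 'k) adhm_poly"
    by (simp only: gl_act_coset[OF that] coset_eq_iff)
  then have e: "(\<forall>g. invertible g \<longrightarrow> gl_act g ` (+) f ` adhm_ideal = (+) f ` adhm_ideal) \<longleftrightarrow> gl_invariant f"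
    for f :: "('n, 'k) adhm_poly"
    unfolding gl_invariant_def by metis
  have "F \<in> carrier M0_ring \<longleftrightarrow> F \<in> carrier adhm_ring \<and> (\<forall>g. invertible g \<longrightarrow> gl_act g ` F = F)"
    by (auto simp: M0_ring_def fixed_subring_def)
  also have "\<dots> \<longleftrightarrow> (\<exists>f. F = (+) f ` adhm_ideal \<and> (\<forall>g. invertible g \<longrightarrow> gl_act g ` F = F))"
    unfolding adhm_ring_simps(1) by blast
  also have "\<dots> \<longleftrightarrow> (\<exists>f. gl_invariant f \<and> F = (+) f ` adhm_ideal)"
    using e by metis
  finally show ?thesis .
qed

lemma gl_invariantI:
  fixes f :: "('n::finite, 'k::field) adhm_poly"
  assumes "\<And>g. invertible g \<Longrightarrow> gl_act g f = f"
  shows "gl_invariant f"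
  unfolding gl_invariant_def using assms adhm_ideal_closed(2)[where 'n = 'n and 'k = 'k] by simp

lemma adhm_equations_at_point:
  fixes \<eta> :: "('n::finite, 'k::field) adhm_poly \<Rightarrow> 'k"
  assumes h: "is_hom \<eta>" and I: "\<And>f. f \<in> adhm_ideal \<Longrightarrow> \<eta> f = 0"
  defines "A \<equiv> map_mat \<eta> (generic_matrix I11)" and "B \<equiv> map_mat \<eta> (generic_matrix I12)"
    and "C \<equiv> map_mat \<eta> (generic_matrix I21)" and "D \<equiv> map_mat \<eta> (generic_matrix I22)"
  shows "A ** B = B ** A" "C ** D = D ** C" "A ** D - D ** A + (C ** B - B ** C) = 0"
proof -
  have z: "map_mat \<eta> E = 0" if "E \<in> adhm_equations" for E
    using I[OF adhm_equations_in_ideal[OF that]] by (simp add: vec_eq_iff)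
  have c: "map_mat \<eta> (commutator P Q) = map_mat \<eta> P ** map_mat \<eta> Q - map_mat \<eta> Q ** map_mat \<eta> P" for P Q
    unfolding map_mat_mult[OF h, symmetric] by (simp add: vec_eq_iff commutator_def is_hom_simps h)
  have add: "map_mat \<eta> (P + Q) = map_mat \<eta> P + map_mat \<eta> Q" for P Q :: "('n, 'k) adhm_poly ^ 'n ^ 'n"
    by (simp add: vec_eq_iff is_hom_simps h)
  show "A ** B = B ** A"
    using z[of "commutator (generic_matrix I11) (generic_matrix I12)"]
    by (simp add: adhm_equations_def c A_def B_def)
  show "C ** D = D ** C"
    using z[of "commutator (generic_matrix I21) (generic_matrix I22)"]
    by (simp add: adhm_equations_def c C_def D_def)
  show "A ** D - D ** A + (C ** B - B ** C) = 0"
    using z[of "commutator (generic_matrix I11) (generic_matrix I22) + commutator (generic_matrix I21) (generic_matrix I12)"]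
    by (simp add: adhm_equations_def c add A_def B_def C_def D_def)
qed

text \<open>At a point where the invariant does not vanish, the four matrices are conjugate to diagonal ones,
  where the invariant function \<open>f\<close> has the same value, namely \<open>0\<close>.\<close>

lemma vanishes_at_points:
  fixes \<eta> :: "('n::finite, 'k::alg_closed_field) adhm_poly \<Rightarrow> 'k"
  assumes \<iota>: "bij_betw \<iota> (UNIV :: ('n \<times> 'n) set) {..<CARD('n) * CARD('n)}"
    and h: "is_hom \<eta>" "\<And>c. \<eta> (mconst c) = c" and I: "\<And>f. f \<in> adhm_ideal \<Longrightarrow> \<eta> f = 0"
    and f: "gl_invariant f" "diag_pullback f = 0"
  shows "\<eta> (diagonalizability_invariant \<iota> \<tau> * f) = 0"
proof (cases "\<eta> (diagonalizability_invariant \<iota> \<tau>) = 0")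
  case True
  then show ?thesis by (simp add: is_hom_simps h(1))
next
  case False
  have det: "det (sylvester_matrix \<iota> \<tau> (map_mat \<eta> (generic_matrix I11)) (map_mat \<eta> (generic_matrix I12))
     (map_mat \<eta> (generic_matrix I21)) (map_mat \<eta> (generic_matrix I22))) \<noteq> 0"
    using False unfolding diagonalizability_invariant_hom[OF h(1)] h(2) by simp
  obtain g g' :: "'k ^ 'n ^ 'n" where g: "g ** g' = mat 1" "g' ** g = mat 1"
    and "is_diag (g' ** map_mat \<eta> (generic_matrix I11) ** g)" "is_diag (g' ** map_mat \<eta> (generic_matrix I12) ** g)"
      "is_diag (g' ** map_mat \<eta> (generic_matrix I21) ** g)" "is_diag (g' ** map_mat \<eta> (generic_matrix I22) ** g)"
    by (rule commuting_pencils_diagonalizable[OF adhm_equations_at_point[OF h(1) I] \<iota> det]) assumption+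
  then have dg: "is_diag (g' ** map_mat \<eta> (generic_matrix a) ** g)" for a by (cases a) simp_all
  have inv: "invertible g'" using g unfolding invertible_def by blast
  have "matrix_inv g' = g ** (g' ** matrix_inv g')" by (simp add: matrix_mul_assoc g)
  then have gi: "matrix_inv g' = g" by (simp add: matrix_inv_mult inv)
  define y where "y = (\<lambda>(r, a). (g' ** map_mat \<eta> (generic_matrix a) ** g) $ r $ r)"
  have cm: "map_mat \<eta> (const_matrix P) = P" for P :: "'k ^ 'n ^ 'n"
    by (simp add: vec_eq_iff const_matrix_def h(2))
  have var: "\<eta> (gl_act g' (mvar (a, r, s))) = (g' ** map_mat \<eta> (generic_matrix a) ** g) $ r $ s" for a r s
  proof -
    have "\<eta> (gl_act g' (mvar (a, r, s))) = map_mat \<eta> (const_matrix g' ** generic_matrix a ** const_matrix g) $ r $ s"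
      unfolding gl_act_mvar gi by simp
    then show ?thesis by (simp add: map_mat_mult[OF h(1)] cm)
  qed
  have "\<eta> (gl_act g' f) = mpoly_eval y (diag_pullback f)"
  proof (rule is_hom_mpoly_eqI[of "\<lambda>f. \<eta> (gl_act g' f)" "\<lambda>f. mpoly_eval y (diag_pullback f)"])
    show "is_hom (\<lambda>f. \<eta> (gl_act g' f))" by (rule is_hom_comp[OF h(1) is_hom_gl_act])
    show "is_hom (\<lambda>f. mpoly_eval y (diag_pullback f))"
      by (rule is_hom_comp[OF mpoly_eval_simps(1) is_hom_diag_pullback])
    show "\<eta> (gl_act g' (mconst c)) = mpoly_eval y (diag_pullback (mconst c))" for c
      by (simp add: gl_act_def diag_pullback_def h(2) mpoly_eval_simps)
    fix v :: "adhm_index \<times> 'n \<times> 'n"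
    obtain a r s where v: "v = (a, r, s)" by (cases v)
    have "mpoly_eval y (diag_pullback (mvar v)) = (if r = s then y (r, a) else 0)"
      by (simp add: v diag_pullback_def mpoly_eval_simps is_hom_simps(4)[OF mpoly_eval_simps(1)])
    then show "\<eta> (gl_act g' (mvar v)) = mpoly_eval y (diag_pullback (mvar v))"
      using dg[of a] unfolding v var by (auto simp: y_def is_diag_def)
  qed
  then have "\<eta> (gl_act g' f) = 0" by (simp add: f(2) is_hom_simps(4)[OF mpoly_eval_simps(1)])
  moreover have "\<eta> (gl_act g' f - f) = 0"
    by (rule I) (use f(1) inv in \<open>simp add: gl_invariant_def\<close>)
  ultimately have "\<eta> f = 0" by (simp add: is_hom_simps h(1))
  then show ?thesis by (simp add: is_hom_simps h(1))
qed

lemma UNIV_adhm_index: "UNIV = {I11, I12, I21, I22}"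
  using adhm_index.exhaust by auto

instance adhm_index :: finite
  by standard (unfold UNIV_adhm_index, simp)

lemma CARD_adhm_index: "CARD(adhm_index) = 4"
  unfolding UNIV_adhm_index by simp

text \<open>Otherwise some prime above the ideal would avoid the powers of the product, and the product would
  not vanish at some point of this prime.\<close>

lemma power_in_adhm_ideal:
  fixes f :: "('n::finite, 'k::alg_closed_field) adhm_poly"
  assumes \<iota>: "bij_betw \<iota> (UNIV :: ('n \<times> 'n) set) {..<CARD('n) * CARD('n)}"
    and f: "gl_invariant f" "diag_pullback f = 0"
  shows "\<exists>n. (diagonalizability_invariant \<iota> \<tau> * f) ^ n \<in> adhm_ideal"
proof (rule ccontr)
  let ?u = "diagonalizability_invariant \<iota> \<tau> * f"
  assume no: "\<not> ?thesis"
  obtain P where P: "prime_in UNIV P" "adhm_ideal \<subseteq> P" "P \<inter> range (\<lambda>n. ?u ^ n) = {}"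
  proof (rule exists_prime_avoiding[OF ideal_in_adhm_ideal, of "range (\<lambda>n. ?u ^ n)"])
    show "adhm_ideal \<inter> range (\<lambda>n. ?u ^ n) = {}" using no by blast
    show "1 \<in> range (\<lambda>n. ?u ^ n)" by (rule range_eqI[of _ _ 0]) simp
    show "a * b \<in> range (\<lambda>n. ?u ^ n)" if ab: "a \<in> range (\<lambda>n. ?u ^ n)" "b \<in> range (\<lambda>n. ?u ^ n)" for a b
    proof -
      obtain i j where "a = ?u ^ i" "b = ?u ^ j" using ab by blast
      then have "a * b = ?u ^ (i + j)" by (simp add: power_add)
      then show ?thesis by blast
    qed
  qed
  have u: "?u \<notin> P" using P(3) by (metis disjoint_iff power_one_right rangeI)
  obtain \<eta> :: "('n, 'k) adhm_poly \<Rightarrow> 'k" where \<eta>: "is_hom \<eta>" "\<And>c. \<eta> (mconst c) = c"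
    "\<And>f. f \<in> P \<Longrightarrow> \<eta> f = 0" "\<eta> ?u \<noteq> 0"
    by (rule nullstellensatz_prime[OF P(1) u]) (rule that, simp_all)
  have "\<eta> ?u = 0" by (rule vanishes_at_points[OF \<iota> \<eta>(1,2) _ f]) (use \<eta>(3) P(2) in blast)
  with \<eta>(4) show False by simp
qed

lemma coset_in_M0_ring:
  "gl_invariant f \<Longrightarrow> (+) f ` (adhm_ideal :: ('n::finite, 'k::field) adhm_poly set) \<in> carrier M0_ring"
  using carrier_M0_ring by blast

lemma M0_ring_ops:
  fixes f g :: "('n::finite, 'k::field) adhm_poly"
  shows "(+) f ` adhm_ideal \<otimes>\<^bsub>M0_ring\<^esub> (+) g ` adhm_ideal = (+) (f * g) ` adhm_ideal"
    "(+) f ` adhm_ideal \<oplus>\<^bsub>M0_ring\<^esub> (+) g ` adhm_ideal = (+) (f + g) ` adhm_ideal"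
    "\<one>\<^bsub>M0_ring\<^esub> = (+) (1 :: ('n, 'k) adhm_poly) ` adhm_ideal"
  using adhm_ring_simps(2-4)[where 'n = 'n and 'k = 'k] by (simp_all add: M0_ring_def fixed_subring_def)

lemma hom_to_type_phi:
  "hom_to_type (M0_ring :: ('n::finite, 'k::field) adhm_poly set ring) phi_ring_hom"
proof (intro hom_to_type.intro hom_to_type_axioms.intro cring_M0_ring)
  show "phi_ring_hom (\<one>\<^bsub>M0_ring\<^esub> :: ('n, 'k) adhm_poly set) = 1"
    unfolding M0_ring_ops(3) phi_ring_hom_coset by simp
  fix F G :: "('n, 'k) adhm_poly set"
  assume "F \<in> carrier M0_ring" "G \<in> carrier M0_ring"
  then obtain f g where FG: "F = (+) f ` adhm_ideal" "G = (+) g ` adhm_ideal" unfolding carrier_M0_ring by blast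
  show "phi_ring_hom (F \<oplus>\<^bsub>M0_ring\<^esub> G) = phi_ring_hom F + phi_ring_hom G"
    unfolding FG M0_ring_ops(2) phi_ring_hom_coset by simp
  show "phi_ring_hom (F \<otimes>\<^bsub>M0_ring\<^esub> G) = phi_ring_hom F * phi_ring_hom G"
    unfolding FG M0_ring_ops(1) phi_ring_hom_coset by simp
qed

interpretation phi: hom_to_type "M0_ring :: ('n::finite, 'k::field) adhm_poly set ring" phi_ring_hom
  by (rule hom_to_type_phi)

lemma hom_to_type_SymA4:
  "hom_to_type (SymA4_ring :: ('n::finite, 'k::comm_ring_1) points_poly ring) (\<lambda>x. x)"
  by (intro hom_to_type.intro hom_to_type_axioms.intro cring_SymA4_ring) (simp_all add: SymA4_ring_def fixed_subring_def)

lemma gl_invariant_power_coset: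
  assumes q: "primeideal q M0_ring"
    and u: "gl_invariant u" and n: "(+) (u ^ n) ` adhm_ideal \<in> q"
  shows "(+) u ` (adhm_ideal :: ('n::finite, 'k::field) adhm_poly set) \<in> q"
  using n
proof (induction n)
  interpret q: primeideal q M0_ring by fact
  have pow: "gl_invariant (u ^ m)" for m
    unfolding gl_invariant_def
  proof (intro allI impI)
    fix g :: "'k ^ 'n ^ 'n" assume g: "invertible g"
    have "gl_act g (u ^ m) - u ^ m = (gl_act g u) ^ m - u ^ m" by (simp add: is_hom_power[OF is_hom_gl_act])
    also have "\<dots> = (gl_act g u - u) * (\<Sum>j<m. u ^ (m - Suc j) * gl_act g u ^ j)" by (rule power_diff_sumr2)
    also have "\<dots> \<in> adhm_ideal" using u g by (intro adhm_ideal_closed(4)) (simp add: gl_invariant_def)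
    finally show "gl_act g (u ^ m) - u ^ m \<in> adhm_ideal" .
  qed
  {
    case 0
    then show ?case using q.one_imp_carrier q.I_notcarr by (simp add: M0_ring_ops(3))
  next
    case (Suc n)
    have "(+) u ` adhm_ideal \<otimes>\<^bsub>M0_ring\<^esub> (+) (u ^ n) ` adhm_ideal \<in> q"
      using Suc.prems by (simp add: M0_ring_ops(1))
    then show ?case
      using q.I_prime[OF coset_in_M0_ring[OF u] coset_in_M0_ring[OF pow]] Suc.IH by blast
  }
qed

text \<open>Up to nilpotents, the diagonalizability invariant annihilates the kernel of the pullback.  As it
  lies outside the kernel, it lies outside \<open>q\<close>, so the prime \<open>q\<close> contains the kernel.\<close>

lemma kernel_minimal_prime:
  fixes q :: "('n::finite, 'k::alg_closed_field) adhm_poly set set"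
  assumes q: "primeideal q M0_ring" "q \<subseteq> phi.comap {0}"
  shows "q = phi.comap {0}"
proof
  interpret q: primeideal q M0_ring by fact
  have "finite (UNIV :: ('n \<times> 'n) set)" by simp
  then obtain \<iota> :: "'n \<times> 'n \<Rightarrow> nat" where "bij_betw \<iota> UNIV {0..<card (UNIV :: ('n \<times> 'n) set)}"
    using ex_bij_betw_finite_nat by blast
  then have \<iota>: "bij_betw \<iota> UNIV {..<CARD('n) * CARD('n)}" by (simp add: atLeast0LessThan)
  obtain \<tau> :: "bool \<times> 'n \<times> 'n \<Rightarrow> 'k" where \<tau>: "inj \<tau>" by (rule inj_finite_to_alg_closed)
  let ?s = "diagonalizability_invariant \<iota> \<tau>"
  have s: "gl_invariant ?s" by (rule gl_invariantI[OF gl_act_diagonalizability_invariant])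
  have "(+) ?s ` adhm_ideal \<notin> phi.comap {0}"
    using diag_pullback_diagonalizability_invariant[OF \<iota> \<tau>] by (simp add: phi.comap_def phi_ring_hom_coset)
  then have sq: "(+) ?s ` adhm_ideal \<notin> q" using q(2) by blast
  show "phi.comap {0} \<subseteq> q"
  proof
    fix F :: "('n, 'k) adhm_poly set" assume "F \<in> phi.comap {0}"
    then obtain f where f: "gl_invariant f" "F = (+) f ` adhm_ideal" "diag_pullback f = 0"
      by (auto simp: phi.comap_def carrier_M0_ring phi_ring_hom_coset)
    obtain n where n: "(?s * f) ^ n \<in> adhm_ideal" using power_in_adhm_ideal[OF \<iota> f(1,3)] by blast
    have sf: "gl_invariant (?s * f)"
      unfolding gl_invariant_def
    proof (intro allI impI)
      fix g :: "'k ^ 'n ^ 'n" assume g: "invertible g"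
      have "gl_act g (?s * f) - ?s * f = ?s * (gl_act g f - f)"
        by (simp add: gl_act_diagonalizability_invariant[OF g] right_diff_distrib)
      also have "\<dots> \<in> adhm_ideal" using f(1) g by (intro adhm_ideal_closed(3)) (simp add: gl_invariant_def)
      finally show "gl_act g (?s * f) - ?s * f \<in> adhm_ideal" .
    qed
    have "(+) ((?s * f) ^ n) ` adhm_ideal = (+) 0 ` adhm_ideal" using n by (simp only: coset_eq_iff diff_zero)
    also have "\<dots> = \<zero>\<^bsub>M0_ring\<^esub>"
    proof -
      have z: "(+) 0 ` adhm_ideal \<in> carrier (M0_ring :: ('n, 'k) adhm_poly set ring)"
        by (rule coset_in_M0_ring[OF gl_invariantI]) (simp add: is_hom_simps(4)[OF is_hom_gl_act])
      moreover have "(+) 0 ` adhm_ideal \<oplus>\<^bsub>M0_ring\<^esub> (+) 0 ` adhm_ideal = (+) (0 :: ('n, 'k) adhm_poly) ` adhm_ideal"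
        unfolding M0_ring_ops(2) by simp
      ultimately show ?thesis using phi.add.r_cancel_one by metis
    qed
    finally have z: "(+) ((?s * f) ^ n) ` adhm_ideal = \<zero>\<^bsub>M0_ring\<^esub>" .
    have "(+) ((?s * f) ^ n) ` adhm_ideal \<in> q" unfolding z by (rule q.zero_closed)
    then have "(+) (?s * f) ` adhm_ideal \<in> q" by (rule gl_invariant_power_coset[OF q(1) sf])
    then have "(+) ?s ` adhm_ideal \<otimes>\<^bsub>M0_ring\<^esub> (+) f ` adhm_ideal \<in> q" unfolding M0_ring_ops(1) .
    from q.I_prime[OF coset_in_M0_ring[OF s] coset_in_M0_ring[OF f(1)] this]
    show "F \<in> q" using sq by (simp add: f(2))
  qed
qed (rule q(2))

section \<open>Integrality over the ring of invariants\<close>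

lemma diag_pullback_in_image:
  assumes "gl_invariant f"
  shows "diag_pullback f \<in> phi_ring_hom ` carrier (M0_ring :: ('n::finite, 'k::field) adhm_poly set ring)"
  using coset_in_M0_ring[OF assms] phi_ring_hom_coset by (metis image_eqI)

lemma mconst_in_image:
  "mconst c \<in> phi_ring_hom ` carrier (M0_ring :: ('n::finite, 'k::field) adhm_poly set ring)"
proof -
  have "diag_pullback (mconst c :: ('n, 'k) adhm_poly) = mconst c" by (simp add: diag_pullback_def)
  moreover have "gl_invariant (mconst c :: ('n, 'k) adhm_poly)" by (rule gl_invariantI) (simp add: gl_act_def)
  ultimately show ?thesis by (metis diag_pullback_in_image)
qed

text \<open>The coordinates of the points are the roots of the characteristic polynomials of the four generic
  matrices, restricted to diagonal matrices; the coefficients of these polynomials are invariant.\<close>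

lemma mvar_relation:
  fixes l :: "'n::finite" and a :: adhm_index
  shows "\<exists>c. (\<forall>j. c j \<in> phi_ring_hom ` carrier (M0_ring :: ('n, 'k::field) adhm_poly set ring)) \<and>
    (mvar (l, a) :: ('n, 'k) points_poly) ^ CARD('n) = (\<Sum>j<CARD('n). c j * mvar (l, a) ^ j)"
proof -
  let ?S = "phi_ring_hom ` carrier (M0_ring :: ('n, 'k) adhm_poly set ring)"
  let ?G = "generic_matrix a :: ('n, 'k) adhm_poly ^ 'n ^ 'n"
  let ?p = "map_poly diag_pullback (charpoly ?G) :: ('n, 'k) points_poly poly"
  have c: "coeff ?p j = diag_pullback (coeff (charpoly ?G) j)" for j
    by (simp add: coeff_map_poly is_hom_simps(4)[OF is_hom_diag_pullback])
  have "gl_invariant (coeff (charpoly ?G) j)" for j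
  proof (rule gl_invariantI)
    fix g :: "'k ^ 'n ^ 'n" assume g: "invertible g"
    show "gl_act g (coeff (charpoly ?G) j) = coeff (charpoly ?G) j"
      unfolding coeff_charpoly_hom[OF is_hom_gl_act] map_mat_gl_act charpoly_conj[OF const_matrix_inv(1)[OF g]] ..
  qed
  then have S: "coeff ?p j \<in> ?S" for j unfolding c by (rule diag_pullback_in_image)
  have "map_mat diag_pullback ?G = diag_mat (\<lambda>r. mvar (r, a))"
    by (simp add: vec_eq_iff generic_matrix_def diag_pullback_def diag_mat_nth)
  then have p: "?p = charpoly (diag_mat (\<lambda>r. mvar (r, a)) :: ('n, 'k) points_poly ^ 'n ^ 'n)"
    by (simp add: charpoly_hom[OF is_hom_diag_pullback])
  have "poly ?p (mvar (l, a)) = 0"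
    unfolding p charpoly_diag poly_prod by (rule prod_zero) (auto intro!: bexI[of _ l])
  moreover have "degree ?p = CARD('n)" "coeff ?p (CARD('n)) = 1" unfolding p by (rule charpoly_monic)+
  ultimately have "(\<Sum>j<CARD('n). coeff ?p j * mvar (l, a) ^ j) + mvar (l, a) ^ CARD('n) = 0"
    unfolding poly_altdef lessThan_Suc_atMost[symmetric] by simp
  then have "mvar (l, a) ^ CARD('n) = (\<Sum>j<CARD('n). - coeff ?p j * mvar (l, a) ^ j)"
    by (simp add: sum_negf eq_neg_iff_add_eq_0 add.commute)
  moreover have "\<forall>j. - coeff ?p j \<in> ?S"
    by (intro allI subring_set_closed(4)[OF phi.subring_image] S)
  ultimately show ?thesis by (intro exI[of _ "\<lambda>j. - coeff ?p j"] conjI)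
qed

text \<open>The monomials with all exponents below \<open>c\<close> span the polynomial ring over the image, since the
  relations for the variables reduce higher powers.\<close>

lemma points_integral:
  fixes b :: "('n::finite, 'k::field) points_poly"
  shows "integral_over (phi_ring_hom ` carrier (M0_ring :: ('n, 'k) adhm_poly set ring)) b"
proof -
  define S where "S = phi_ring_hom ` carrier (M0_ring :: ('n, 'k) adhm_poly set ring)"
  have S: "subring_set S" unfolding S_def by (rule phi.subring_image)
  note Sc = subring_set_closed[OF S]
  obtain \<iota> :: "'n \<Rightarrow> nat" where "bij_betw \<iota> UNIV {0..<CARD('n)}"
    using ex_bij_betw_finite_nat[OF finite_class.finite_UNIV] by blast
  then have range: "range \<iota> = {0..<CARD('n)}" by (simp add: bij_betw_def)
  have \<iota>: "\<iota> i < CARD('n)" for i using range by (metis atLeastLessThan_iff rangeI)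
  have \<iota>ex: "\<exists>i. \<iota> i = j" if "j < CARD('n)" for j
  proof -
    have "j \<in> range \<iota>" using that by (simp add: range)
    then show ?thesis by blast
  qed
  define e :: "('n \<times> adhm_index \<Rightarrow> 'n) \<Rightarrow> ('n, 'k) points_poly"
    where "e = (\<lambda>\<phi>. \<Prod>v\<in>UNIV. mvar v ^ \<iota> (\<phi> v))"
  define N where "N = {b. \<exists>c. (\<forall>\<phi>. c \<phi> \<in> S) \<and> b = (\<Sum>\<phi>\<in>UNIV. c \<phi> * e \<phi>)}"
  have N0: "0 \<in> N" unfolding N_def using Sc(2) by (intro CollectI exI[of _ "\<lambda>_. 0"]) simp
  have Nadd: "x + y \<in> N" if xy: "x \<in> N" "y \<in> N" for x y
  proof -
    obtain c d where "\<forall>\<phi>. c \<phi> \<in> S" "x = (\<Sum>\<phi>\<in>UNIV. c \<phi> * e \<phi>)" "\<forall>\<phi>. d \<phi> \<in> S" "y = (\<Sum>\<phi>\<in>UNIV. d \<phi> * e \<phi>)"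
      using xy unfolding N_def by blast
    then show ?thesis unfolding N_def
      by (intro CollectI exI[of _ "\<lambda>\<phi>. c \<phi> + d \<phi>"]) (simp add: Sc(5) distrib_right sum.distrib)
  qed
  have Nsum: "sum F A \<in> N" if "\<And>x. x \<in> A \<Longrightarrow> F x \<in> N" for F and A :: "'z set"
    using that by (induction A rule: infinite_finite_induct) (auto simp: N0 Nadd)
  have Nscale: "s * x \<in> N" if sx: "s \<in> S" "x \<in> N" for s x
  proof -
    obtain c where "\<forall>\<phi>. c \<phi> \<in> S" "x = (\<Sum>\<phi>\<in>UNIV. c \<phi> * e \<phi>)" using sx unfolding N_def by blast
    then show ?thesis unfolding N_def using sx(1)
      by (intro CollectI exI[of _ "\<lambda>\<phi>. s * c \<phi>"]) (simp add: Sc(6) sum_distrib_left mult.assoc)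
  qed
  have Ne: "e \<phi> \<in> N" for \<phi>
    unfolding N_def using Sc(1,2)
    by (intro CollectI exI[of _ "\<lambda>\<psi>. if \<psi> = \<phi> then 1 else 0"]) (simp add: if_distrib[of "\<lambda>x. x * _"] cong: if_cong)
  have e_split: "e (\<phi>(v := i)) = mvar v ^ \<iota> i * (\<Prod>w\<in>UNIV - {v}. mvar w ^ \<iota> (\<phi> w))" for \<phi> v i
    unfolding e_def by (subst prod.remove[of _ v]) (auto intro!: arg_cong2[of _ _ _ _ "(*)"] prod.cong)
  have Npow: "mvar v ^ j * (\<Prod>w\<in>UNIV - {v}. mvar w ^ \<iota> (\<phi> w)) \<in> N" if j: "j < CARD('n)" for v j \<phi>
  proof -
    obtain i where "\<iota> i = j" using \<iota>ex[OF j] by blast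
    then show ?thesis using Ne[of "\<phi>(v := i)"] unfolding e_split by simp
  qed
  have Nvar_e: "mvar v * e \<phi> \<in> N" for v \<phi>
  proof -
    let ?r = "\<Prod>w\<in>UNIV - {v}. mvar w ^ \<iota> (\<phi> w)"
    have eq: "mvar v * e \<phi> = mvar v ^ Suc (\<iota> (\<phi> v)) * ?r"
      using e_split[of \<phi> v "\<phi> v"] by (simp add: mult.assoc)
    show ?thesis
    proof (cases "Suc (\<iota> (\<phi> v)) < CARD('n)")
      case True
      then show ?thesis unfolding eq by (rule Npow)
    next
      case False
      then have top: "Suc (\<iota> (\<phi> v)) = CARD('n)" using \<iota>[of "\<phi> v"] by simp
      obtain l a where v: "v = (l, a)" by (cases v)
      obtain c where c: "\<forall>j. c j \<in> S" "(mvar v :: ('n, 'k) points_poly) ^ CARD('n) = (\<Sum>j<CARD('n). c j * mvar v ^ j)"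
        using mvar_relation[of l a, where 'k = 'k] unfolding v S_def by (elim exE conjE)
      have "mvar v * e \<phi> = (\<Sum>j<CARD('n). c j * (mvar v ^ j * ?r))"
        unfolding eq top c(2) by (simp add: sum_distrib_right mult.assoc)
      also have "\<dots> \<in> N" by (intro Nsum Nscale c(1)[rule_format] Npow) simp
      finally show ?thesis .
    qed
  qed
  have Nvar: "mvar v * x \<in> N" if x: "x \<in> N" for v x
  proof -
    obtain c where c: "\<forall>\<phi>. c \<phi> \<in> S" "x = (\<Sum>\<phi>\<in>UNIV. c \<phi> * e \<phi>)" using x unfolding N_def by blast
    have "mvar v * x = (\<Sum>\<phi>\<in>UNIV. c \<phi> * (mvar v * e \<phi>))"
      unfolding c(2) by (simp add: sum_distrib_left mult.left_commute)
    also have "\<dots> \<in> N" using c(1) by (intro Nsum Nscale Nvar_e) simp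
    finally show ?thesis .
  qed
  have Nneg: "- x \<in> N" if "x \<in> N" for x using Nscale[OF Sc(4)[OF Sc(1)] that] by simp
  have "f \<in> {f. \<forall>x\<in>N. f * x \<in> N}" for f
  proof (rule mpoly_in_subring)
    have "x - y \<in> N" if "x \<in> N" "y \<in> N" for x y using Nadd[OF that(1) Nneg[OF that(2)]] by simp
    then show "subring_set {f. \<forall>x\<in>N. f * x \<in> N}"
      by (simp add: subring_set_def left_diff_distrib mult.assoc)
    have "mconst c \<in> S" for c unfolding S_def by (rule mconst_in_image)
    then show "range mconst \<subseteq> {f. \<forall>x\<in>N. f * x \<in> N}" by (auto intro: Nscale)
    show "range mvar \<subseteq> {f. \<forall>x\<in>N. f * x \<in> N}" by (auto intro: Nvar)
  qed
  then have all: "f * x \<in> N" if "x \<in> N" for f x using that by simp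
  have "(0::nat) < CARD('n)" by simp
  then obtain i0 where i0: "\<iota> i0 = 0" using \<iota>ex by blast
  then have e1: "e (\<lambda>_. i0) = 1" by (simp add: e_def)
  then have "f \<in> N" for f using all[OF Ne[of "\<lambda>_. i0"], of f] by simp
  then have "\<exists>c. (\<forall>\<phi>. c \<phi> \<in> S) \<and> f = (\<Sum>\<phi>\<in>UNIV. c \<phi> * e \<phi>)" for f
    unfolding N_def mem_Collect_eq .
  then show ?thesis unfolding S_def[symmetric] by (rule integral_over_finite[where e = e, OF S, OF e1])
qed

text \<open>A prime above the kernel is the contraction of a prime of the polynomial ring in the coordinates of
  the points, by lying over; this prime is contracted to the symmetric polynomials.\<close>

lemma image_phi:
  "phi ` topspace (SymA4 :: ('n::finite, 'k::field) points_poly set topology) =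
     zero_locus M0_ring (phi.comap {0})"
proof (intro equalityI subsetI)
  fix F assume "F \<in> phi ` topspace (SymA4 :: ('n, 'k) points_poly set topology)"
  then obtain Q :: "('n, 'k) points_poly set" where Q: "Q \<in> topspace SymA4" "F = phi Q" by blast
  have "primeideal Q SymA4_ring" using Q(1) by (simp add: SymA4_def topspace_Spec spectrum_def)
  then interpret Q: primeideal Q SymA4_ring .
  have "\<zero>\<^bsub>SymA4_ring\<^esub> = (0 :: ('n, 'k) points_poly)" by (simp add: SymA4_ring_def fixed_subring_def)
  then have "0 \<in> Q" using additive_subgroup.zero_closed[OF Q.additive_subgroup_axioms] by simp
  then have "phi.comap {0} \<subseteq> phi Q" by (auto simp: phi.comap_def phi_def)
  moreover have "phi Q \<in> spectrum M0_ring"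
    using phi_in_M0[OF Q(1)] by (simp add: M0_def topspace_Spec)
  ultimately show "F \<in> zero_locus M0_ring (phi.comap {0})" by (simp add: Q(2) zero_locus_def)
next
  fix q :: "('n, 'k) adhm_poly set set" assume "q \<in> zero_locus M0_ring (phi.comap {0})"
  then have q: "primeideal q M0_ring" "phi.comap {0} \<subseteq> q" by (simp_all add: zero_locus_def spectrum_def)
  let ?S = "phi_ring_hom ` carrier (M0_ring :: ('n, 'k) adhm_poly set ring)"
  have "ideal_in UNIV ({0} :: ('n, 'k) points_poly set)" by (simp add: ideal_in_def)
  moreover have "{0} \<inter> ?S \<subseteq> phi_ring_hom ` q"
    using ideal_in_closed(1)[OF prime_inD(1)[OF phi.prime_in_image(1)[OF q]]] by auto
  ultimately obtain Q' where Q': "prime_in UNIV Q'" "Q' \<inter> ?S = phi_ring_hom ` q"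
    by (rule lying_over[OF phi.subring_image points_integral phi.prime_in_image(1)[OF q]])
  interpret sym: hom_to_type "SymA4_ring :: ('n, 'k) points_poly ring" "\<lambda>x. x" by (rule hom_to_type_SymA4)
  let ?Q = "Q' \<inter> carrier SymA4_ring"
  have "prime_in (carrier SymA4_ring) ?Q"
    using prime_in_contract[OF sym.subring_image Q'(1)] by simp
  then have "primeideal (sym.comap ?Q) SymA4_ring" by (intro sym.primeideal_comap) simp
  moreover have "sym.comap ?Q = ?Q" by (auto simp: sym.comap_def)
  ultimately have "?Q \<in> topspace SymA4" by (simp add: SymA4_def topspace_Spec spectrum_def)
  moreover have "phi ?Q = q"
  proof -
    have "phi_ring_hom F \<in> carrier SymA4_ring" if "F \<in> carrier M0_ring" for F :: "('n, 'k) adhm_poly set"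
      by (rule ring_hom_closed[OF phi_ring_hom that])
    then have "phi ?Q = {F \<in> carrier M0_ring. phi_ring_hom F \<in> Q'}" by (auto simp: phi_def)
    also have "\<dots> = phi.comap (phi_ring_hom ` q)" unfolding Q'(2)[symmetric] by (auto simp: phi.comap_def)
    also have "\<dots> = q" by (rule phi.prime_in_image(2)[OF q])
    finally show ?thesis .
  qed
  ultimately show "q \<in> phi ` topspace (SymA4 :: ('n, 'k) points_poly set topology)" by blast
qed

theorem proposition5p7:
  shows "irreducible_component
           (M0 :: ('n::finite, 'k::alg_closed_field) adhm_poly set set topology)
           (phi ` topspace SymA4)
       \<and> krull_dim (subtopology
           (M0 :: ('n, 'k) adhm_poly set set topology)
           (phi ` topspace SymA4)) = enat (4 * CARD('n))"
proof
  have prime: "primeideal (phi.comap {0}) (M0_ring :: ('n, 'k) adhm_poly set ring)"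
    by (rule phi.primeideal_comap[OF phi.prime_in_zero[OF prime_in_zero_mpoly]])
  show "irreducible_component (M0 :: ('n, 'k) adhm_poly set set topology) (phi ` topspace SymA4)"
    unfolding image_phi M0_def
    by (rule irreducible_component_zero_locus[OF cring_M0_ring prime]) (rule kernel_minimal_prime)
  obtain Q :: "nat \<Rightarrow> ('n, 'k) points_poly set"
    where Q: "\<And>i. i \<le> CARD('n \<times> adhm_index) \<Longrightarrow> prime_in UNIV (Q i)"
      "\<And>i. i < CARD('n \<times> adhm_index) \<Longrightarrow> Q i \<subset> Q (Suc i)"
    using mpoly_prime_chain[where 'v = "'n \<times> adhm_index" and 'k = 'k] by metis
  have "krull_dim (subtopology (M0 :: ('n, 'k) adhm_poly set set topology) (phi ` topspace SymA4))
      = enat (CARD('n \<times> adhm_index))"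
    unfolding image_phi M0_def by (rule phi.krull_dim_kernel[where Q = Q])
      (fact points_integral Q mpoly_chain_bound)+
  then show "krull_dim (subtopology (M0 :: ('n, 'k) adhm_poly set set topology) (phi ` topspace SymA4))
      = enat (4 * CARD('n))"
    by (simp add: card_cartesian_product CARD_adhm_index mult.commute flip: UNIV_Times_UNIV)
qed

end
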